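(* Let $k\geq 2$ be an integer. Let $G$ be a $2$-connected graph of minimum degree at least $k$ that contains a triangle $K_3$. Then either $G$ is isomorphic to $K_{k+1}$, or $G$ contains $k$ cycles of consecutive lengths, i.e. there is an integer $\ell$ such that $G$ contains cycles of lengths $\ell,\ell+1,\ldots,\ell+k-1$.
   Context: Graphs are finite and simple; the length of a cycle is its number of edges. *)

theory Defs
  imports Main
begin

definition simple_graph :: "'a set \<Rightarrow> ('a \<Rightarrow> 'a \<Rightarrow> bool) \<Rightarrow> bool" where
  "simple_graph V E \<longleftrightarrow> finite V \<and> (\<forall>x y. E x y \<longrightarrow> x \<in> V \<and> y \<in> V)
     \<and> (\<forall>x y. E x y \<longrightarrow> E y x) \<and> (\<forall>x. \<not> E x x)"

definition degree :: "('a \<Rightarrow> 'a \<Rightarrow> bool) \<Rightarrow> 'a \<Rightarrow> nat" where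
  "degree E v = card {u. E v u}"

definition min_degree_ge :: "'a set \<Rightarrow> ('a \<Rightarrow> 'a \<Rightarrow> bool) \<Rightarrow> nat \<Rightarrow> bool" where
  "min_degree_ge V E k \<longleftrightarrow> (\<forall>v\<in>V. degree E v \<ge> k)"

definition connected_on :: "'a set \<Rightarrow> ('a \<Rightarrow> 'a \<Rightarrow> bool) \<Rightarrow> bool" where
  "connected_on S E \<longleftrightarrow> S \<noteq> {} \<and>
     (\<forall>u\<in>S. \<forall>w\<in>S. (\<lambda>x y. E x y \<and> x \<in> S \<and> y \<in> S)\<^sup>*\<^sup>* u w)"

definition two_connected :: "'a set \<Rightarrow> ('a \<Rightarrow> 'a \<Rightarrow> bool) \<Rightarrow> bool" where
  "two_connected V E \<longleftrightarrow> card V \<ge> 3 \<and> connected_on V E \<and>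
     (\<forall>v\<in>V. connected_on (V - {v}) E)"

definition is_cycle :: "'a set \<Rightarrow> ('a \<Rightarrow> 'a \<Rightarrow> bool) \<Rightarrow> 'a list \<Rightarrow> bool" where
  "is_cycle V E cs \<longleftrightarrow> length cs \<ge> 3 \<and> distinct cs \<and> set cs \<subseteq> V \<and>
     (\<forall>i < length cs - 1. E (cs ! i) (cs ! Suc i)) \<and> E (last cs) (hd cs)"

definition has_cycle_of_length :: "'a set \<Rightarrow> ('a \<Rightarrow> 'a \<Rightarrow> bool) \<Rightarrow> nat \<Rightarrow> bool" where
  "has_cycle_of_length V E n \<longleftrightarrow> (\<exists>cs. is_cycle V E cs \<and> length cs = n)"

definition complete_verts :: "nat \<Rightarrow> nat set" where
  "complete_verts n = {..<n}"

definition complete_edges :: "nat \<Rightarrow> nat \<Rightarrow> bool" where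
  "complete_edges x y \<longleftrightarrow> x \<noteq> y"

definition graph_iso :: "'a set \<Rightarrow> ('a \<Rightarrow> 'a \<Rightarrow> bool) \<Rightarrow> 'b set \<Rightarrow> ('b \<Rightarrow> 'b \<Rightarrow> bool) \<Rightarrow> bool" where
  "graph_iso V1 E1 V2 E2 \<longleftrightarrow> (\<exists>f. bij_betw f V1 V2 \<and>
     (\<forall>x\<in>V1. \<forall>y\<in>V1. E1 x y \<longleftrightarrow> E2 (f x) (f y)))"

end

theory Submission
  imports Defs
begin

text \<open>
  The engine is the theorem of Gao, Huo, Liu and Ma: if \<open>G + xy\<close> is 2-connected and all vertices
  other than \<open>x, y\<close> have degree at least \<open>k + 1\<close>, then there are \<open>k\<close> paths from \<open>x\<close> to \<open>y\<close>
  whose lengths form an arithmetic progression of difference 1 or 2.  In a minimal counterexample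
  one picks a core \<open>H\<close> at \<open>x\<close> and a set \<open>A \<subseteq> H\<close> such that \<open>x\<close> reaches every vertex of \<open>A\<close> inside \<open>H\<close>
  by paths of \<open>r\<close> lengths in progression, while deleting \<open>H - A\<close> and contracting \<open>A\<close> lowers degrees by
  at most \<open>r - 1\<close>; induction on the contracted graph and addition of the two progressions finish.
  The core is a maximum clique through \<open>x\<close>; if \<open>x\<close> is in no triangle, \<open>x\<close> with one or two neighbours
  complete to a maximum clique; and if no triangle comes that close, a complete bipartite graph.
  Whenever contraction destroys 2-connectivity, or \<open>y\<close> has all its neighbours in the core, there is a
  small separator and another choice of the two roots works.

  For the cycles, take a maximum clique \<open>K\<close> and contract all but one of its vertices in the same
  way.  The clique supplies consecutive lengths, so the progression becomes consecutive even when its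
  difference is 2.  One length is missing exactly when some outside vertex is adjacent to all of \<open>K\<close>
  but one vertex \<open>x\<close>; adding this vertex to the core and rooting at \<open>x\<close> recovers it.
\<close>

text \<open>The bound \<open>r - 1\<close> is a budget. Contraction then leaves a degree bound good
  for \<open>m = k + 1 - r\<close> paths, and an \<open>m\<close>-term and an \<open>r\<close>-term
  progression add up to \<open>m + r - 1 = k\<close> terms. Extremality of the core keeps the loss
  within budget: a vertex seeing too much of the core could be added to it. Parity limits the
  addition: a progression of step 1 fills the holes of one of step 2 only if it has two terms,
  whence \<open>2 \<le> r\<close> when \<open>e = 1\<close>. The main obstacle is a gap: a set
  \<open>Z\<close> that hangs on a single vertex \<open>c\<close> of the remaining region and
  otherwise sees only \<open>H - A\<close>, so that contracting \<open>A\<close> makes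
  \<open>c\<close> a cut vertex. A second contraction then works inside \<open>Z\<close>, with
  \<open>c\<close> or \<open>x\<close> as a root, while core and region supply connecting paths.
  Once gaps are excluded, all neighbours of \<open>y\<close> lie in the core. The hypotheses are
  symmetric in the roots, and the statement with the roots exchanged then forces
  \<open>nbrs E x = nbrs E y\<close>. Either the common neighbours form a forbidden 2-cut, or one of
  them replaces \<open>y\<close> as the target.\<close>

definition has_path :: "('a \<Rightarrow> 'a \<Rightarrow> bool) \<Rightarrow> 'a set \<Rightarrow> 'a \<Rightarrow> 'a \<Rightarrow> nat \<Rightarrow> bool" where
  "has_path E S u v n \<longleftrightarrow> (\<exists>p. p \<noteq> [] \<and> hd p = u \<and> last p = v \<and> distinct p \<and> set p \<subseteq> S
     \<and> successively E p \<and> length p = Suc n)"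

definition nbrs :: "('a \<Rightarrow> 'a \<Rightarrow> bool) \<Rightarrow> 'a \<Rightarrow> 'a set" where
  "nbrs E v = {u. E v u}"

definition boundary :: "('a \<Rightarrow> 'a \<Rightarrow> bool) \<Rightarrow> 'a set \<Rightarrow> 'a set" where
  "boundary E W = {u. u \<notin> W \<and> (\<exists>w\<in>W. E w u)}"

text \<open>For symmetric \<open>E\<close> and \<open>y \<in> S\<close> this is the connected
  component of \<open>y\<close> in the graph induced on \<open>S\<close>.\<close>

definition reach :: "('a \<Rightarrow> 'a \<Rightarrow> bool) \<Rightarrow> 'a set \<Rightarrow> 'a \<Rightarrow> 'a set" where
  "reach E S y = {v. \<exists>n. has_path E S v y n}"

text \<open>Connectivity of \<open>D\<close>, seen from \<open>y\<close>.\<close>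

definition anchored :: "('a \<Rightarrow> 'a \<Rightarrow> bool) \<Rightarrow> 'a set \<Rightarrow> 'a \<Rightarrow> bool" where
  "anchored E D y \<longleftrightarrow> y \<in> D \<and> (\<forall>W. W \<noteq> {} \<and> W \<subseteq> D - {y} \<longrightarrow> boundary E W \<inter> D \<noteq> {})"

text \<open>2-connectivity of \<open>G + xy\<close>: the vertex sets avoiding both roots have at least two outer neighbours.\<close>

definition rooted :: "'a set \<Rightarrow> ('a \<Rightarrow> 'a \<Rightarrow> bool) \<Rightarrow> 'a \<Rightarrow> 'a \<Rightarrow> bool" where
  "rooted V E x y \<longleftrightarrow> simple_graph V E \<and> x \<in> V \<and> y \<in> V \<and> x \<noteq> y
     \<and> (\<forall>W. W \<noteq> {} \<and> W \<subseteq> V - {x, y} \<longrightarrow> 2 \<le> card (boundary E W))"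

text \<open>The lower bound 2 rules out the edge between the roots. It also ensures that closing
  such a path by one of length at least 1 gives a genuine cycle.\<close>

definition admissible :: "('a \<Rightarrow> 'a \<Rightarrow> bool) \<Rightarrow> 'a set \<Rightarrow> 'a \<Rightarrow> 'a \<Rightarrow> nat \<Rightarrow> bool" where
  "admissible E S x y k \<longleftrightarrow> (\<exists>a d. 2 \<le> a \<and> d \<in> {1, 2} \<and> (\<forall>i<k. has_path E S x y (a + d * i)))"

definition clique :: "('a \<Rightarrow> 'a \<Rightarrow> bool) \<Rightarrow> 'a set \<Rightarrow> bool" where
  "clique E K \<longleftrightarrow> (\<forall>u\<in>K. \<forall>v\<in>K. u \<noteq> v \<longrightarrow> E u v)"

lemma nbrs_iff [simp]: "u \<in> nbrs E v \<longleftrightarrow> E v u"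
  by (simp add: nbrs_def)

lemma degree_eq_card_nbrs: "degree E v = card (nbrs E v)"
  by (simp add: degree_def nbrs_def)

lemma boundaryI: "w \<in> W \<Longrightarrow> E w u \<Longrightarrow> u \<notin> W \<Longrightarrow> u \<in> boundary E W"
  by (auto simp: boundary_def)

lemma boundary_singleton: "\<not> E w w \<Longrightarrow> boundary E {w} = nbrs E w"
  by (auto simp: boundary_def)

lemma simple_graphD:
  assumes "simple_graph V E"
  shows "finite V" "E u v \<Longrightarrow> u \<in> V" "E u v \<Longrightarrow> v \<in> V" "E u v \<Longrightarrow> E v u" "\<not> E u u"
  using assms by (auto simp: simple_graph_def)

lemma boundary_subset: "simple_graph V E \<Longrightarrow> boundary E W \<subseteq> V - W"
  by (auto simp: boundary_def simple_graph_def)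

lemma finite_boundary: "simple_graph V E \<Longrightarrow> finite (boundary E W)"
  by (meson boundary_subset finite_Diff finite_subset simple_graphD(1))

lemma nbrs_subset: "simple_graph V E \<Longrightarrow> nbrs E v \<subseteq> V"
  by (auto simp: simple_graph_def)

lemma finite_nbrs: "simple_graph V E \<Longrightarrow> finite (nbrs E v)"
  by (meson nbrs_subset finite_subset simple_graphD(1))

section \<open>Paths\<close>

lemma has_path_mono: "has_path E S u v n \<Longrightarrow> S \<subseteq> S' \<Longrightarrow> has_path E S' u v n"
  unfolding has_path_def by blast

lemma has_path_mono_edges:
  assumes "has_path E S u v n" "\<And>a b. E a b \<Longrightarrow> a \<in> S \<Longrightarrow> b \<in> S \<Longrightarrow> E' a b"
  shows "has_path E' S u v n"
proof -
  obtain p where p: "p \<noteq> []" "hd p = u" "last p = v" "distinct p" "set p \<subseteq> S"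
      "successively E p" "length p = Suc n"
    using assms(1) unfolding has_path_def by blast
  have "successively E' p"
    using p(6) by (rule successively_mono) (use p(5) assms(2) in auto)
  then show ?thesis unfolding has_path_def using p by blast
qed

lemma has_path_ends: "has_path E S u v n \<Longrightarrow> u \<in> S" "has_path E S u v n \<Longrightarrow> v \<in> S"
  unfolding has_path_def by (metis hd_in_set subsetD, metis last_in_set subsetD)

lemma has_path_refl: "u \<in> S \<Longrightarrow> has_path E S u u 0"
  unfolding has_path_def by (rule exI[of _ "[u]"]) simp

lemma has_path_edge: "E u v \<Longrightarrow> u \<noteq> v \<Longrightarrow> u \<in> S \<Longrightarrow> v \<in> S \<Longrightarrow> has_path E S u v 1"
  unfolding has_path_def by (rule exI[of _ "[u, v]"]) simp

lemma has_path_join: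
  assumes "has_path E S1 u v n" "has_path E S2 v w m" "S1 \<inter> S2 \<subseteq> {v}" "S1 \<union> S2 \<subseteq> S"
  shows "has_path E S u w (n + m)"
proof -
  obtain p where p: "p \<noteq> []" "hd p = u" "last p = v" "distinct p" "set p \<subseteq> S1"
      "successively E p" "length p = Suc n"
    using assms(1) unfolding has_path_def by blast
  obtain q where q: "q \<noteq> []" "hd q = v" "last q = w" "distinct q" "set q \<subseteq> S2"
      "successively E q" "length q = Suc m"
    using assms(2) unfolding has_path_def by blast
  obtain q' where q': "q = v # q'" using q(1,2) by (cases q) auto
  have "distinct (p @ q')" using p q(4,5) assms(3) q' by auto
  moreover have "successively E (p @ q')"
    using p(3,6) q(6) q' by (cases q') (auto simp: successively_append_iff)
  moreover have "last (p @ q') = w" using q(3) q' p(3) by (cases q') auto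
  moreover have "set (p @ q') \<subseteq> S" using p(5) q(5) q' assms(4) by auto
  moreover have "length (p @ q') = Suc (n + m)" using p(7) q(7) q' by simp
  ultimately show ?thesis unfolding has_path_def using p(1,2)
    by (intro exI[of _ "p @ q'"]) auto
qed

lemma has_path_sym:
  assumes "has_path E S u v n" "\<And>a b. E a b \<Longrightarrow> E b a"
  shows "has_path E S v u n"
proof -
  obtain p where p: "p \<noteq> []" "hd p = u" "last p = v" "distinct p" "set p \<subseteq> S"
      "successively E p" "length p = Suc n"
    using assms(1) unfolding has_path_def by blast
  have "successively E (rev p)"
    unfolding successively_rev using p(6) by (rule successively_mono) (use assms(2) in auto)
  then show ?thesis unfolding has_path_def using p
    by (intro exI[of _ "rev p"]) (auto simp: hd_rev last_rev)
qed

lemma has_path_Cons: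
  assumes "E w u" "has_path E S u v n" "w \<notin> S"
  shows "has_path E (insert w S) w v (Suc n)"
proof -
  have u: "u \<in> S" using assms(2) by (rule has_path_ends)
  then have "w \<noteq> u" using assms(3) by blast
  then have "has_path E {w, u} w u 1" using assms(1) by (intro has_path_edge) auto
  from has_path_join[OF this assms(2), of "insert w S"] show ?thesis using u assms(3) by auto
qed

lemma has_path_suffix:
  assumes "p \<noteq> []" "last p = v" "distinct p" "set p \<subseteq> S" "successively E p" "w \<in> set p"
  shows "\<exists>n. has_path E S w v n"
proof -
  obtain p1 p2 where p: "p = p1 @ w # p2" using assms(6) split_list by fast
  show ?thesis unfolding has_path_def
    by (rule exI[of _ "length p2"], rule exI[of _ "w # p2"])
      (use assms p in \<open>auto simp: successively_append_iff\<close>)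
qed

lemma has_path_extend:
  assumes "E w u" "has_path E S u v n" "w \<in> S"
  shows "\<exists>n. has_path E S w v n"
proof -
  obtain p where p: "p \<noteq> []" "hd p = u" "last p = v" "distinct p" "set p \<subseteq> S"
      "successively E p" "length p = Suc n"
    using assms(2) unfolding has_path_def by blast
  show ?thesis
  proof (cases "w \<in> set p")
    case True
    then show ?thesis using has_path_suffix p by metis
  next
    case False
    then have "has_path E S w v (Suc n)" unfolding has_path_def using p assms
      by (intro exI[of _ "w # p"]) (auto simp: successively_Cons)
    then show ?thesis by blast
  qed
qed

lemma anchored_path:
  assumes "anchored E D y" "v \<in> D"
  shows "\<exists>n. has_path E D v y n"
proof (rule ccontr)
  assume neg: "\<not> ?thesis"
  define W where "W = {w \<in> D. \<not> (\<exists>n. has_path E D w y n)}"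
  have "y \<in> D" using assms(1) by (simp add: anchored_def)
  then have "y \<notin> W" using has_path_refl[of y D E] by (auto simp: W_def)
  then have "W \<noteq> {}" "W \<subseteq> D - {y}" using neg assms(2) by (auto simp: W_def)
  then obtain u where "u \<in> boundary E W" "u \<in> D"
    using assms(1) unfolding anchored_def by blast
  then obtain w where w: "w \<in> W" "E w u" "u \<notin> W" by (auto simp: boundary_def)
  then obtain n where "has_path E D u y n" using \<open>u \<in> D\<close> by (auto simp: W_def)
  then show False using has_path_extend[of E w u D y n] w by (auto simp: W_def)
qed

lemma reach_subset: "reach E S y \<subseteq> S"
  by (auto simp: reach_def dest: has_path_ends)

lemma reach_self: "y \<in> S \<Longrightarrow> y \<in> reach E S y"
  by (auto simp: reach_def intro: has_path_refl)

lemma reach_step: "v \<in> reach E S y \<Longrightarrow> E u v \<Longrightarrow> u \<in> S \<Longrightarrow> u \<in> reach E S y"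
  by (auto simp: reach_def intro: has_path_extend)

lemma path_leaves:
  assumes "successively E p" "p \<noteq> []" "hd p \<in> W" "last p \<notin> W"
  shows "\<exists>a b. a \<in> W \<and> b \<notin> W \<and> E a b \<and> b \<in> set p"
  using assms
proof (induction p)
  case (Cons a p)
  have p: "p \<noteq> []" using Cons.prems by auto
  then have E: "E a (hd p)" "successively E p" using Cons.prems by (auto simp: successively_Cons)
  show ?case
  proof (cases "hd p \<in> W")
    case True
    then show ?thesis using Cons.IH E p Cons.prems by (metis last_ConsR list.set_intros(2))
  next
    case False
    then show ?thesis using E p Cons.prems by (metis hd_in_set list.sel(1) list.set_intros(2))
  qed
qed simp

lemma reach_anchored:
  assumes "y \<in> S"
  shows "anchored E (reach E S y) y"
  unfolding anchored_def
proof (intro conjI allI impI)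
  show "y \<in> reach E S y" using assms by (rule reach_self)
  fix W assume W: "W \<noteq> {} \<and> W \<subseteq> reach E S y - {y}"
  then obtain w where "w \<in> W" "w \<in> reach E S y" by blast
  then obtain n where w: "w \<in> W" "has_path E S w y n" by (auto simp: reach_def)
  then obtain p where p: "p \<noteq> []" "hd p = w" "last p = y" "distinct p" "set p \<subseteq> S"
      "successively E p" unfolding has_path_def by blast
  then obtain a b where ab: "a \<in> W" "b \<notin> W" "E a b" "b \<in> set p"
    using path_leaves[of E p W] W w by auto
  then have "b \<in> reach E S y" using has_path_suffix[of p y S E b] p by (auto simp: reach_def)
  then show "boundary E W \<inter> reach E S y \<noteq> {}" using ab by (auto simp: boundary_def)
qed

section \<open>Paths in cliques and complete bipartite graphs\<close>

lemma clique_subset: "clique E K \<Longrightarrow> K' \<subseteq> K \<Longrightarrow> clique E K'"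
  by (auto simp: clique_def)

lemma clique_path:
  assumes "finite K" "clique E K" "u \<in> K" "v \<in> K" "u \<noteq> v" "1 \<le> n" "n < card K"
  shows "has_path E K u v n"
  using assms
proof (induction n arbitrary: u K)
  case (Suc n)
  show ?case
  proof (cases "n = 0")
    case True
    then show ?thesis using Suc has_path_edge[of E u v K] by (auto simp: clique_def)
  next
    case False
    have "card {u, v} < card K" using Suc.prems False by auto
    then obtain w where w: "w \<in> K" "w \<noteq> u" "w \<noteq> v"
      by (metis card_mono finite.emptyI finite_insert insertCI leD subsetI)
    have "has_path E (K - {u}) w v n"
      using Suc w False by (intro Suc.IH) (auto intro: clique_subset)
    then have "has_path E (insert u (K - {u})) u v (Suc n)"
      by (intro has_path_Cons[of E u w]) (use Suc w in \<open>auto simp: clique_def\<close>)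
    then show ?thesis using Suc by (simp add: insert_absorb)
  qed
qed simp

lemma bipartite_path_opposite:
  assumes "finite S" "finite T" "\<And>u v. u \<in> S \<Longrightarrow> v \<in> T \<Longrightarrow> E u v \<and> E v u" "S \<inter> T = {}"
    and "u \<in> S" "v \<in> T" "n < card S" "n < card T"
  shows "has_path E (S \<union> T) u v (1 + 2 * n)"
  using assms
proof (induction n arbitrary: u S T)
  case 0
  then show ?case using has_path_edge[of E u v "S \<union> T"] by auto
next
  case (Suc n)
  have "card {v} < card T" "card {u} < card S" using Suc.prems by auto
  then obtain t s where ts: "t \<in> T" "t \<noteq> v" "s \<in> S" "s \<noteq> u"
    by (metis card_mono finite.emptyI finite_insert insertCI leD subsetI)
  have "has_path E ((S - {u}) \<union> (T - {t})) s v (1 + 2 * n)"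
    by (rule Suc.IH) (use Suc ts in auto)
  then have "has_path E (insert t ((S - {u}) \<union> (T - {t}))) t v (Suc (1 + 2 * n))"
    by (intro has_path_Cons[of E t s]) (use Suc ts in auto)
  then have "has_path E (insert u (insert t ((S - {u}) \<union> (T - {t})))) u v (Suc (Suc (1 + 2 * n)))"
    by (intro has_path_Cons[of E u t]) (use Suc ts in auto)
  then show ?case using Suc.prems(5) ts
    by (auto elim!: has_path_mono)
qed

lemma bipartite_path_same:
  assumes "finite S" "finite T" "\<And>u v. u \<in> S \<Longrightarrow> v \<in> T \<Longrightarrow> E u v \<and> E v u" "S \<inter> T = {}"
    and "u \<in> S" "v \<in> S" "u \<noteq> v" "Suc n < card S" "n < card T"
  shows "has_path E (S \<union> T) u v (2 + 2 * n)"
proof -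
  have "card T > 0" using assms by auto
  then obtain t where t: "t \<in> T" by (metis card.empty ex_in_conv less_irrefl)
  have "has_path E (T \<union> (S - {u})) t v (1 + 2 * n)"
    by (rule bipartite_path_opposite) (use assms t in auto)
  then have "has_path E (insert u (T \<union> (S - {u}))) u v (Suc (1 + 2 * n))"
    by (intro has_path_Cons[of E u t]) (use assms t in auto)
  then show ?thesis using assms(5) by (auto elim!: has_path_mono)
qed

section \<open>Rooted graphs\<close>

lemma rooted_simple: "rooted V E x y \<Longrightarrow> simple_graph V E"
  by (simp add: rooted_def)

lemma rooted_sym: "rooted V E x y \<Longrightarrow> rooted V E y x"
  by (auto simp: rooted_def insert_commute)

lemma rooted_boundary:
  "rooted V E x y \<Longrightarrow> W \<noteq> {} \<Longrightarrow> W \<subseteq> V - {x, y} \<Longrightarrow> 2 \<le> card (boundary E W)"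
  by (simp add: rooted_def)

lemma card_le_1_of_subset_singleton: "S \<subseteq> {v} \<Longrightarrow> card S \<le> 1"
  by (metis card.empty card_mono finite.emptyI finite_insert is_singletonI is_singleton_altdef)

lemma rooted_boundary_singleton:
  assumes "rooted V E x y" "W \<subseteq> V - {x, y}" "boundary E W \<subseteq> {v}"
  shows "W = {}"
  using rooted_boundary[OF assms(1) _ assms(2)] card_le_1_of_subset_singleton[OF assms(3)] by force

text \<open>If \<open>x\<close> cannot reach \<open>y\<close>, the component of \<open>y\<close>
  without \<open>y\<close>, and its complement without \<open>x\<close>, have at most one outer
  neighbour each. Both are then empty, and no third vertex remains.\<close>

lemma rooted_path_exists:
  assumes "rooted V E x y" "V - {x, y} \<noteq> {}"
  shows "\<exists>n. has_path E V x y n"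
proof (rule ccontr)
  assume neg: "\<not> ?thesis"
  note sg = simple_graphD[OF rooted_simple[OF assms(1)]]
  let ?M = "reach E V y"
  have x: "x \<notin> ?M" using neg by (auto simp: reach_def)
  have MV: "?M \<subseteq> V" by (rule reach_subset)
  have step: "u \<in> ?M" if "v \<in> ?M" "E v u" for u v
    using reach_step[OF that(1)] sg that(2) by blast
  have "?M - {y} = {}"
    by (rule rooted_boundary_singleton[OF assms(1), of _ y])
      (use MV x step in \<open>auto simp: boundary_def\<close>)
  moreover have "V - ?M - {x} = {}"
  proof (rule rooted_boundary_singleton[OF assms(1), of _ x])
    show "V - ?M - {x} \<subseteq> V - {x, y}"
      using assms(1) reach_self[of y V E] by (auto simp: rooted_def)
    show "boundary E (V - ?M - {x}) \<subseteq> {x}"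
    proof
      fix u assume "u \<in> boundary E (V - ?M - {x})"
      then obtain w where w: "w \<in> V" "w \<notin> ?M" "E w u" "u \<notin> V - ?M - {x}"
        by (auto simp: boundary_def)
      then have "u \<notin> ?M" using step sg(4) by blast
      then show "u \<in> {x}" using w sg(3) by blast
    qed
  qed
  ultimately show False using assms(2) by blast
qed

text \<open>Keeps the list itself instead of its length, because rerouting and cutting need the
  vertices.\<close>

definition is_path :: "('a \<Rightarrow> 'a \<Rightarrow> bool) \<Rightarrow> 'a set \<Rightarrow> 'a \<Rightarrow> 'a \<Rightarrow> 'a list \<Rightarrow> bool" where
  "is_path E S u v p \<longleftrightarrow> p \<noteq> [] \<and> hd p = u \<and> last p = v \<and> distinct p \<and> set p \<subseteq> S \<and> successively E p"

lemma is_path_reroute: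
  assumes "is_path E S x y (p1 @ a # p2 @ b # p3)" "q \<noteq> []" "distinct q" "set q \<subseteq> S"
    "set q \<inter> set (p1 @ a # p2 @ b # p3) = {}" "successively E q" "E a (hd q)" "E (last q) b"
  shows "is_path E S x y (p1 @ a # q @ b # p3)"
proof -
  have p: "hd (p1 @ a # p2 @ b # p3) = x" "last (p1 @ a # p2 @ b # p3) = y"
      "distinct (p1 @ a # p2 @ b # p3)" "set (p1 @ a # p2 @ b # p3) \<subseteq> S"
      "successively E (p1 @ a # p2 @ b # p3)"
    using assms(1) by (simp_all add: is_path_def)
  have suc: "successively E p1" "p1 \<noteq> [] \<Longrightarrow> E (last p1) a" "successively E (b # p3)"
    using p(5) by (auto simp: successively_append_iff successively_Cons)
  have "successively E (q @ b # p3)" using suc(3) assms(2,6,8) by (simp add: successively_append_iff)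
  then have "successively E (a # q @ b # p3)" using assms(2,7) by (simp add: successively_Cons)
  then have "successively E (p1 @ a # q @ b # p3)"
    using suc by (cases "p1 = []") (simp_all add: successively_append_iff)
  moreover have "distinct (p1 @ a # q @ b # p3)" using p(3) assms(3,5) by auto
  moreover have "set (p1 @ a # q @ b # p3) \<subseteq> S" using p(4) assms(4) by auto
  moreover have "hd (p1 @ a # q @ b # p3) = x" using p(1) by (cases p1) simp_all
  moreover have "last (p1 @ a # q @ b # p3) = y" using p(2) by simp
  ultimately show ?thesis by (simp add: is_path_def)
qed

text \<open>Among the vertices on no such path, some \<open>w\<close> is adjacent to a vertex
  \<open>w'\<close> of a path \<open>p\<close>. The component of \<open>w\<close> off
  \<open>p\<close> has a second neighbour \<open>z\<close> on \<open>p\<close>; replacing the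
  stretch of \<open>p\<close> between \<open>w'\<close> and \<open>z\<close> by a detour through
  this component covers \<open>w\<close>.\<close>

lemma rooted_path_through:
  assumes "rooted V E x y" "w0 \<in> V"  "V - {x, y} \<noteq> {}"
  shows "\<exists>p. is_path E V x y p \<and> w0 \<in> set p"
proof (rule ccontr)
  assume neg: "\<not> ?thesis"
  note sg = simple_graphD[OF rooted_simple[OF assms(1)]]
  define W where "W = {w \<in> V. \<not> (\<exists>p. is_path E V x y p \<and> w \<in> set p)}"
  have W0: "W \<noteq> {}" using neg assms(2) by (auto simp: W_def)
  obtain p0 where p0: "is_path E V x y p0"
    using rooted_path_exists[OF assms(1,3)] unfolding has_path_def is_path_def by blast
  then have "x \<in> set p0" "y \<in> set p0" unfolding is_path_def by auto
  then have W1: "W \<subseteq> V - {x, y}" using p0 by (auto simp: W_def)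
  have "boundary E W \<noteq> {}" using rooted_boundary[OF assms(1) W0 W1] by auto
  then obtain w w' where w: "w \<in> W" "w' \<notin> W" "E w w'" by (auto simp: boundary_def)
  then obtain p where p: "is_path E V x y p" "w' \<in> set p"
    using sg(3) by (auto simp: W_def)
  have wp: "w \<notin> set p" using w p(1) by (auto simp: W_def)
  let ?M = "reach E (V - set p) w"
  have wM: "w \<in> ?M" using wp w by (auto simp: W_def intro: reach_self)
  have "x \<in> set p" "y \<in> set p" using p(1) unfolding is_path_def by auto
  moreover have "?M \<subseteq> V - set p" by (rule reach_subset)
  ultimately have "?M \<subseteq> V - {x, y}" "?M \<inter> set p = {}" by auto
  then have "2 \<le> card (boundary E ?M)" using rooted_boundary[OF assms(1)] wM by blast
  then obtain z where z: "z \<in> boundary E ?M" "z \<noteq> w'"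
    by (metis card_le_1_of_subset_singleton not_less_eq_eq numeral_2_eq_2 One_nat_def singletonI subsetI)
  then obtain m where m: "m \<in> ?M" "E m z" "z \<notin> ?M" by (auto simp: boundary_def)
  have zp: "z \<in> set p" using reach_step[OF m(1) sg(4)[OF m(2)]] m sg(3) by blast
  obtain q where q: "q \<noteq> []" "hd q = m" "last q = w" "distinct q" "set q \<subseteq> V - set p"
      "successively E q"
    using m(1) unfolding reach_def has_path_def by blast
  have qr: "successively E (rev q)"
    unfolding successively_rev using q(6) by (rule successively_mono) (use sg(4) in auto)
  obtain p1 p2 where pp: "p = p1 @ w' # p2" using p(2) split_list by fast
  have "\<exists>p'. is_path E V x y p' \<and> w \<in> set p'"
  proof (cases "z \<in> set p2")
    case True
    then obtain p3 p4 where p2: "p2 = p3 @ z # p4" using split_list by fast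
    have "is_path E V x y (p1 @ w' # rev q @ z # p4)"
      by (rule is_path_reroute[of _ _ _ _ p1 w' p3])
        (use p pp p2 q qr m w sg(4) in \<open>auto simp: hd_rev last_rev\<close>)
    then show ?thesis using q(3) last_in_set[OF q(1)]
      by (intro exI[of _ "p1 @ w' # rev q @ z # p4"]) auto
  next
    case False
    then have "z \<in> set p1" using zp pp z by auto
    then obtain p3 p4 where p1: "p1 = p3 @ z # p4" using split_list by fast
    have "is_path E V x y (p3 @ z # q @ w' # p2)"
      by (rule is_path_reroute[of _ _ _ _ p3 z p4])
        (use p pp p1 q m w sg(4) in auto)
    then show ?thesis using q(3) last_in_set[OF q(1)]
      by (intro exI[of _ "p3 @ z # q @ w' # p2"]) auto
  qed
  then show False using w by (auto simp: W_def)
qed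

text \<open>The two halves of a path through \<open>W\<close>, cut where it first enters and last leaves \<open>W\<close>.\<close>

lemma rooted_linkage:
  assumes "rooted V E x y" "W \<noteq> {}" "W \<subseteq> V - {x, y}" "card (boundary E W) = 2"
  shows "\<exists>p q O1 O2 n m. boundary E W = {p, q} \<and> p \<noteq> q \<and> O1 \<inter> O2 = {} \<and> O1 \<union> O2 \<subseteq> V - W
    \<and> has_path E O1 x p n \<and> has_path E O2 q y m"
proof -
  note sg = simple_graphD[OF rooted_simple[OF assms(1)]]
  obtain w where w: "w \<in> W" using assms(2) by auto
  have "w \<in> V" "V - {x, y} \<noteq> {}" using w assms(3) by auto
  then obtain r where r: "is_path E V x y r" "w \<in> set r"
    using rooted_path_through[OF assms(1)] by blast
  define r1 where "r1 = takeWhile (\<lambda>v. v \<notin> W) r"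
  define s where "s = dropWhile (\<lambda>v. v \<notin> W) r"
  define r3 where "r3 = rev (takeWhile (\<lambda>v. v \<notin> W) (rev s))"
  define r2 where "r2 = rev (dropWhile (\<lambda>v. v \<notin> W) (rev s))"
  have rs: "r = r1 @ s" by (simp add: r1_def s_def)
  have s23: "s = r2 @ r3" unfolding r2_def r3_def rev_append[symmetric] by simp
  have r1W: "set r1 \<inter> W = {}" unfolding r1_def by (auto dest: set_takeWhileD)
  have r3W: "set r3 \<inter> W = {}" unfolding r3_def by (auto dest: set_takeWhileD)
  have sne: "s \<noteq> []" unfolding s_def using r(2) w by (auto simp: dropWhile_eq_Nil_conv)
  have hds: "hd s \<in> W" using hd_dropWhile[of "\<lambda>v. v \<notin> W" r] sne by (simp add: s_def)
  then have "w \<in> W" "\<exists>v\<in>set s. v \<in> W" using w sne by (auto intro: bexI[of _ "hd s"])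
  then have r2ne: "r2 \<noteq> []" unfolding r2_def by (auto simp: dropWhile_eq_Nil_conv)
  have l2: "last r2 \<in> W"
    using hd_dropWhile[of "\<lambda>v. v \<notin> W" "rev s"] r2ne by (simp add: r2_def last_rev)
  have h2: "hd r2 \<in> W" using hds s23 r2ne by simp
  have xW: "x \<notin> W" "y \<notin> W" using assms(3) by auto
  have r1ne: "r1 \<noteq> []"
    using r(1) xW hds rs unfolding is_path_def by (cases r1) auto
  have r3ne: "r3 \<noteq> []"
  proof
    assume "r3 = []"
    then have "last r = last r2" using rs s23 r2ne by simp
    then show False using r(1) xW l2 unfolding is_path_def by simp
  qed
  have rr: "r = r1 @ r2 @ r3" using rs s23 by simp
  have suc: "successively E r1" "successively E r3" "E (last r1) (hd r2)" "E (last r2) (hd r3)"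
    using r(1) r1ne r2ne r3ne unfolding is_path_def rr by (auto simp: successively_append_iff)
  have dis: "distinct r1" "distinct r3" "set r1 \<inter> set r3 = {}" "set r1 \<union> set r3 \<subseteq> V"
    using r(1) unfolding is_path_def rr by auto
  have ends: "hd r1 = x" "last r3 = y"
    using r(1) r1ne r3ne unfolding is_path_def rr by auto
  have b1: "last r1 \<in> boundary E W"
    using suc(3) h2 r1W last_in_set[OF r1ne] sg(4) by (auto simp: boundary_def)
  have b3: "hd r3 \<in> boundary E W"
    using suc(4) l2 r3W hd_in_set[OF r3ne] by (auto simp: boundary_def)
  have ne: "last r1 \<noteq> hd r3" using dis(3) last_in_set[OF r1ne] hd_in_set[OF r3ne] by auto
  have "finite (boundary E W)" using assms(4) by (metis card.infinite zero_neq_numeral)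
  then have "boundary E W = {last r1, hd r3}"
    using b1 b3 ne assms(4) by (intro card_subset_eq[symmetric]) auto
  moreover have "has_path E (set r1) x (last r1) (length r1 - 1)"
    unfolding has_path_def using r1ne dis suc ends by (intro exI[of _ r1]) auto
  moreover have "has_path E (set r3) (hd r3) y (length r3 - 1)"
    unfolding has_path_def using r3ne dis suc ends by (intro exI[of _ r3]) auto
  moreover have "set r1 \<union> set r3 \<subseteq> V - W" using dis r1W r3W by auto
  ultimately show ?thesis using ne dis(3) by blast
qed

section \<open>Contracting a set of vertices to a root\<close>

text \<open>The contracted vertex borrows the name \<open>a0\<close> of a member of
  \<open>A\<close>, so the new graph lives on the same type and the induction applies to it.\<close>

definition contract :: "('a \<Rightarrow> 'a \<Rightarrow> bool) \<Rightarrow> 'a set \<Rightarrow> 'a set \<Rightarrow> 'a \<Rightarrow> 'a \<Rightarrow> 'a \<Rightarrow> bool" where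
  "contract E A R a0 u v \<longleftrightarrow> (u \<in> R \<and> v \<in> R \<and> E u v)
     \<or> (u = a0 \<and> v \<in> R \<and> (\<exists>a\<in>A. E v a)) \<or> (v = a0 \<and> u \<in> R \<and> (\<exists>a\<in>A. E u a))"

text \<open>Exactly what makes the graph on \<open>R\<close> with \<open>A\<close> contracted to a vertex rooted at that vertex and \<open>c\<close>.\<close>

definition linked :: "('a \<Rightarrow> 'a \<Rightarrow> bool) \<Rightarrow> 'a set \<Rightarrow> 'a set \<Rightarrow> 'a \<Rightarrow> bool" where
  "linked E A R c \<longleftrightarrow> c \<in> R \<and> (\<forall>W. W \<noteq> {} \<and> W \<subseteq> R - {c} \<longrightarrow>
     boundary E W \<inter> R \<noteq> {} \<and> (boundary E W \<inter> A \<noteq> {} \<or> 2 \<le> card (boundary E W \<inter> R)))"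

lemma contract_rooted:
  assumes sg: "simple_graph V E" and "A \<subseteq> V" "R \<subseteq> V" "A \<inter> R = {}" "a0 \<in> A" "linked E A R c"
  shows "rooted (insert a0 R) (contract E A R a0) a0 c"
  unfolding rooted_def
proof (intro conjI allI impI)
  have fin: "finite R" using sg assms(3) finite_subset simple_graphD(1) by metis
  have a0: "a0 \<notin> R" using assms(4,5) by auto
  show sg': "simple_graph (insert a0 R) (contract E A R a0)"
    unfolding simple_graph_def using fin a0 simple_graphD[OF sg] by (auto simp: contract_def)
  show "a0 \<in> insert a0 R" "c \<in> insert a0 R" "a0 \<noteq> c"
    using assms(6) a0 by (auto simp: linked_def)
  fix W assume W: "W \<noteq> {} \<and> W \<subseteq> insert a0 R - {a0, c}"
  then have WR: "W \<subseteq> R - {c}" by auto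
  have l: "boundary E W \<inter> R \<noteq> {}" "boundary E W \<inter> A \<noteq> {} \<or> 2 \<le> card (boundary E W \<inter> R)"
    using assms(6) W WR unfolding linked_def by auto
  have sub: "boundary E W \<inter> R \<subseteq> boundary (contract E A R a0) W"
    using WR by (auto simp: boundary_def contract_def)
  have finb: "finite (boundary (contract E A R a0) W)" by (rule finite_boundary[OF sg'])
  show "2 \<le> card (boundary (contract E A R a0) W)"
  proof (cases "boundary E W \<inter> A = {}")
    case True
    then show ?thesis using l card_mono[OF finb sub] by auto
  next
    case False
    then have "a0 \<in> boundary (contract E A R a0) W"
      using WR a0 by (auto simp: boundary_def contract_def)
    moreover obtain u where "u \<in> boundary E W" "u \<in> R" using l(1) by auto
    ultimately have "{a0, u} \<subseteq> boundary (contract E A R a0) W" "a0 \<noteq> u" using sub a0 by auto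
    then show ?thesis using card_mono[OF finb, of "{a0, u}"] by auto
  qed
qed

lemma contract_degree:
  assumes "simple_graph V E" "w \<in> R" "a0 \<notin> R"
  shows "degree (contract E A R a0) w = card (nbrs E w \<inter> R) + (if nbrs E w \<inter> A = {} then 0 else 1)"
proof -
  have fin: "finite (nbrs E w \<inter> R)" using finite_nbrs[OF assms(1)] by auto
  have "nbrs (contract E A R a0) w
      = (nbrs E w \<inter> R) \<union> (if nbrs E w \<inter> A = {} then {} else {a0})"
  proof -
    have iff: "nbrs E w \<inter> A = {} \<longleftrightarrow> \<not> (\<exists>a\<in>A. E w a)" by auto
    show ?thesis unfolding iff using assms(2,3) by (auto simp: contract_def)
  qed
  then show ?thesis using fin assms(3) by (simp add: degree_eq_card_nbrs)
qed

text \<open>Only the first edge of the path involves \<open>a0\<close>. It stems from an edge at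
  some member of \<open>A\<close>, and the rest of the path stays in \<open>R\<close>.\<close>

lemma contract_lift:
  assumes "has_path (contract E A R a0) (insert a0 R) a0 c n" "0 < n" "a0 \<notin> R" "A \<inter> R = {}"
    and sym: "\<And>u v. E u v \<Longrightarrow> E v u"
  shows "\<exists>a\<in>A. has_path E (insert a R) a c n"
proof -
  obtain p where p: "p \<noteq> []" "hd p = a0" "last p = c" "distinct p" "set p \<subseteq> insert a0 R"
      "successively (contract E A R a0) p" "length p = Suc n"
    using assms(1) unfolding has_path_def by blast
  then obtain q where q: "p = a0 # q" by (cases p) auto
  then have qne: "q \<noteq> []" using p(7) assms(2) by auto
  have qR: "set q \<subseteq> R" using p q by auto
  have "contract E A R a0 a0 (hd q)" using p(6) q qne by (auto simp: successively_Cons)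
  then obtain a where a: "a \<in> A" "E a (hd q)" using assms(3) sym by (auto simp: contract_def)
  have "successively (contract E A R a0) q" using p(6) q by (auto simp: successively_Cons)
  then have "successively E q"
    by (rule successively_mono) (use qR assms(3) in \<open>auto simp: contract_def\<close>)
  then have "has_path E (insert a R) a c n"
    unfolding has_path_def using p q qne qR a assms(4)
    by (intro exI[of _ "a # q"]) (auto simp: successively_Cons)
  then show ?thesis using a(1) by blast
qed

text \<open>The quantifier over \<open>a\<close> stands inside because different lifted paths may
  start at different members of \<open>A\<close>. This is why a core must offer all its lengths to
  every member of \<open>A\<close>.\<close>

definition admissible_from :: "('a \<Rightarrow> 'a \<Rightarrow> bool) \<Rightarrow> 'a set \<Rightarrow> 'a set \<Rightarrow> 'a \<Rightarrow> nat \<Rightarrow> bool" where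
  "admissible_from E A R c m \<longleftrightarrow> (\<exists>l d. 2 \<le> l \<and> d \<in> {1, 2}
     \<and> (\<forall>i<m. \<exists>a\<in>A. has_path E (insert a R) a c (l + d * i)))"

text \<open>The induction hypothesis is an assumption here because two inductions use it: one with
  an exceptional vertex, one without.\<close>

lemma contract_admissible:
  assumes "simple_graph V E" "A \<subseteq> V" "R \<subseteq> V" "A \<inter> R = {}" "A \<noteq> {}" "linked E A R c"
    and IH: "\<And>E' a0. rooted (insert a0 R) E' a0 c \<Longrightarrow> a0 \<notin> R \<Longrightarrow>
      (\<And>w. w \<in> R \<Longrightarrow> degree E' w = card (nbrs E w \<inter> R) + (if nbrs E w \<inter> A = {} then 0 else 1))
      \<Longrightarrow> admissible E' (insert a0 R) a0 c m"
  shows "admissible_from E A R c m"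
proof -
  obtain a0 where a0: "a0 \<in> A" using assms(5) by auto
  then have "a0 \<notin> R" using assms(4) by auto
  then have "admissible (contract E A R a0) (insert a0 R) a0 c m"
    using contract_rooted[OF assms(1-4) a0 assms(6)] contract_degree[OF assms(1)] by (intro IH) auto
  then obtain l d where l: "2 \<le> l" "d \<in> {1, 2}"
      "\<And>i. i < m \<Longrightarrow> has_path (contract E A R a0) (insert a0 R) a0 c (l + d * i)"
    unfolding admissible_def by blast
  have "\<exists>a\<in>A. has_path E (insert a R) a c (l + d * i)" if "i < m" for i
    using contract_lift[OF l(3)[OF that]] l(1) \<open>a0 \<notin> R\<close> assms(4) simple_graphD(4)[OF assms(1)]
    by auto
  then show ?thesis unfolding admissible_from_def using l by blast
qed

section \<open>Sums of arithmetic progressions\<close>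

text \<open>Steps of size \<open>d\<close> are taken greedily, up to the \<open>m - 1\<close>
  available, and the consecutive progression makes up the rest. For \<open>d = 2\<close> the rest
  may be odd, which requires two consecutive terms as soon as \<open>m > 1\<close>.\<close>

lemma ap_sum_consecutive:
  fixes P :: "nat \<Rightarrow> bool"
  assumes P: "\<And>i j. i < m \<Longrightarrow> j < r \<Longrightarrow> P (a + d * i + (l + j))"
    and "d \<in> {1, 2}" "1 \<le> m" "m = 1 \<or> 2 \<le> r" "k + 1 \<le> m + r" "i < k"
  shows "P (a + l + i)"
proof (cases "d = 1")
  case True
  define i' where "i' = min i (m - 1)"
  have "i' < m" "i - i' < r" "i' \<le> i" using assms by (auto simp: i'_def)
  then show ?thesis using P[of i' "i - i'"] True by (simp add: algebra_simps)
next
  case False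
  then have d: "d = 2" using assms by auto
  define i' where "i' = min (i div 2) (m - 1)"
  have "i' < m" "2 * i' \<le> i" using assms by (auto simp: i'_def)
  moreover have "i - 2 * i' < r"
  proof (cases "i div 2 \<le> m - 1")
    case True
    show ?thesis
    proof (cases "m = 1")
      case True
      then show ?thesis using assms by (auto simp: i'_def)
    next
      case False
      have "i - 2 * i' \<le> 1" using True by (simp add: i'_def)
      then show ?thesis using assms(4) False by linarith
    qed
  next
    case False
    then show ?thesis using assms by (auto simp: i'_def)
  qed
  ultimately show ?thesis using P[of i' "i - 2 * i'"] d by (simp add: algebra_simps)
qed

text \<open>A progression of step 1 with two terms fills the holes of the other one. If
  \<open>m = 1\<close>, the second progression alone has \<open>k\<close> terms.\<close>

lemma ap_sum:
  fixes P :: "nat \<Rightarrow> bool"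
  assumes P: "\<And>i j. i < m \<Longrightarrow> j < r \<Longrightarrow> P (a + d * i + (l + e * j))"
    and d: "d \<in> {1, 2}" and e: "e \<in> {1, 2}" and "1 \<le> m" "1 \<le> r" "e = 1 \<Longrightarrow> 2 \<le> r" "k + 1 \<le> m + r"
  shows "\<exists>d'\<in>{1, 2}. \<forall>i<k. P (a + l + d' * i)"
proof -
  consider "e = 1" | "e = 2" "d = 2" | "e = 2" "d = 1" "m = 1" | "e = 2" "d = 1" "2 \<le> m"
    using d e assms(4) by force
  then show ?thesis
  proof cases
    case 1
    have "P (a + l + i)" if "i < k" for i
      by (rule ap_sum_consecutive[where m = m and r = r and d = d])
        (use assms 1 that P in auto)
    then show ?thesis by (intro bexI[of _ 1]) auto
  next
    case 2
    have "P (a + l + 2 * i)" if "i < k" for i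
    proof -
      define i' where "i' = min i (m - 1)"
      have "i' < m" "i - i' < r" "i' \<le> i" using assms that by (auto simp: i'_def)
      then show ?thesis using P[of i' "i - i'"] 2 by (simp add: algebra_simps)
    qed
    then show ?thesis by (intro bexI[of _ 2]) auto
  next
    case 3
    have "P (a + l + 2 * i)" if "i < k" for i
      using P[of 0 i] assms that 3 by (simp add: algebra_simps)
    then show ?thesis by (intro bexI[of _ 2]) auto
  next
    case 4
    have "P (l + a + i)" if "i < k" for i
      by (rule ap_sum_consecutive[where m = r and r = m and d = 2])
        (use assms 4 that P in \<open>auto simp: algebra_simps\<close>)
    then show ?thesis by (intro bexI[of _ 1]) (auto simp: algebra_simps)
  qed
qed

section \<open>The core lemma\<close>

text \<open>Only the vertex set is fixed: the induction on its size is applied to contracted graphs,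
  with other roots and usually a smaller \<open>k\<close>.\<close>

definition admissible_thm :: "'a set \<Rightarrow> bool" where
  "admissible_thm V \<longleftrightarrow> (\<forall>E x y k. rooted V E x y \<longrightarrow> V - {x, y} \<noteq> {} \<longrightarrow>
     (\<forall>v\<in>V - {x, y}. k + 1 \<le> degree E v) \<longrightarrow> admissible E V x y k)"

text \<open>After contraction \<open>w\<close> keeps its neighbours in \<open>R\<close> and gains
  one if it sees \<open>A\<close>. For \<open>m = 1\<close> the degree bound 2 comes from
  rootedness, applied to \<open>{w}\<close>.\<close>

lemma core_paths:
  fixes V :: "'a set"
  assumes IH: "\<And>V' :: 'a set. card V' < N \<Longrightarrow> admissible_thm V'"
    and sg: "simple_graph V E" and "H \<subseteq> V" "R \<subseteq> V" "A \<subseteq> H" "A \<noteq> {}" "H \<inter> R = {}" "card R + 1 < N"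
    and linked: "linked E A R c" and "R - {c} \<noteq> {}"
    and nb: "\<And>w. w \<in> R - {c} \<Longrightarrow> nbrs E w \<subseteq> R \<union> H"
    and deg: "\<And>w. w \<in> R - {c} \<Longrightarrow> m = 1 \<or>
      card (nbrs E w \<inter> H) + (m + 1) \<le> degree E w + (if nbrs E w \<inter> A = {} then 0 else 1)"
  shows "admissible_from E A R c m"
proof (rule contract_admissible[OF sg])
  show "A \<subseteq> V" "R \<subseteq> V" "A \<inter> R = {}" "A \<noteq> {}" "linked E A R c" using assms by auto
  fix E' a0
  assume r: "rooted (insert a0 R) E' a0 c" and a0: "a0 \<notin> R"
    and dg: "\<And>w. w \<in> R \<Longrightarrow> degree E' w = card (nbrs E w \<inter> R) + (if nbrs E w \<inter> A = {} then 0 else 1)"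
  have fin: "finite R" using sg assms(4) finite_subset simple_graphD(1) by metis
  have "admissible_thm (insert a0 R)" using IH[of "insert a0 R"] assms(8) a0 fin by simp
  moreover have "insert a0 R - {a0, c} \<noteq> {}" using assms(10) a0 by auto
  moreover have "m + 1 \<le> degree E' w" if "w \<in> insert a0 R - {a0, c}" for w
  proof -
    have w: "w \<in> R - {c}" using that by auto
    show ?thesis
    proof (cases "m = 1")
      case True
      have "2 \<le> card (boundary E' {w})" using r that unfolding rooted_def by blast
      then show ?thesis
        using True boundary_singleton[of E' w] rooted_simple[OF r]
        by (simp add: degree_eq_card_nbrs simple_graph_def)
    next
      case False
      have "nbrs E w = (nbrs E w \<inter> R) \<union> (nbrs E w \<inter> H)" using nb[OF w] by auto
      then have "degree E w \<le> card (nbrs E w \<inter> R) + card (nbrs E w \<inter> H)"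
        by (metis card_Un_le degree_eq_card_nbrs)
      then show ?thesis using deg[OF w] False dg[of w] w by auto
    qed
  qed
  ultimately show "admissible E' (insert a0 R) a0 c m"
    using r unfolding admissible_thm_def by blast
qed

text \<open>Each path has three stretches: from \<open>s\<close> through \<open>H\<close> to a
  member of \<open>A\<close>, through \<open>R\<close> to \<open>c\<close>, and through
  \<open>F\<close> to \<open>t\<close>. The first two contribute progressions, the last a
  constant.\<close>

lemma core:
  fixes V :: "'a set"
  assumes IH: "\<And>V' :: 'a set. card V' < N \<Longrightarrow> admissible_thm V'"
    and sg: "simple_graph V E" and "H \<subseteq> V" "R \<subseteq> V" "A \<subseteq> H" "A \<noteq> {}" "H \<inter> R = {}" "card R + 1 < N"
    and linked: "linked E A R c" and "R - {c} \<noteq> {}"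
    and deg: "\<And>w. w \<in> R - {c} \<Longrightarrow> k + 1 \<le> degree E w"
    and nb: "\<And>w. w \<in> R - {c} \<Longrightarrow> nbrs E w \<subseteq> R \<union> H"
    and r: "1 \<le> r" "e \<in> {1, 2}" "e = 1 \<Longrightarrow> 2 \<le> r"
    and loss: "\<And>w. w \<in> R - {c} \<Longrightarrow>
      card (nbrs E w \<inter> H) + 1 \<le> r + (if nbrs E w \<inter> A = {} then 0 else 1)"
    and start: "\<And>a i. a \<in> A \<Longrightarrow> i < r \<Longrightarrow> has_path E H s a (l + e * i)"
    and finish: "has_path E F c t n" "F \<subseteq> V" "F \<inter> (H \<union> R) = {c}"
  shows "admissible E V s t k"
proof -
  \<comment> \<open>What the loss leaves of the degree bound. The maximum with 1 covers cores that
    already offer \<open>k\<close> lengths, where one continuation is enough.\<close>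
  define m where "m = max 1 (k + 1 - r)"
  have "admissible_from E A R c m"
  proof (rule core_paths[OF IH sg])
    show "m = 1 \<or> card (nbrs E w \<inter> H) + (m + 1) \<le> degree E w + (if nbrs E w \<inter> A = {} then 0 else 1)"
      if "w \<in> R - {c}" for w
      using deg[OF that] loss[OF that] r(1) by (auto simp: m_def split: if_splits)
  qed (use assms in auto)
  then obtain l' d where l': "2 \<le> l'" "d \<in> {1, 2}"
      "\<And>i. i < m \<Longrightarrow> \<exists>a\<in>A. has_path E (insert a R) a c (l' + d * i)"
    unfolding admissible_from_def by blast
  have P: "has_path E V s t (l' + d * i + (l + e * j) + n)" if ij: "i < m" "j < r" for i j
  proof -
    obtain a where a: "a \<in> A" "has_path E (insert a R) a c (l' + d * i)" using l'(3)[OF ij(1)] by blast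
    have "has_path E (H \<union> R) s c ((l + e * j) + (l' + d * i))"
      by (rule has_path_join[OF start[OF a(1) ij(2)] a(2)]) (use assms a in auto)
    then have "has_path E V s t ((l + e * j) + (l' + d * i) + n)"
      by (rule has_path_join[OF _ finish(1)]) (use assms in auto)
    then show ?thesis by (simp add: algebra_simps)
  qed
  have "\<exists>d'\<in>{1, 2}. \<forall>i<k. has_path E V s t ((l' + l + d' * i) + n)"
    by (rule ap_sum[where P = "\<lambda>z. has_path E V s t (z + n)" and m = m and r = r and d = d and e = e])
      (use P l' r in \<open>auto simp: m_def\<close>)
  then obtain d' where "d' \<in> {1, 2}" "\<forall>i<k. has_path E V s t ((l' + l + d' * i) + n)" by blast
  then show ?thesis unfolding admissible_def using l'(1)
    by (intro exI[of _ "l' + l + n"] exI[of _ d']) (auto simp: algebra_simps)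
qed

lemma admissible_sym:
  "admissible E S x y k \<Longrightarrow> (\<And>u v. E u v \<Longrightarrow> E v u) \<Longrightarrow> admissible E S y x k"
  unfolding admissible_def by (meson has_path_sym)

lemma rooted_basic:
  assumes "rooted V E x y"
  shows "finite V" "x \<in> V" "y \<in> V" "x \<noteq> y"
  using assms simple_graphD(1) by (auto simp: rooted_def)

text \<open>Allows the roots to be taken non-adjacent: the edge between them affects neither the
  degrees of the other vertices nor the boundaries of sets avoiding both roots.\<close>

definition del_edge :: "('a \<Rightarrow> 'a \<Rightarrow> bool) \<Rightarrow> 'a \<Rightarrow> 'a \<Rightarrow> 'a \<Rightarrow> 'a \<Rightarrow> bool" where
  "del_edge E x y u v \<longleftrightarrow> E u v \<and> {u, v} \<noteq> {x, y}"

lemma del_edge_rooted: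
  assumes "rooted V E x y"
  shows "rooted V (del_edge E x y) x y"
proof -
  have "simple_graph V (del_edge E x y)"
    using rooted_simple[OF assms] by (auto simp: simple_graph_def del_edge_def insert_commute)
  moreover have "boundary (del_edge E x y) W = boundary E W" if "W \<subseteq> V - {x, y}" for W
    using that by (auto simp: boundary_def del_edge_def doubleton_eq_iff)
  ultimately show ?thesis using assms by (simp add: rooted_def)
qed

lemma del_edge_degree: "v \<notin> {x, y} \<Longrightarrow> degree (del_edge E x y) v = degree E v"
  unfolding degree_def del_edge_def by (rule arg_cong[where f = card]) auto

lemma del_edge_admissible: "admissible (del_edge E x y) V x y k \<Longrightarrow> admissible E V x y k"
proof -
  have "has_path E V x y n" if "has_path (del_edge E x y) V x y n" for n
    using that by (rule has_path_mono_edges) (simp add: del_edge_def)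
  then show "admissible (del_edge E x y) V x y k \<Longrightarrow> ?thesis"
    unfolding admissible_def by blast
qed

lemma linked_single:
  assumes "c \<in> R" "p \<notin> R"
    and "\<And>W. W \<noteq> {} \<Longrightarrow> W \<subseteq> R - {c} \<Longrightarrow> 2 \<le> card (boundary E W \<inter> insert p R)"
  shows "linked E {p} R c"
  unfolding linked_def
proof (intro conjI allI impI)
  show "c \<in> R" by fact
  fix W assume W: "W \<noteq> {} \<and> W \<subseteq> R - {c}"
  then have c: "2 \<le> card (boundary E W \<inter> insert p R)" using assms(3) by blast
  show "boundary E W \<inter> R \<noteq> {}"
  proof
    assume "boundary E W \<inter> R = {}"
    then have "boundary E W \<inter> insert p R \<subseteq> {p}" by auto
    then show False using c card_le_1_of_subset_singleton by force
  qed
  show "boundary E W \<inter> {p} \<noteq> {} \<or> 2 \<le> card (boundary E W \<inter> R)"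
  proof (cases "p \<in> boundary E W")
    case False
    then have "boundary E W \<inter> insert p R = boundary E W \<inter> R" by auto
    then show ?thesis using c by simp
  qed auto
qed

lemma card_two_outside:
  assumes "finite V" "R \<subseteq> V" "a \<in> V - R" "b \<in> V - R" "a \<noteq> b"
  shows "card R + 1 < card V"
proof -
  have "finite R" using assms finite_subset by blast
  then have "card (insert a (insert b R)) = card R + 2" using assms by simp
  moreover have "card (insert a (insert b R)) \<le> card V" using assms by (intro card_mono) auto
  ultimately show ?thesis by simp
qed

lemma anchored_linked:
  assumes "anchored E R c" "A \<inter> R = {}"
    and "\<And>W. W \<noteq> {} \<Longrightarrow> W \<subseteq> R - {c} \<Longrightarrow> boundary E W \<inter> A = {} \<Longrightarrow> 2 \<le> card (boundary E W \<inter> R)"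
  shows "linked E A R c"
  unfolding linked_def
proof (intro conjI allI impI)
  show "c \<in> R" using assms(1) by (simp add: anchored_def)
  fix W assume W: "W \<noteq> {} \<and> W \<subseteq> R - {c}"
  then show "boundary E W \<inter> R \<noteq> {}" using assms(1) by (simp add: anchored_def)
  show "boundary E W \<inter> A \<noteq> {} \<or> 2 \<le> card (boundary E W \<inter> R)" using assms(3) W by metis
qed

text \<open>A root-to-root path through \<open>W\<close> first enters it from one outer neighbour
  and finally leaves it to the other. Its two ends are disjoint and avoid \<open>W\<close>, so they
  extend all \<open>p\<close>-\<open>q\<close> paths of the piece at once.\<close>

lemma two_cut_reduction:
  assumes "rooted V E x y" "W \<noteq> {}" "W \<subseteq> V - {x, y}" "card (boundary E W) = 2"
    and adm: "\<And>p q. boundary E W = {p, q} \<Longrightarrow> p \<noteq> q \<Longrightarrow> p \<in> V - W \<Longrightarrow> q \<in> V - W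
      \<Longrightarrow> linked E {p} (insert q W) q \<Longrightarrow> admissible_from E {p} (insert q W) q k"
  shows "admissible E V x y k"
proof -
  obtain p q O1 O2 n m where pq: "boundary E W = {p, q}" "p \<noteq> q" "O1 \<inter> O2 = {}"
      "O1 \<union> O2 \<subseteq> V - W" "has_path E O1 x p n" "has_path E O2 q y m"
    using rooted_linkage[OF assms(1-4)] by blast
  have ends: "p \<in> O1" "q \<in> O2" using has_path_ends pq by fast+
  have "linked E {p} (insert q W) q"
  proof (rule linked_single)
    show "p \<notin> insert q W" using pq ends by auto
    fix W' assume W': "W' \<noteq> {}" "W' \<subseteq> insert q W - {q}"
    have "boundary E W' \<subseteq> W \<union> boundary E W" using W'(2) by (auto simp: boundary_def)
    then have "boundary E W' \<inter> insert p (insert q W) = boundary E W'" using pq(1) by auto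
    moreover have "2 \<le> card (boundary E W')"
      using W' assms(3) by (intro rooted_boundary[OF assms(1)]) auto
    ultimately show "2 \<le> card (boundary E W' \<inter> insert p (insert q W))" by simp
  qed auto
  then have "admissible_from E {p} (insert q W) q k" using adm pq ends by blast
  then obtain l d where ld: "2 \<le> l" "d \<in> {1, 2}"
      "\<And>i. i < k \<Longrightarrow> has_path E (insert p (insert q W)) p q (l + d * i)"
    unfolding admissible_from_def by blast
  have "has_path E V x y (n + l + m + d * i)" if "i < k" for i
  proof -
    have "has_path E (O1 \<union> insert q W) x q (n + (l + d * i))"
      by (rule has_path_join[OF pq(5) ld(3)[OF that]]) (use pq ends in auto)
    then have "has_path E V x y (n + (l + d * i) + m)"
      by (rule has_path_join[OF _ pq(6)]) (use pq ends assms(3) in auto)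
    then show ?thesis by (simp add: algebra_simps)
  qed
  then show ?thesis unfolding admissible_def using ld
    by (intro exI[of _ "n + l + m"] exI[of _ d]) auto
qed

lemma reach_boundary: "boundary E (reach E (V - H) y) \<inter> (V - H) = {}"
  if "\<And>u v. E u v \<Longrightarrow> E v u"
  using that by (auto simp: boundary_def dest: reach_step)

text \<open>If the component of \<open>y\<close> off \<open>H\<close> does not see \<open>A\<close>,
  then \<open>H - A\<close> separates it from a set containing \<open>A\<close>. When
  \<open>H - A\<close> is small this contradicts connectivity.\<close>

lemma reach_complement_boundary:
  assumes "simple_graph V E" "A \<subseteq> H" "boundary E (reach E (V - H) y) \<inter> A = {}"
  shows "boundary E (V - reach E (V - H) y - (H - A)) \<subseteq> H - A"
proof
  note sg = simple_graphD[OF assms(1)]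
  let ?D = "reach E (V - H) y"
  fix u assume "u \<in> boundary E (V - ?D - (H - A))"
  then obtain w where w: "w \<in> V" "w \<notin> ?D" "w \<notin> H - A" "E w u" "u \<notin> V - ?D - (H - A)"
    by (auto simp: boundary_def)
  have "u \<notin> ?D"
  proof
    assume u: "u \<in> ?D"
    then have "w \<in> boundary E ?D" using w sg(4) by (auto simp: boundary_def)
    then show False using assms(3) w reach_boundary[of E V H y, OF sg(4)] by auto
  qed
  then show "u \<in> H - A" using w sg(3) by blast
qed

text \<open>Here the core alone offers \<open>k\<close> lengths to every member of \<open>A\<close>,
  so a single continuation to \<open>y\<close> finishes without induction.\<close>

lemma direct_admissible:
  assumes "simple_graph V E" "H \<subseteq> V - {y}" "y \<in> V"
    and "boundary E (reach E (V - H) y) \<inter> A \<noteq> {}" "A \<subseteq> H" "1 \<le> l" "e \<in> {1, 2}"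
    and paths: "\<And>a i. a \<in> A \<Longrightarrow> i < k \<Longrightarrow> has_path E H x a (l + e * i)"
  shows "admissible E V x y k"
proof -
  note sg = simple_graphD[OF assms(1)]
  let ?D = "reach E (V - H) y"
  obtain d a where a: "a \<in> A" "d \<in> ?D" "E d a" "a \<notin> ?D" using assms(4) by (auto simp: boundary_def)
  have D: "?D \<subseteq> V - H" by (rule reach_subset)
  have "anchored E ?D y" using assms by (intro reach_anchored) auto
  then obtain n where n: "has_path E ?D d y n" using anchored_path a(2) by metis
  then have n': "has_path E (insert a ?D) a y (Suc n)"
    using a(4) by (rule has_path_Cons[where E = E, OF sg(4)[OF a(3)]])
  have "has_path E V x y (l + Suc n + e * i)" if "i < k" for i
  proof -
    have "has_path E V x y (l + e * i + Suc n)"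
      by (rule has_path_join[OF paths[OF a(1) that] n']) (use a assms(2,5) D in auto)
    then show ?thesis by (simp add: algebra_simps)
  qed
  then show ?thesis unfolding admissible_def using assms(6,7)
    by (intro exI[of _ "l + Suc n"] exI[of _ e]) auto
qed

section \<open>Two admissible paths, with one exceptional vertex\<close>

lemma rooted_nbr:
  assumes "rooted V E x y" "V - {x, y} \<noteq> {}"
  shows "\<exists>a. E x a"
proof -
  obtain p where p: "p \<noteq> []" "hd p = x" "last p = y" "successively E p"
    using rooted_path_exists[OF assms] unfolding has_path_def by blast
  then obtain q where q: "p = x # q" by (cases p) auto
  then have "q \<noteq> []" using p rooted_basic(4)[OF assms(1)] by auto
  then show ?thesis using p(4) q by (auto simp: successively_Cons)
qed

text \<open>A smallest counterexample for \<open>k = 2\<close> with \<open>z\<close> exempt from the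
  degree bound. The same \<open>z\<close> is kept through the whole induction, so \<open>ne\<close>
  asks for a vertex of controlled degree besides the roots.\<close>

locale two_critical =
  fixes V :: "'a set" and E x y z
  assumes root: "rooted V E x y" and nonadj: "\<not> E x y"
    and ne: "V - {x, y, z} \<noteq> {}" and deg: "\<And>v. v \<in> V - {x, y, z} \<Longrightarrow> 3 \<le> degree E v"
    and IH: "\<And>(V' :: 'a set) E' x' y'. card V' < card V \<Longrightarrow> rooted V' E' x' y' \<Longrightarrow> V' - {x', y', z} \<noteq> {}
      \<Longrightarrow> (\<And>v. v \<in> V' - {x', y', z} \<Longrightarrow> 3 \<le> degree E' v) \<Longrightarrow> admissible E' V' x' y' 2"
    and counter: "\<not> admissible E V x y 2"
begin

lemma sg: "simple_graph V E" by (rule rooted_simple[OF root])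

lemmas sgD = simple_graphD[OF sg] and rc = rooted_basic[OF root]

lemma swap: "two_critical V E y x z"
proof unfold_locales
  show "rooted V E y x" by (rule rooted_sym[OF root])
  show "\<not> E y x" using nonadj sgD(4) by blast
  show "V - {y, x, z} \<noteq> {}" using ne by (simp add: insert_commute)
  show "\<And>v. v \<in> V - {y, x, z} \<Longrightarrow> 3 \<le> degree E v" using deg by (simp add: insert_commute)
  show "\<not> admissible E V y x 2" using counter admissible_sym sgD(4) by metis
qed (fact IH)

text \<open>No degree drops here: a vertex with at most one neighbour in \<open>A\<close> exchanges
  it for the contracted vertex.\<close>

lemma contract_two:
  assumes "A \<subseteq> V" "R \<subseteq> V" "A \<inter> R = {}" "A \<noteq> {}" "linked E A R c" "card R + 1 < card V" "{x, y} \<inter> R \<subseteq> {c}"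
    and "R - {c, z} \<noteq> {}" and "\<And>w. w \<in> R - {c, z} \<Longrightarrow> nbrs E w \<subseteq> R \<union> A"
    and "\<And>w. w \<in> R - {c, z} \<Longrightarrow> card (nbrs E w \<inter> A) \<le> 1"
  shows "admissible_from E A R c 2"
proof (rule contract_admissible[OF sg assms(1-5)])
  fix E' a0
  assume r: "rooted (insert a0 R) E' a0 c" and a0: "a0 \<notin> R"
    and dg: "\<And>w. w \<in> R \<Longrightarrow> degree E' w = card (nbrs E w \<inter> R) + (if nbrs E w \<inter> A = {} then 0 else 1)"
  have fin: "finite R" using assms(2) finite_subset sgD(1) by metis
  show "admissible E' (insert a0 R) a0 c 2"
  proof (rule IH[OF _ r])
    show "card (insert a0 R) < card V" using assms(6) a0 fin by simp
    show "insert a0 R - {a0, c, z} \<noteq> {}" using assms(8) a0 by auto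
    fix w assume "w \<in> insert a0 R - {a0, c, z}"
    then have w: "w \<in> R - {c, z}" by auto
    have "nbrs E w = (nbrs E w \<inter> R) \<union> (nbrs E w \<inter> A)" using assms(9)[OF w] by auto
    then have "degree E w \<le> card (nbrs E w \<inter> R) + card (nbrs E w \<inter> A)"
      by (metis card_Un_le degree_eq_card_nbrs)
    also have "\<dots> \<le> degree E' w"
      using dg[of w] w assms(10)[OF w] by auto
    finally have "degree E w \<le> degree E' w" .
    moreover have "3 \<le> degree E w" using w assms(2,7) by (intro deg) auto
    ultimately show "3 \<le> degree E' w" by simp
  qed
qed

text \<open>The piece behind a 2-cut is a smaller instance with the two cut vertices as roots. For
  \<open>W = {z}\<close> that instance would have no vertex of controlled degree.\<close>

lemma separator:
  assumes "W \<noteq> {}" "W \<subseteq> V - {x, y}" "W \<noteq> {z}" "W \<union> boundary E W \<noteq> V"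
  shows "3 \<le> card (boundary E W)"
proof (rule ccontr)
  assume "\<not> ?thesis"
  then have c2: "card (boundary E W) = 2" using rooted_boundary[OF root assms(1,2)] by simp
  have "admissible E V x y 2"
  proof (rule two_cut_reduction[OF root assms(1,2) c2])
    fix p q assume pq: "boundary E W = {p, q}" "p \<noteq> q" "p \<in> V - W" "q \<in> V - W"
      and l: "linked E {p} (insert q W) q"
    have WV: "insert p (insert q W) \<subset> V" using assms(2,4) pq by auto
    show "admissible_from E {p} (insert q W) q 2"
    proof (rule contract_two[OF _ _ _ _ l])
      show "card (insert q W) + 1 < card V"
        using psubset_card_mono[OF rc(1) WV] pq finite_subset[OF _ rc(1), of "insert q W"] assms(2)
        by (subst (asm) card_insert_disjoint) auto
      show "insert q W - {q, z} \<noteq> {}" using assms(1,3) pq by auto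
      show "card (nbrs E w \<inter> {p}) \<le> 1" for w by (rule card_le_1_of_subset_singleton) auto
      show "nbrs E w \<subseteq> insert q W \<union> {p}" if "w \<in> insert q W - {q, z}" for w
      proof
        fix u assume "u \<in> nbrs E w"
        then have "u \<in> W \<or> u \<in> boundary E W" using that by (auto simp: boundary_def)
        then show "u \<in> insert q W \<union> {p}" using pq(1) by auto
      qed
    qed (use pq assms in auto)
  qed
  then show False using counter by simp
qed

text \<open>The triangle offers lengths 1 and 2 from \<open>x\<close> to both \<open>a\<close> and
  \<open>b\<close>. If the component of \<open>y\<close> sees neither, \<open>x\<close> alone
  separates them from \<open>y\<close>.\<close>

lemma no_triangle:
  assumes "E x a" "E x b" "E a b"
  shows False
proof -
  have ab: "a \<noteq> b" "a \<noteq> x" "b \<noteq> x" "a \<noteq> y" "b \<noteq> y" "E a x" "E b x" "E b a" "a \<in> V" "b \<in> V"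
    using assms sgD nonadj by blast+
  let ?H = "{x, a, b}"
  have H: "?H \<subseteq> V - {y}" using ab rc by auto
  have "boundary E (reach E (V - ?H) y) \<inter> {a, b} \<noteq> {}"
  proof
    assume "boundary E (reach E (V - ?H) y) \<inter> {a, b} = {}"
    from reach_complement_boundary[OF sg _ this]
    have "boundary E (V - reach E (V - ?H) y - (?H - {a, b})) \<subseteq> {x}" using ab by auto
    moreover have "y \<in> reach E (V - ?H) y" using H rc by (intro reach_self) auto
    ultimately have "V - reach E (V - ?H) y - (?H - {a, b}) = {}"
      using ab by (intro rooted_boundary_singleton[OF root]) auto
    then show False using ab reach_subset[of E "V - ?H" y] by auto
  qed
  then have "admissible E V x y 2"
  proof (rule direct_admissible[OF sg H rc(3), where l = 1 and e = 1])
    fix c i assume c: "c \<in> {a, b}" and i: "i < (2 :: nat)"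
    have "clique E ?H" using ab assms by (auto simp: clique_def)
    then show "has_path E ?H x c (1 + 1 * i)" using c ab i by (intro clique_path) auto
  qed auto
  then show False using counter by simp
qed

text \<open>The 4-cycle \<open>x a v b\<close> offers lengths 1 and 3 from \<open>x\<close> to both
  \<open>a\<close> and \<open>b\<close>. If the component of \<open>y\<close> sees neither,
  \<open>{x, v}\<close> cuts off a set containing both, which is therefore not
  \<open>{z}\<close>.\<close>

lemma common_nbr_unique:
  assumes "E x a" "E x b" "E v a" "E v b" "v \<noteq> x" "v \<noteq> y"
  shows "a = b"
proof (rule ccontr)
  assume "a \<noteq> b"
  then have ab: "a \<noteq> b" "a \<noteq> x" "b \<noteq> x" "a \<noteq> y" "b \<noteq> y" "a \<noteq> v" "b \<noteq> v" "E a x" "E b x"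
      "E a v" "E b v" "a \<in> V" "b \<in> V" "v \<in> V"
    using assms sgD nonadj by blast+
  let ?H = "{x, v, a, b}"
  have H: "?H \<subseteq> V - {y}" using ab rc assms by auto
  have "boundary E (reach E (V - ?H) y) \<inter> {a, b} \<noteq> {}"
  proof
    let ?W = "V - reach E (V - ?H) y - (?H - {a, b})"
    assume "boundary E (reach E (V - ?H) y) \<inter> {a, b} = {}"
    from reach_complement_boundary[OF sg _ this]
    have b: "boundary E ?W \<subseteq> {x, v}" using ab by auto
    have y: "y \<in> reach E (V - ?H) y" using H rc by (intro reach_self) auto
    have W: "a \<in> ?W" "b \<in> ?W" using ab reach_subset[of E "V - ?H" y] by auto
    have "3 \<le> card (boundary E ?W)"
    proof (rule separator)
      show "?W \<noteq> {}" "?W \<noteq> {z}" using W ab(1) by blast+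
      show "?W \<subseteq> V - {x, y}" using y ab by auto
      show "?W \<union> boundary E ?W \<noteq> V" using b y rc assms by blast
    qed
    moreover have "card (boundary E ?W) \<le> card {x, v}" using b by (intro card_mono) auto
    ultimately show False using assms by auto
  qed
  then have "admissible E V x y 2"
  proof (rule direct_admissible[OF sg H rc(3), where l = 1 and e = 2])
    fix c i assume c: "c \<in> {a, b}" and i: "i < (2 :: nat)"
    have "has_path E ({x, v} \<union> {a, b}) x c (1 + 2 * i)"
      by (rule bipartite_path_opposite) (use c ab i assms in auto)
    then show "has_path E ?H x c (1 + 2 * i)" by (auto elim: has_path_mono)
  qed auto
  then show False using counter by simp
qed

lemma card_common_nbrs: "v \<noteq> x \<Longrightarrow> v \<noteq> y \<Longrightarrow> card (nbrs E v \<inter> nbrs E x) \<le> 1"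
proof -
  assume "v \<noteq> x" "v \<noteq> y"
  then have "a = b" if "a \<in> nbrs E v \<inter> nbrs E x" "b \<in> nbrs E v \<inter> nbrs E x" for a b
    using that common_nbr_unique[of a b v] by auto
  then show ?thesis by (metis One_nat_def card_le_Suc0_iff_eq finite_Int finite_nbrs sg)
qed

text \<open>All neighbours of \<open>x\<close> can be contracted without lowering degrees, since
  another vertex off the roots sees at most one of them. Hence the component of \<open>y\<close>
  contains no vertex of controlled degree besides \<open>y\<close>.\<close>

lemma reach_y: "reach E (V - insert x (nbrs E x)) y \<subseteq> {y, z}"
proof (rule ccontr)
  let ?H = "insert x (nbrs E x)" and ?A = "nbrs E x"
  let ?D = "reach E (V - ?H) y"
  assume "\<not> ?D \<subseteq> {y, z}"
  then have Dne: "?D - {y, z} \<noteq> {}" by auto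
  have D: "?D \<subseteq> V - ?H" by (rule reach_subset)
  have y: "y \<in> V - ?H" using rc nonadj by auto
  have anch: "anchored E ?D y" by (rule reach_anchored[OF y])
  have xD: "\<not> E w x" if "w \<in> ?D" for w using that D sgD(4) by auto
  have nb: "nbrs E w \<subseteq> ?D \<union> ?A" if "w \<in> ?D" for w
  proof
    fix u assume "u \<in> nbrs E w"
    then show "u \<in> ?D \<union> ?A" using reach_step[OF that, of u] sgD(3,4) xD[OF that] by auto
  qed
  obtain x1 where x1: "E x x1"
    using rooted_nbr[OF root] ne by auto
  have "admissible_from E ?A ?D y 2"
  proof (rule contract_two)
    show "?A \<subseteq> V" by (rule nbrs_subset[OF sg])
    show "?D \<subseteq> V" "?A \<inter> ?D = {}" "?A \<noteq> {}" "{x, y} \<inter> ?D \<subseteq> {y}" using D x1 by auto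
    show "card ?D + 1 < card V"
      by (rule card_two_outside[OF rc(1), of _ x x1]) (use D x1 rc sgD in auto)
    show "linked E ?A ?D y"
    proof (rule anchored_linked[OF anch])
      show "?A \<inter> ?D = {}" using D by auto
      fix W assume W: "W \<noteq> {}" "W \<subseteq> ?D - {y}" "boundary E W \<inter> ?A = {}"
      have "boundary E W \<subseteq> ?D \<union> ?A" using W(2) nb by (fastforce simp: boundary_def)
      then have "boundary E W \<inter> ?D = boundary E W" using W(3) by blast
      moreover have "2 \<le> card (boundary E W)" using W D by (intro rooted_boundary[OF root]) auto
      ultimately show "2 \<le> card (boundary E W \<inter> ?D)" by simp
    qed
    show "card (nbrs E w \<inter> ?A) \<le> 1" if "w \<in> ?D - {y, z}" for w
      using that D by (intro card_common_nbrs) auto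
  qed (use nb Dne in auto)
  then obtain l d where ld: "2 \<le> l" "d \<in> {1, 2}"
      "\<And>i. i < 2 \<Longrightarrow> \<exists>a\<in>?A. has_path E (insert a ?D) a y (l + d * i)"
    unfolding admissible_from_def by blast
  have "has_path E V x y (Suc l + d * i)" if i: "i < 2" for i
  proof -
    obtain a where a: "E x a" "has_path E (insert a ?D) a y (l + d * i)" using ld(3)[OF i] by auto
    have "has_path E (insert x (insert a ?D)) x y (Suc (l + d * i))"
      by (rule has_path_Cons[OF a]) (use D a sgD(5) in auto)
    then show ?thesis using D a(1) sgD(3) rc by (auto elim!: has_path_mono)
  qed
  then have "admissible E V x y 2" unfolding admissible_def using ld
    by (intro exI[of _ "Suc l"] exI[of _ d]) auto
  then show False using counter by simp
qed

lemma nbrs_y: "nbrs E y \<subseteq> nbrs E x \<union> {z}"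
proof
  fix u assume u: "u \<in> nbrs E y"
  let ?H = "insert x (nbrs E x)"
  have y: "y \<in> reach E (V - ?H) y" using rc nonadj by (intro reach_self) auto
  show "u \<in> nbrs E x \<union> {z}"
  proof (cases "u \<in> ?H")
    case True
    then show ?thesis using u nonadj sgD(4) by auto
  next
    case False
    then have "u \<in> reach E (V - ?H) y" using u sgD(3,4) by (intro reach_step[OF y]) auto
    then show ?thesis using reach_y u sgD(5) by auto
  qed
qed

text \<open>Otherwise \<open>z\<close> is adjacent to \<open>y\<close> but not to \<open>x\<close>.
  A neighbour of \<open>z\<close> among those of \<open>x\<close> would close a triangle at
  \<open>y\<close>, so \<open>y\<close> is the only neighbour of \<open>z\<close>, against
  rootedness.\<close>

lemma nbrs_y_subset: "nbrs E y \<subseteq> nbrs E x"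
proof (rule ccontr)
  interpret sw: two_critical V E y x z by (rule swap)
  assume "\<not> ?thesis"
  then have z: "E y z" "\<not> E x z" using nbrs_y by auto
  then have sub: "nbrs E x \<subseteq> nbrs E y" using sw.nbrs_y by auto
  let ?H = "insert x (nbrs E x)"
  have zxy: "z \<noteq> x" "z \<noteq> y" "z \<in> V" "E z y" using z nonadj sgD by blast+
  have y: "y \<in> reach E (V - ?H) y" using rc nonadj by (intro reach_self) auto
  have zD: "z \<in> reach E (V - ?H) y" using z zxy by (intro reach_step[OF y]) auto
  have "nbrs E z \<subseteq> {y}"
  proof
    fix u assume u: "u \<in> nbrs E z"
    show "u \<in> {y}"
    proof (cases "u \<in> ?H")
      case True
      then have "E x u" using u z sgD(4) by auto
      then have "E y u" using sub by auto
      then show ?thesis using sw.no_triangle[of z u] z u by simp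
    next
      case False
      then have "u \<in> reach E (V - ?H) y" using u sgD(3,4) by (intro reach_step[OF zD]) auto
      then show ?thesis using reach_y u sgD(5) by auto
    qed
  qed
  then have "boundary E {z} \<subseteq> {y}" using sgD(5) by (simp add: boundary_singleton)
  then show False using rooted_boundary_singleton[OF root] zxy by blast
qed

text \<open>Both roots now have the same independent neighbourhood \<open>T\<close>. One
  \<open>a \<in> T\<close> becomes the target and \<open>T - {a}\<close> is contracted; an edge from
  \<open>x\<close> into \<open>T - {a}\<close> and the edge from \<open>a\<close> to
  \<open>y\<close> are the fixed ends.\<close>

lemma contradiction: False
proof -
  interpret sw: two_critical V E y x z by (rule swap)
  define T where "T = nbrs E x"
  define C where "C = V - {x, y} - T"
  have Ny: "nbrs E y = T" using nbrs_y_subset sw.nbrs_y_subset by (auto simp: T_def)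
  have adj: "E x u \<longleftrightarrow> u \<in> T" "E u x \<longleftrightarrow> u \<in> T" "E y u \<longleftrightarrow> u \<in> T" "E u y \<longleftrightarrow> u \<in> T" for u
  proof -
    show "E x u \<longleftrightarrow> u \<in> T" by (simp add: T_def)
    then show "E u x \<longleftrightarrow> u \<in> T" using sgD(4) by blast
    show "E y u \<longleftrightarrow> u \<in> T" using Ny by (metis nbrs_iff)
    then show "E u y \<longleftrightarrow> u \<in> T" using sgD(4) by blast
  qed
  have indep: "\<not> E u v" if "u \<in> T" "v \<in> T" for u v using that no_triangle by (auto simp: T_def)
  have TV: "T \<subseteq> V - {x, y}" using adj sgD nonadj by blast
  have C_nb: "u \<in> C \<union> T" if "w \<in> C" "E w u" for u w
    using that adj sgD(3) by (auto simp: C_def)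
  have Cz: "C - {z} \<noteq> {}"
  proof
    assume "C - {z} = {}"
    then have Cz: "C \<subseteq> {z}" by auto
    have "z \<notin> C"
    proof
      assume z: "z \<in> C"
      have "nbrs E z \<subseteq> T"
      proof
        fix u assume "u \<in> nbrs E z"
        then have "E z u" "u \<noteq> z" using sgD(5) by auto
        then show "u \<in> T" using C_nb[OF z, of u] Cz by blast
      qed
      then have "boundary E {z} = nbrs E z \<inter> nbrs E x"
        using sgD(5) by (auto simp: boundary_singleton T_def)
      moreover have "2 \<le> card (boundary E {z})"
        using z by (intro rooted_boundary[OF root]) (auto simp: C_def)
      ultimately show False using card_common_nbrs[of z] z by (auto simp: C_def)
    qed
    then have C0: "C = {}" using Cz by auto
    obtain v where v: "v \<in> V - {x, y, z}" using ne by auto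
    then have "v \<in> T" using C0 unfolding C_def by blast
    have "nbrs E v \<subseteq> {x, y}"
    proof
      fix u assume "u \<in> nbrs E v"
      then have "u \<in> V" "u \<notin> T" using indep \<open>v \<in> T\<close> sgD(3) by auto
      then show "u \<in> {x, y}" using C0 unfolding C_def by blast
    qed
    then have "card (nbrs E v) \<le> card {x, y}" by (intro card_mono) auto
    then show False using deg[OF v] by (auto simp: degree_eq_card_nbrs card_insert_if split: if_splits)
  qed
  \<comment> \<open>Otherwise no member of \<open>T\<close> sees \<open>C - {z}\<close>, which would
    then be attached to \<open>z\<close> alone.\<close>
  have "\<exists>a\<in>T. reach E (insert a C) a - {a, z} \<noteq> {}"
  proof (rule ccontr)
    assume neg: "\<not> ?thesis"
    have nT: "\<not> E v a" if "v \<in> C - {z}" "a \<in> T" for v a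
    proof
      assume "E v a"
      then have "v \<in> reach E (insert a C) a"
        using that by (intro reach_step[OF reach_self]) auto
      moreover have "v \<noteq> a" using that by (auto simp: C_def)
      ultimately show False using neg that by auto
    qed
    have "boundary E (C - {z}) \<subseteq> {z}" using nT C_nb by (fastforce simp: boundary_def)
    then show False using rooted_boundary_singleton[OF root, of "C - {z}" z] Cz
      unfolding C_def by blast
  qed
  then obtain a where a: "a \<in> T" "reach E (insert a C) a - {a, z} \<noteq> {}" by auto
  let ?R = "reach E (insert a C) a" and ?A = "T - {a}"
  have R: "?R \<subseteq> insert a C" by (rule reach_subset)
  have anch: "anchored E ?R a" by (rule reach_anchored) simp
  have nb: "nbrs E w \<subseteq> ?R \<union> ?A" if "w \<in> ?R - {a}" for w
  proof
    fix u assume u: "u \<in> nbrs E w"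
    then have "u \<in> C \<union> T" using C_nb[of w u] that R by auto
    then show "u \<in> ?R \<union> ?A"
      using reach_step[of w E "insert a C" a u] that u sgD(4) a by (auto simp: reach_self)
  qed
  have T2: "?A \<noteq> {}"
  proof
    assume "?A = {}"
    then have "boundary E C \<subseteq> {a}" using C_nb by (auto simp: boundary_def)
    then show False using rooted_boundary_singleton[OF root, of C a] Cz unfolding C_def by blast
  qed
  have "admissible_from E ?A ?R a 2"
  proof (rule contract_two)
    show "?A \<subseteq> V" "?R \<subseteq> V" "?A \<inter> ?R = {}" "{x, y} \<inter> ?R \<subseteq> {a}"
      using TV R a by (auto simp: C_def)
    show "card ?R + 1 < card V"
      by (rule card_two_outside[OF rc(1), of _ x y]) (use R TV a rc in \<open>auto simp: C_def\<close>)
    show "linked E ?A ?R a"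
    proof (rule anchored_linked[OF anch])
      show "?A \<inter> ?R = {}" using R by (auto simp: C_def)
      fix W assume W: "W \<noteq> {}" "W \<subseteq> ?R - {a}" "boundary E W \<inter> ?A = {}"
      have "boundary E W \<subseteq> ?R \<union> ?A" using W(2) nb by (fastforce simp: boundary_def)
      then have "boundary E W \<inter> ?R = boundary E W" using W(3) by blast
      moreover have "2 \<le> card (boundary E W)"
        using W R by (intro rooted_boundary[OF root]) (auto simp: C_def)
      ultimately show "2 \<le> card (boundary E W \<inter> ?R)" by simp
    qed
    show "card (nbrs E w \<inter> ?A) \<le> 1" if "w \<in> ?R - {a, z}" for w
    proof -
      have "card (nbrs E w \<inter> ?A) \<le> card (nbrs E w \<inter> nbrs E x)"
        by (intro card_mono) (auto simp: T_def finite_nbrs[OF sg])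
      also have "\<dots> \<le> 1" using that R by (intro card_common_nbrs) (auto simp: C_def)
      finally show ?thesis .
    qed
  qed (use nb a T2 in auto)
  then obtain l d where ld: "2 \<le> l" "d \<in> {1, 2}"
      "\<And>i. i < 2 \<Longrightarrow> \<exists>b\<in>?A. has_path E (insert b ?R) b a (l + d * i)"
    unfolding admissible_from_def by blast
  have "has_path E V x y (l + 2 + d * i)" if i: "i < 2" for i
  proof -
    obtain b where b: "b \<in> ?A" "has_path E (insert b ?R) b a (l + d * i)" using ld(3)[OF i] by auto
    have "E x b" using b(1) adj by auto
    then have p1: "has_path E (insert x (insert b ?R)) x a (Suc (l + d * i))"
      by (rule has_path_Cons[where E = E, OF _ b(2)]) (use b R a TV in \<open>auto simp: C_def\<close>)
    have p2: "has_path E {a, y} a y 1" using a adj TV by (intro has_path_edge) auto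
    have "has_path E V x y (Suc (l + d * i) + 1)"
      by (rule has_path_join[OF p1 p2]) (use b R a TV rc in \<open>auto simp: C_def\<close>)
    then show ?thesis by simp
  qed
  then have "admissible E V x y 2" unfolding admissible_def using ld
    by (intro exI[of _ "l + 2"] exI[of _ d]) auto
  then show False using counter by simp
qed

end

text \<open>The exceptional vertex \<open>z\<close> may coincide with a root or lie outside \<open>V\<close>.\<close>

theorem two_admissible:
  fixes V :: "'a set"
  assumes "rooted V E x y" "V - {x, y, z} \<noteq> {}" "\<And>v. v \<in> V - {x, y, z} \<Longrightarrow> 3 \<le> degree E v"
  shows "admissible E V x y 2"
  using assms
proof (induction "card V" arbitrary: V E x y rule: less_induct)
  case less
  have "admissible (del_edge E x y) V x y 2"
  proof (rule ccontr)
    assume neg: "\<not> ?thesis"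
    interpret two_critical V "del_edge E x y" x y z
    proof unfold_locales
      show "rooted V (del_edge E x y) x y" by (rule del_edge_rooted[OF less.prems(1)])
      show "\<not> del_edge E x y x y" by (simp add: del_edge_def)
      show "V - {x, y, z} \<noteq> {}" by fact
      show "3 \<le> degree (del_edge E x y) v" if "v \<in> V - {x, y, z}" for v
        using less.prems(3)[OF that] that by (subst del_edge_degree) auto
    qed (use less.hyps neg in \<open>blast+\<close>)
    show False by (rule contradiction)
  qed
  then show ?case by (rule del_edge_admissible)
qed

section \<open>Regions and their one-vertex attachments\<close>

lemma nbrs_subsetD: "nbrs E w \<subseteq> S \<Longrightarrow> E w u \<Longrightarrow> u \<in> S"
  by auto

lemma anchored_boundary:
  "anchored E D y \<Longrightarrow> W \<noteq> {} \<Longrightarrow> W \<subseteq> D - {y} \<Longrightarrow> boundary E W \<inter> D \<noteq> {}"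
  by (simp add: anchored_def)

text \<open>A path of \<open>D\<close> that visits \<open>Z\<close> enters and leaves it through
  \<open>c\<close>, so \<open>Z\<close> is dispensable for connections within the rest.\<close>

lemma anchored_diff:
  assumes "anchored E D y" "Z \<subseteq> D - {y}" "c \<notin> Z" "boundary E Z \<inter> D \<subseteq> {c}"
    and sym: "\<And>a b. E a b \<Longrightarrow> E b a"
  shows "anchored E (D - Z) y"
  unfolding anchored_def
proof (intro conjI allI impI)
  show "y \<in> D - Z" using assms(1,2) by (auto simp: anchored_def)
  fix W assume W: "W \<noteq> {} \<and> W \<subseteq> D - Z - {y}"
  show "boundary E W \<inter> (D - Z) \<noteq> {}"
  proof (cases "c \<in> W")
    case True
    have "boundary E (W \<union> Z) \<inter> D \<noteq> {}"
      by (rule anchored_boundary[OF assms(1)]) (use W assms(2) in auto)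
    then obtain u w where u: "u \<in> D" "u \<notin> W" "u \<notin> Z" "w \<in> W \<union> Z" "E w u"
      by (auto simp: boundary_def)
    have "w \<notin> Z"
    proof
      assume "w \<in> Z"
      then have "u \<in> boundary E Z \<inter> D" using u by (auto simp: boundary_def)
      then show False using assms(4) True u(2) by blast
    qed
    then show ?thesis using u by (auto simp: boundary_def)
  next
    case False
    have "boundary E W \<inter> D \<noteq> {}"
      by (rule anchored_boundary[OF assms(1)]) (use W in auto)
    then obtain u w where u: "u \<in> D" "u \<notin> W" "w \<in> W" "E w u"
      by (auto simp: boundary_def)
    have "u \<notin> Z"
    proof
      assume "u \<in> Z"
      then have "w \<in> boundary E Z \<inter> D" using u(3) sym[OF u(4)] W by (auto simp: boundary_def)
      then show False using assms(4) False u(3) by blast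
    qed
    then show ?thesis using u by (auto simp: boundary_def)
  qed
qed

lemma card_le_1E:
  assumes "finite S" "\<not> 2 \<le> card S"
  obtains v where "S \<subseteq> {v}"
proof -
  have "card S = 0 \<or> card S = 1" using assms(2) by auto
  then show ?thesis
  proof
    assume "card S = 0"
    then show ?thesis using assms(1) that[of undefined] by simp
  next
    assume "card S = 1"
    then show ?thesis using that by (metis card_1_singletonE subset_refl)
  qed
qed

text \<open>In a connected region only the second clause of \<open>linked\<close> can fail. The
  violating set \<open>Z\<close> misses \<open>A\<close> and has at most one neighbour in
  \<open>D\<close>; connectivity supplies that neighbour \<open>c\<close>.\<close>

lemma not_linked_gap:
  assumes "anchored E D y" "A \<inter> D = {}" "\<not> linked E A D y" "finite D"
    and nb: "\<And>w. w \<in> D - {y} \<Longrightarrow> nbrs E w \<subseteq> D \<union> H"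
  shows "\<exists>Z c. Z \<noteq> {} \<and> Z \<subseteq> D - {y} \<and> c \<in> D - Z \<and> boundary E Z \<subseteq> insert c (H - A)"
proof -
  have "\<exists>Z. Z \<noteq> {} \<and> Z \<subseteq> D - {y} \<and> boundary E Z \<inter> A = {} \<and> \<not> 2 \<le> card (boundary E Z \<inter> D)"
    using anchored_linked[OF assms(1,2)] assms(3) by blast
  then obtain Z where Z: "Z \<noteq> {}" "Z \<subseteq> D - {y}" "boundary E Z \<inter> A = {}"
      "\<not> 2 \<le> card (boundary E Z \<inter> D)"
    by blast
  have "finite (boundary E Z \<inter> D)" using assms(4) by auto
  then obtain c where c: "boundary E Z \<inter> D \<subseteq> {c}" using Z(4) by (rule card_le_1E)
  moreover have "boundary E Z \<inter> D \<noteq> {}" using anchored_boundary[OF assms(1) Z(1,2)] .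
  ultimately have "c \<in> boundary E Z" "c \<in> D" by auto
  moreover have "boundary E Z \<subseteq> insert c (H - A)"
  proof
    fix u assume u: "u \<in> boundary E Z"
    then obtain w where w: "w \<in> Z" "E w u" by (auto simp: boundary_def)
    have "u \<in> D \<union> H" by (rule nbrs_subsetD[OF nb w(2)]) (use w(1) Z(2) in blast)
    then show "u \<in> insert c (H - A)" using u c Z(3) by auto
  qed
  moreover have "c \<notin> Z" using \<open>c \<in> boundary E Z\<close> by (simp add: boundary_def)
  ultimately show ?thesis using Z(1,2) by (intro exI[of _ Z] exI[of _ c]) simp
qed

text \<open>Turns a gap into the region of a second contraction: \<open>c\<close> becomes the root,
  and \<open>A\<close> is now taken from the part of the core that \<open>Z\<close> sees.\<close>

lemma gap_linked:
  assumes "anchored E D y" "Z \<subseteq> D - {y}" "c \<in> D - Z" "boundary E Z \<inter> D \<subseteq> {c}"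
    and "\<And>W. W \<noteq> {} \<Longrightarrow> W \<subseteq> Z \<Longrightarrow> boundary E W \<inter> A = {}
      \<Longrightarrow> 2 \<le> card (boundary E W \<inter> insert c Z)"
  shows "linked E A (insert c Z) c"
  unfolding linked_def
proof (intro conjI allI impI)
  show "c \<in> insert c Z" by simp
  fix W assume W: "W \<noteq> {} \<and> W \<subseteq> insert c Z - {c}"
  then have WZ: "W \<subseteq> Z" by auto
  have "boundary E W \<inter> D \<noteq> {}"
    by (rule anchored_boundary[OF assms(1)]) (use W WZ assms(2) in auto)
  then obtain u where u: "u \<in> boundary E W" "u \<in> D" by auto
  then have "u \<in> Z \<or> u \<in> boundary E Z" using WZ by (auto simp: boundary_def)
  then have "u \<in> insert c Z" using assms(4) u(2) by blast
  then show "boundary E W \<inter> insert c Z \<noteq> {}" using u(1) by blast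
  show "boundary E W \<inter> A \<noteq> {} \<or> 2 \<le> card (boundary E W \<inter> insert c Z)"
    using assms(5) W WZ by metis
qed

lemma boundary_subset_Un: "W \<subseteq> Z \<Longrightarrow> boundary E W \<subseteq> Z \<union> boundary E Z"
  by (auto simp: boundary_def)

lemma nbrs_Un_boundary: "w \<in> Z \<Longrightarrow> nbrs E w \<subseteq> Z \<union> boundary E Z"
  by (auto simp: boundary_def)

lemma card_ge_2_of_insert:
  assumes "3 \<le> card S" "S \<subseteq> insert x S'" "finite S'"
  shows "2 \<le> card S'"
proof -
  have "card S \<le> card (insert x S')" using assms by (intro card_mono) auto
  also have "\<dots> \<le> Suc (card S')" by (simp add: card_insert_if assms(3))
  finally show ?thesis using assms(1) by simp
qed

lemma ex_max_card:
  assumes "finite V" "P K0" "\<And>K. P K \<Longrightarrow> K \<subseteq> V"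
  shows "\<exists>K :: 'a set. P K \<and> (\<forall>K'. P K' \<longrightarrow> card K' \<le> card K)"
proof -
  have "\<forall>K. P K \<longrightarrow> card K < Suc (card V)"
    unfolding less_Suc_eq_le by (intro allI impI card_mono assms)
  then show ?thesis using assms(2) by (intro ex_has_greatest_nat[where P = P and f = card])
qed

lemma card_subset_pair_le_2: "S \<subseteq> {a, b} \<Longrightarrow> card S \<le> 2"
proof -
  assume "S \<subseteq> {a, b}"
  then have "card S \<le> card {a, b}" by (intro card_mono) auto
  also have "\<dots> \<le> 2" by (simp add: card_insert_if)
  finally show ?thesis .
qed

section \<open>Minimal counterexamples\<close>

locale critical =
  fixes V :: "'a set" and E x y and k :: nat
  assumes root: "rooted V E x y" and nonadj: "\<not> E x y" and k2: "2 \<le> k"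
    and ne: "V - {x, y} \<noteq> {}" and deg: "\<And>v. v \<in> V - {x, y} \<Longrightarrow> k + 1 \<le> degree E v"
    and IH: "\<And>V' :: 'a set. card V' < card V \<Longrightarrow> admissible_thm V'"
    and counter: "\<not> admissible E V x y k"
begin

lemma sg: "simple_graph V E" by (rule rooted_simple[OF root])

lemmas sgD = simple_graphD[OF sg] and rc = rooted_basic[OF root]

lemma finite_sub: "S \<subseteq> V \<Longrightarrow> finite S" using rc(1) finite_subset by blast

lemma swap: "critical V E y x k"
proof unfold_locales
  show "rooted V E y x" by (rule rooted_sym[OF root])
  show "\<not> E y x" using nonadj sgD(4) by blast
  show "V - {y, x} \<noteq> {}" using ne by (simp add: insert_commute)
  show "\<And>v. v \<in> V - {y, x} \<Longrightarrow> k + 1 \<le> degree E v" using deg by (simp add: insert_commute)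
  show "\<not> admissible E V y x k" using counter admissible_sym sgD(4) by metis
qed (use k2 IH in auto)

text \<open>The core is the single vertex \<open>p\<close>. Contracting one vertex loses nothing, so
  the piece keeps the full degree bound and provides \<open>k\<close> paths.\<close>

lemma separator:
  assumes "W \<noteq> {}" "W \<subseteq> V - {x, y}" "W \<union> boundary E W \<noteq> V"
  shows "3 \<le> card (boundary E W)"
proof (rule ccontr)
  assume "\<not> ?thesis"
  then have c2: "card (boundary E W) = 2" using rooted_boundary[OF root assms(1,2)] by simp
  have "admissible E V x y k"
  proof (rule two_cut_reduction[OF root assms(1,2) c2])
    fix p q assume pq: "boundary E W = {p, q}" "p \<noteq> q" "p \<in> V - W" "q \<in> V - W"
      and l: "linked E {p} (insert q W) q"
    have "W \<union> {p, q} \<noteq> V" using assms(3) pq(1) by simp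
    moreover have "W \<union> {p, q} \<subseteq> V" using assms(2) pq(3,4) by auto
    ultimately obtain v where v: "v \<in> V" "v \<notin> W" "v \<noteq> p" "v \<noteq> q" by blast
    show "admissible_from E {p} (insert q W) q k"
    proof (rule core_paths[OF IH sg _ _ _ _ _ _ l])
      show "card (insert q W) + 1 < card V"
        by (rule card_two_outside[OF rc(1), of _ p v]) (use v pq assms in auto)
      show "insert q W - {q} \<noteq> {}" using assms(1) pq by auto
      fix w assume w: "w \<in> insert q W - {q}"
      then have "nbrs E w \<subseteq> W \<union> {p, q}" using nbrs_Un_boundary[of w W E] pq(1) by auto
      then show "nbrs E w \<subseteq> insert q W \<union> {p}" by auto
      have "k + 1 \<le> degree E w" using w assms(2) by (intro deg) auto
      then show "k = 1 \<or> card (nbrs E w \<inter> {p}) + (k + 1) \<le> degree E w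
          + (if nbrs E w \<inter> {p} = {} then 0 else 1)"
        by (cases "E w p") (auto simp: Int_insert_right)
    qed (use pq assms in auto)
  qed
  then show False using counter by simp
qed

lemma no_2_cut:
  assumes "W \<noteq> {}" "W \<subseteq> V - {x, y}" "boundary E W \<subseteq> {p, q}" "v \<in> V" "v \<notin> W" "v \<noteq> p" "v \<noteq> q"
  shows False
proof -
  have "3 \<le> card (boundary E W)" by (rule separator) (use assms in auto)
  then show False using card_subset_pair_le_2[OF assms(3)] by simp
qed

lemma core_contra:
  assumes "H \<subseteq> V" "R \<subseteq> V" "A \<subseteq> H" "A \<noteq> {}" "H \<inter> R = {}" "card R + 1 < card V"
    and "linked E A R c" and "R - {c} \<noteq> {}" "R - {c} \<subseteq> V - {x, y}"
    and "\<And>w. w \<in> R - {c} \<Longrightarrow> nbrs E w \<subseteq> R \<union> H"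
    and "1 \<le> r" "e \<in> {1, 2}" "e = 1 \<Longrightarrow> 2 \<le> r"
    and "\<And>w. w \<in> R - {c} \<Longrightarrow> card (nbrs E w \<inter> H) + 1 \<le> r + (if nbrs E w \<inter> A = {} then 0 else 1)"
    and "\<And>a i. a \<in> A \<Longrightarrow> i < r \<Longrightarrow> has_path E H x a (l + e * i)"
    and "has_path E F c y n" "F \<subseteq> V" "F \<inter> (H \<union> R) = {c}"
  shows False
proof -
  have "admissible E V x y k"
    by (rule core[OF IH sg assms(1-8) _ assms(10-18)]) (use assms(9) deg in blast)+
  then show False using counter by simp
qed

text \<open>A single neighbour \<open>b\<close> would make \<open>{x, b}\<close> a 2-cut around
  \<open>y\<close>; the degree of \<open>b\<close> guarantees a vertex on its other side.\<close>

lemma card_nbrs_y: "2 \<le> card (nbrs E y)"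
proof (rule ccontr)
  assume "\<not> ?thesis"
  then obtain b where b: "nbrs E y \<subseteq> {b}" using card_le_1E[OF finite_nbrs[OF sg]] by metis
  obtain b' where "E y b'" using rooted_nbr[OF rooted_sym[OF root]] ne by (auto simp: insert_commute)
  then have yb: "E y b" using b by auto
  then have bV: "b \<in> V" "b \<noteq> y" "b \<noteq> x" using sgD nonadj by blast+
  show False
  proof (cases "V - {x, y, b} = {}")
    case True
    then have "nbrs E b \<subseteq> {x, y}" using sgD(3,5) by fastforce
    then have "card (nbrs E b) \<le> 2" by (rule card_subset_pair_le_2)
    then show False using deg[of b] bV k2 by (simp add: degree_eq_card_nbrs)
  next
    case False
    have "boundary E (V - {x, y, b}) \<subseteq> {x, b}"
    proof
      fix u assume "u \<in> boundary E (V - {x, y, b})"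
      then obtain w where w: "w \<in> V - {x, y, b}" "E w u" "u \<notin> V - {x, y, b}" by (auto simp: boundary_def)
      then have "u \<noteq> y" using b sgD(4) by fastforce
      then show "u \<in> {x, b}" using w sgD(3) by blast
    qed
    show False by (rule no_2_cut[OF False _ \<open>boundary _ _ \<subseteq> _\<close>, of y]) (use bV rc in auto)
  qed
qed

section \<open>Clique cores containing a root\<close>

lemma region:
  assumes "H \<subseteq> V - {y}" "x \<in> H"
  defines "D \<equiv> reach E (V - H) y"
  shows "anchored E D y" "D \<subseteq> V - H" "y \<in> D" "finite D" "D - {y} \<subseteq> V - {x, y}"
    "\<And>w. w \<in> D \<Longrightarrow> nbrs E w \<subseteq> D \<union> H" "\<not> nbrs E y \<subseteq> H \<Longrightarrow> D - {y} \<noteq> {}"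
proof -
  have y: "y \<in> V - H" using assms rc by auto
  show a: "anchored E D y" unfolding D_def by (rule reach_anchored[OF y])
  show D: "D \<subseteq> V - H" unfolding D_def by (rule reach_subset)
  show yD: "y \<in> D" unfolding D_def by (rule reach_self[OF y])
  show "finite D" using D by (intro finite_sub) auto
  show "D - {y} \<subseteq> V - {x, y}" using D assms by auto
  show nb: "nbrs E w \<subseteq> D \<union> H" if "w \<in> D" for w
  proof
    fix u assume "u \<in> nbrs E w"
    then have "E u w" "u \<in> V" using sgD by auto
    then show "u \<in> D \<union> H" using that reach_step[of w E "V - H" y u] unfolding D_def by auto
  qed
  assume "\<not> nbrs E y \<subseteq> H"
  then obtain u where "E y u" "u \<notin> H" unfolding nbrs_def by blast
  then show "D - {y} \<noteq> {}" using nbrs_subsetD[OF nb[OF yD]] sgD(5) by blast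
qed

text \<open>By maximality every outside vertex other than \<open>y\<close> misses a member of
  \<open>K\<close>, so the \<open>card K - 1\<close> lengths of the clique pay for the loss. A gap
  would be attached to \<open>c\<close> and \<open>x\<close> only, a forbidden 2-cut.\<close>

lemma clique_case:
  assumes "E x a" "E x b" "E a b"
  obtains K where "clique E K" "x \<in> K" "nbrs E y \<subseteq> K - {x}"
proof -
  define P where "P K \<longleftrightarrow> K \<subseteq> V - {y} \<and> clique E K \<and> x \<in> K" for K
  have ab: "a \<noteq> b" "a \<noteq> x" "b \<noteq> x" "a \<noteq> y" "b \<noteq> y" "a \<in> V" "b \<in> V" "E a x" "E b x" "E b a"
    using assms sgD nonadj by blast+
  have "P {x, a, b}" using ab assms rc by (auto simp: P_def clique_def)
  then obtain K where K: "P K" and Kmax: "\<And>K'. P K' \<Longrightarrow> card K' \<le> card K"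
    using ex_max_card[of V P, OF rc(1) \<open>P {x, a, b}\<close>] unfolding P_def by blast
  have K3: "3 \<le> card K" using Kmax[OF \<open>P {x, a, b}\<close>] ab by auto
  have KV: "K \<subseteq> V - {y}" "clique E K" "x \<in> K" "finite K" using K finite_sub by (auto simp: P_def)
  let ?A = "K - {x}"
  have cA: "card ?A = card K - 1" using KV by simp
  note reg = region[OF KV(1,3)]
  let ?D = "reach E (V - K) y"
  have "nbrs E y \<subseteq> K"
  proof (rule ccontr)
    assume n: "\<not> nbrs E y \<subseteq> K"
    have A0: "?A \<noteq> {}" using cA K3 by force
    then obtain a' where a': "a' \<in> ?A" by auto
    have l: "linked E ?A ?D y"
    proof (rule ccontr)
      assume "\<not> ?thesis"
      then have "\<exists>Z c. Z \<noteq> {} \<and> Z \<subseteq> ?D - {y} \<and> c \<in> ?D - Z \<and> boundary E Z \<subseteq> insert c (K - ?A)"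
        by (intro not_linked_gap[OF reg(1)]) (use reg(2,4,6) in auto)
      then obtain Z c where Z: "Z \<noteq> {}" "Z \<subseteq> ?D - {y}" "c \<in> ?D - Z" "boundary E Z \<subseteq> insert c (K - ?A)"
        by blast
      then show False
        by (intro no_2_cut[of Z c x a']) (use reg(2,5) KV a' in auto)
    qed
    show False
    proof (rule core_contra[OF _ _ _ A0 _ _ l, where H = K and r = "card K - 1" and e = 1 and l = 1 and F = "{y}" and n = 0])
      show "card ?D + 1 < card V"
        by (rule card_two_outside[OF rc(1), of _ x a']) (use reg(2) KV a' in auto)
      show "card (nbrs E w \<inter> K) + 1 \<le> card K - 1 + (if nbrs E w \<inter> ?A = {} then 0 else 1)"
        if w: "w \<in> ?D - {y}" for w
      proof -
        have "\<not> K \<subseteq> nbrs E w"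
        proof
          assume "K \<subseteq> nbrs E w"
          then have "E w u" "E u w" if "u \<in> K" for u using that sgD(4) by auto
          moreover have w': "w \<in> V - K" using w reg(2) by blast
          ultimately have "P (insert w K)" using w KV by (auto simp: P_def clique_def)
          then show False using Kmax[of "insert w K"] w' KV by simp
        qed
        then have "card (nbrs E w \<inter> K) < card K" using KV by (intro psubset_card_mono) auto
        moreover have "card (nbrs E w \<inter> K) \<le> 1" if "nbrs E w \<inter> ?A = {}"
          by (rule card_le_1_of_subset_singleton[of _ x]) (use that in auto)
        ultimately show ?thesis using K3 by auto
      qed
      show "has_path E K x u (1 + 1 * i)" if "u \<in> ?A" "i < card K - 1" for u i
        using that KV by (intro clique_path) auto
    qed (use reg n KV K3 rc in \<open>auto intro: has_path_refl\<close>)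
  qed
  moreover have "x \<notin> nbrs E y" using nonadj sgD(4) by auto
  ultimately have "nbrs E y \<subseteq> K - {x}" by blast
  then show ?thesis by (rule that[OF KV(2,3)])
qed

end

lemma clique_nbrs:
  assumes "clique E K" "v \<in> K"
  shows "K - {v} \<subseteq> nbrs E v"
proof
  fix u assume "u \<in> K - {v}"
  then have "u \<in> K" "v \<noteq> u" by auto
  then show "u \<in> nbrs E v" using assms by (simp add: clique_def)
qed

context critical
begin

text \<open>Unless the clique already has \<open>k\<close> lengths, a common neighbour
  \<open>a\<close> becomes the target, and the core is \<open>x\<close> with the other common
  neighbours. Vertices of \<open>C\<close> miss \<open>x\<close>, which keeps the loss within
  budget.\<close>

lemma twin_clique:
  assumes "nbrs E x = A" "nbrs E y = A" "clique E A"
  shows False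
proof -
  define C where "C = V - {x, y} - A"
  have adj: "E x u \<longleftrightarrow> u \<in> A" "E u x \<longleftrightarrow> u \<in> A" "E y u \<longleftrightarrow> u \<in> A" "E u y \<longleftrightarrow> u \<in> A" for u
  proof -
    show "E x u \<longleftrightarrow> u \<in> A" using assms(1) by (metis nbrs_iff)
    then show "E u x \<longleftrightarrow> u \<in> A" using sgD(4) by blast
    show "E y u \<longleftrightarrow> u \<in> A" using assms(2) by (metis nbrs_iff)
    then show "E u y \<longleftrightarrow> u \<in> A" using sgD(4) by blast
  qed
  have AV: "A \<subseteq> V - {x, y}" using adj sgD nonadj by blast
  have finA: "finite A" using AV finite_sub by blast
  have xA: "clique E (insert x A)" "clique E (insert x (A - {a}))" for a
    using assms(3) adj by (auto simp: clique_def)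
  have A2: "2 \<le> card A" using card_nbrs_y assms(2) by simp
  have xnA: "x \<notin> A" "y \<notin> A" using AV by auto
  show False
  proof (cases "k \<le> card A")
    case True
    obtain a where a: "a \<in> A" using A2 by fastforce
    have "has_path E V x y (2 + 1 * i)" if "i < k" for i
    proof -
      have p: "has_path E (insert x A) x a (1 + i)"
        by (rule clique_path) (use xA a xnA finA that True in auto)
      have q: "has_path E {a, y} a y 1" using a adj xnA by (intro has_path_edge) auto
      have "has_path E V x y (1 + i + 1)"
        by (rule has_path_join[OF p q]) (use a xnA AV rc in auto)
      then show ?thesis by simp
    qed
    then have "admissible E V x y k" unfolding admissible_def
      by (intro exI[of _ 2] exI[of _ 1]) auto
    then show False using counter by simp
  next
    case False
    have C_nb: "u \<in> C \<union> A" if "w \<in> C" "E w u" for u w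
      using that adj sgD(3) by (auto simp: C_def)
    \<comment> \<open>With nothing outside, \<open>a\<close> would have degree at most
      \<open>card A + 1 \<le> k\<close>.\<close>
    have C0: "C \<noteq> {}"
    proof
      assume C0: "C = {}"
      obtain a where a: "a \<in> A" using A2 by fastforce
      have "nbrs E a \<subseteq> insert x (insert y (A - {a}))"
      proof
        fix u assume "u \<in> nbrs E a"
        then have "u \<in> V" "u \<noteq> a" using sgD(3,5) by auto
        then show "u \<in> insert x (insert y (A - {a}))" using C0 unfolding C_def by blast
      qed
      then have "card (nbrs E a) \<le> card (insert x (insert y (A - {a})))"
        using finA by (intro card_mono) auto
      also have "\<dots> \<le> card A + 1" using finA a A2 by (auto simp: card_insert_if)
      finally show False using deg[of a] a AV False by (auto simp: degree_eq_card_nbrs)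
    qed
    have bC: "boundary E C \<subseteq> A" using C_nb by (auto simp: boundary_def)
    have "3 \<le> card (boundary E C)"
      by (rule separator[OF C0]) (use bC xnA rc in \<open>auto simp: C_def\<close>)
    moreover have "card (boundary E C) \<le> card A" by (rule card_mono[OF finA bC])
    ultimately have A3: "3 \<le> card A" and bne: "boundary E C \<noteq> {}" by auto
    then obtain a w0 where a: "a \<in> A" "w0 \<in> C" "E w0 a" using bC by (auto simp: boundary_def)
    let ?R = "reach E (insert a C) a" and ?A = "A - {a}"
    have R: "?R \<subseteq> insert a C" by (rule reach_subset)
    have aC: "a \<notin> C" using a by (simp add: C_def)
    have CV: "C \<subseteq> V - {x, y}" by (auto simp: C_def)
    have anch: "anchored E ?R a" by (rule reach_anchored) simp
    have aR: "a \<in> ?R" by (simp add: reach_self)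
    have w0R: "w0 \<in> ?R" by (rule reach_step[OF aR a(3)]) (use a in simp)
    have nb: "nbrs E w \<subseteq> ?R \<union> ?A" if w: "w \<in> ?R - {a}" for w
    proof
      fix u assume "u \<in> nbrs E w"
      then have u: "E w u" by simp
      have "w \<in> C" using w R by blast
      then have "u \<in> C \<union> A" using C_nb u by blast
      then show "u \<in> ?R \<union> ?A"
        using reach_step[of w E "insert a C" a u] w sgD(4)[OF u] aR by auto
    qed
    have cA: "card ?A = card A - 1" using finA a by simp
    have l: "linked E ?A ?R a"
    proof (rule anchored_linked[OF anch])
      show "?A \<inter> ?R = {}" using R by (auto simp: C_def)
      fix W assume W: "W \<noteq> {}" "W \<subseteq> ?R - {a}" "boundary E W \<inter> ?A = {}"
      have "boundary E W \<subseteq> ?R \<union> ?A"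
      proof
        fix u assume "u \<in> boundary E W"
        then obtain w where w: "w \<in> W" "E w u" by (auto simp: boundary_def)
        then have "w \<in> ?R - {a}" using W(2) by blast
        then show "u \<in> ?R \<union> ?A" using nbrs_subsetD[OF nb w(2)] by blast
      qed
      then have "boundary E W \<inter> ?R = boundary E W" using W(3) by blast
      moreover have "2 \<le> card (boundary E W)"
        using W R CV by (intro rooted_boundary[OF root]) blast+
      ultimately show "2 \<le> card (boundary E W \<inter> ?R)" by simp
    qed
    have q: "has_path E {a, y} a y 1" using a adj xnA by (intro has_path_edge) auto
    have H: "insert x ?A \<subseteq> V" "?A \<subseteq> insert x ?A" "?A \<noteq> {}" using AV rc cA A3 by force+
    have RV: "?R \<subseteq> V" "insert x ?A \<inter> ?R = {}" "?R - {a} \<noteq> {}" "?R - {a} \<subseteq> V - {x, y}"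
      using R a AV CV w0R aC xnA by (auto simp: C_def)
    show False
    proof (rule core_contra[OF H(1) RV(1) H(2,3) RV(2) _ l RV(3,4), where r = "card A - 1" and e = 1 and l = 1 and F = "{a, y}" and n = 1])
      show "card ?R + 1 < card V"
        by (rule card_two_outside[OF rc(1), of _ x y]) (use R xnA rc a CV RV in auto)
      show "nbrs E w \<subseteq> ?R \<union> insert x ?A" if "w \<in> ?R - {a}" for w using nb[OF that] by auto
      show "card (nbrs E w \<inter> insert x ?A) + 1 \<le> card A - 1 + (if nbrs E w \<inter> ?A = {} then 0 else 1)"
        if w: "w \<in> ?R - {a}" for w
      proof -
        have "w \<notin> A" using w R by (auto simp: C_def)
        then have eq: "nbrs E w \<inter> insert x ?A = nbrs E w \<inter> ?A" using adj by auto
        have "card (nbrs E w \<inter> ?A) \<le> card ?A" using finA by (intro card_mono) auto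
        then show ?thesis using cA A3 unfolding eq by auto
      qed
      show "has_path E (insert x ?A) x u (1 + 1 * i)" if "u \<in> ?A" "i < card A - 1" for u i
        by (rule clique_path) (use that xA cA xnA finA in auto)
      show "{a, y} \<inter> (insert x ?A \<union> ?R) = {a}" using xnA rc R CV aR by auto
    qed (use q a AV rc A3 in auto)
  qed
qed

text \<open>Two neighbours of \<open>y\<close> inside the clique form a triangle with
  \<open>y\<close>, so the clique case also applies at \<open>y\<close>. The chain \<open>K - {x}
  \<subseteq> nbrs E x \<subseteq> K' - {y} \<subseteq> nbrs E y \<subseteq> K - {x}\<close> then
  closes up.\<close>

lemma no_triangle:
  assumes "E x a" "E x b" "E a b"
  shows False
proof -
  interpret sw: critical V E y x k by (rule swap)
  obtain K where K: "clique E K" "x \<in> K" "nbrs E y \<subseteq> K - {x}" using clique_case[OF assms] by blast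
  obtain c d where cd: "c \<in> nbrs E y" "d \<in> nbrs E y" "c \<noteq> d"
    using card_nbrs_y by (metis card_le_Suc0_iff_eq finite_nbrs sg not_less_eq_eq numeral_2_eq_2)
  then have "c \<in> K" "d \<in> K" using K(3) by blast+
  then have "E c d" using K(1) cd(3) by (simp add: clique_def)
  then obtain K' where K': "clique E K'" "y \<in> K'" "nbrs E x \<subseteq> K' - {y}"
    using sw.clique_case[of c d] cd by auto
  have "K - {x} \<subseteq> nbrs E x" "K' - {y} \<subseteq> nbrs E y"
    using clique_nbrs[OF K(1,2)] clique_nbrs[OF K'(1,2)] .
  then have "nbrs E x = K - {x}" "nbrs E y = K - {x}" using K(3) K'(3) by blast+
  then show False using twin_clique clique_subset[OF K(1)] by blast
qed

text \<open>Three attachments \<open>c, x, p\<close> of \<open>Z\<close>: walk from \<open>x\<close> through \<open>Z\<close> to \<open>p\<close>, losing only \<open>c\<close>.  The missing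
  length is recovered from two lengths on the other side.\<close>

lemma three_cut:
  assumes Z: "Z \<noteq> {}" "Z \<subseteq> V - {x, y}" "boundary E Z \<subseteq> {c, x, p}" "p \<in> V - Z" "p \<noteq> x"
    and v: "v \<in> V" "v \<notin> Z" "v \<notin> {c, x, p}" and e: "e \<in> {1, 2}"
    and paths: "\<And>i. i < 2 \<Longrightarrow> has_path E (V - insert x Z) y p (l + e * i)"
  shows False
proof -
  interpret sw: critical V E y x k by (rule swap)
  let ?H = "V - insert x Z"
  have nb: "nbrs E w \<subseteq> Z \<union> {c, x, p}" if "w \<in> Z" for w
    using nbrs_Un_boundary[OF that, of E] Z(3) by blast
  have l: "linked E {p} (insert x Z) x"
  proof (rule linked_single)
    show "x \<in> insert x Z" "p \<notin> insert x Z" using Z by auto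
    fix W assume W: "W \<noteq> {}" "W \<subseteq> insert x Z - {x}"
    have b: "boundary E W \<subseteq> Z \<union> {c, x, p}" using boundary_subset_Un[of W Z E] W Z(3) by blast
    have "3 \<le> card (boundary E W)"
    proof (rule separator[OF W(1)])
      show "W \<subseteq> V - {x, y}" using W Z by blast
      show "W \<union> boundary E W \<noteq> V" using b W(2) v by blast
    qed
    moreover have "boundary E W \<subseteq> insert c (boundary E W \<inter> insert p (insert x Z))" using b by blast
    moreover have "finite (boundary E W \<inter> insert p (insert x Z))" using finite_boundary[OF sg] by blast
    ultimately show "2 \<le> card (boundary E W \<inter> insert p (insert x Z))" by (rule card_ge_2_of_insert)
  qed
  show False
  \<comment> \<open>The roots are exchanged: the walk starts at \<open>y\<close>, everything outside
    \<open>Z\<close> and \<open>x\<close> is the core, and \<open>x\<close> is the target.\<close>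
  proof (rule sw.core_contra[OF _ _ _ _ _ _ l, where H = ?H and r = 2 and e = e and l = l and F = "{x}" and n = 0])
    show "card (insert x Z) + 1 < card V"
      by (rule card_two_outside[OF rc(1), of _ p v]) (use Z v rc in auto)
    show "nbrs E w \<subseteq> insert x Z \<union> ?H" for w using sgD(3) by auto
    show "card (nbrs E w \<inter> ?H) + 1 \<le> 2 + (if nbrs E w \<inter> {p} = {} then 0 else 1)"
      if "w \<in> insert x Z - {x}" for w
    proof -
      have s: "nbrs E w \<inter> ?H \<subseteq> {c, p}" using nb[of w] that by blast
      show ?thesis
      proof (cases "nbrs E w \<inter> {p} = {}")
        case True
        then have "nbrs E w \<inter> ?H \<subseteq> {c}" using s by blast
        then show ?thesis using True card_le_1_of_subset_singleton by fastforce
      next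
        case False
        then show ?thesis using card_subset_pair_le_2[OF s] by simp
      qed
    qed
    show "has_path E {x} x x 0" by (rule has_path_refl) simp
  qed (use Z rc e paths in auto)
qed

section \<open>Cliques complete to neighbours of a root\<close>

lemma clique_nbr_case:
  assumes t0: "E x t0" "E t0 b1" "E t0 b2" "E b1 b2"
  obtains t b c where "nbrs E y \<subseteq> nbrs E x" "card (nbrs E y) = 2" "E y t" "E t b" "E t c" "E b c"
proof -
  interpret sw: critical V E y x k by (rule swap)
  define P where "P B \<longleftrightarrow> B \<subseteq> V - {x, y} \<and> clique E B \<and> (\<exists>t. E x t \<and> (\<forall>b\<in>B. E t b))" for B
  have b12: "b1 \<noteq> b2" "E b2 b1" "E b1 t0" "E b2 t0" "b1 \<in> V" "b2 \<in> V" using t0 sgD by blast+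
  moreover have "b1 \<noteq> x" "b2 \<noteq> x" using no_triangle[of t0] t0 b12 by blast+
  moreover have "b1 \<noteq> y" "b2 \<noteq> y" using sw.no_triangle[of t0] t0 b12 by blast+
  ultimately have "P {b1, b2}" using t0 by (auto simp: P_def clique_def)
  then have "\<exists>B. P B \<and> (\<forall>B'. P B' \<longrightarrow> card B' \<le> card B)"
    by (rule ex_max_card[OF rc(1)]) (auto simp: P_def)
  then obtain B where PB: "P B" and Bmax: "\<And>B'. P B' \<Longrightarrow> card B' \<le> card B" by blast
  have B2: "2 \<le> card B" using Bmax[OF \<open>P {b1, b2}\<close>] b12(1) by simp
  have B: "B \<subseteq> V - {x, y}" "clique E B" using PB by (auto simp: P_def)
  have finB: "finite B" using B finite_sub by blast
  define T where "T = {t. E x t \<and> (\<forall>b\<in>B. E t b)}"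
  have TV: "T \<subseteq> V" using sgD(3) by (auto simp: T_def)
  have finT: "finite T" using TV by (rule finite_sub)
  have T0: "T \<noteq> {}" using PB by (auto simp: P_def T_def)
  \<comment> \<open>An outside vertex adjacent to \<open>x\<close> and to all of \<open>B\<close>
    would exceed the budget of a core with a single \<open>t\<close>. Either no such vertex exists,
    or a second one enters the core and contributes one more length.\<close>
  have "\<exists>T1\<subseteq>T. (card T1 = 1 \<and> T1 = T) \<or> card T1 = 2"
  proof (cases "card T \<le> 1")
    case True
    then have "card T = 1" using T0 finT by (simp add: le_Suc_eq)
    then show ?thesis by blast
  next
    case False
    then have "2 \<le> card T" by simp
    then show ?thesis by (meson obtain_subset_with_card_n)
  qed
  then obtain T1 where T1: "T1 \<subseteq> T" "(card T1 = 1 \<and> T1 = T) \<or> card T1 = 2" by blast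
  define q where "q = card T1"
  have q: "q = 1 \<or> q = 2" "q = 1 \<Longrightarrow> T1 = T" using T1(2) by (auto simp: q_def)
  have finT1: "finite T1" using T1(1) finT finite_subset by blast
  have xT: "E x t" "E t x" "E t b" "E b t" if "t \<in> T1" "b \<in> B" for t b
    using that T1(1) sgD(4) by (auto simp: T_def)
  have xT1: "E x t" if "t \<in> T1" for t using that T1(1) by (auto simp: T_def)
  have T1x: "T1 \<subseteq> nbrs E x" using T1(1) by (auto simp: T_def)
  have ne1: "T1 \<noteq> {}" "B \<noteq> {}" using q(1) B2 by (auto simp: q_def)
  have T1_out: "x \<notin> T1" "y \<notin> T1" "T1 \<inter> B = {}" "T1 \<subseteq> V"
    using T1(1) TV nonadj sgD(5) by (auto simp: T_def)
  have cTB: "clique E (insert t B)" "t \<notin> B" "card (insert t B) = card B + 1" if t: "t \<in> T1" for t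
  proof -
    show "clique E (insert t B)" using t B(2) xT by (auto simp: clique_def)
    show "t \<notin> B" using t T1_out by blast
    then show "card (insert t B) = card B + 1" using finB by simp
  qed
  define H where "H = insert x (T1 \<union> B)"
  have H: "H \<subseteq> V - {y}" "x \<in> H" "B \<subseteq> H" "T1 \<subseteq> H" using B T1_out rc by (auto simp: H_def)
  note reg = region[OF H(1,2)]
  let ?D = "reach E (V - H) y"
  have HB: "H - B = insert x T1" using B T1_out by (auto simp: H_def)
  have DB: "?D \<inter> B = {}" "?D \<inter> T1 = {}" "x \<notin> ?D" using reg(2) H by blast+
  obtain b0 where b0: "b0 \<in> B" using ne1 by auto
  have no_T1_nbr: "nbrs E w \<inter> T1 = {}" if "E w x" for w
  proof -
    have "\<not> E w t" if "t \<in> T1" for t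
      using no_triangle[of w t] sgD(4)[OF \<open>E w x\<close>] xT1[OF that] by blast
    then show ?thesis by auto
  qed
  have nyH: "nbrs E y \<subseteq> H"
  proof (rule ccontr)
    assume n: "\<not> nbrs E y \<subseteq> H"
    have "\<not> linked E B ?D y"
    proof
      assume l: "linked E B ?D y"
      show False
      proof (rule core_contra[OF _ _ H(3) ne1(2) _ _ l, where r = "card B + q - 1" and e = 1 and l = 2 and F = "{y}" and n = 0])
        show "card ?D + 1 < card V"
          by (rule card_two_outside[OF rc(1), of _ x b0]) (use reg(2) DB B b0 rc in auto)
        show "card (nbrs E w \<inter> H) + 1 \<le> card B + q - 1 + (if nbrs E w \<inter> B = {} then 0 else 1)"
          if w: "w \<in> ?D - {y}" for w
        proof -
          have wH: "w \<in> V - H" "w \<noteq> y" using w reg(2) by auto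
          show ?thesis
          proof (cases "E w x")
            case True
            then have s: "nbrs E w \<inter> H \<subseteq> insert x (nbrs E w \<inter> B)"
              using no_T1_nbr[OF True] unfolding H_def by blast
            then have c: "card (nbrs E w \<inter> H) \<le> card (nbrs E w \<inter> B) + 1"
            proof -
              have "card (nbrs E w \<inter> H) \<le> card (insert x (nbrs E w \<inter> B))"
                by (rule card_mono[OF _ s]) (use finB in auto)
              also have "\<dots> \<le> card (nbrs E w \<inter> B) + 1" using finB by (simp add: card_insert_if)
              finally show ?thesis .
            qed
            have "card (nbrs E w \<inter> B) \<le> card B" using finB by (intro card_mono) auto
            moreover have "card (nbrs E w \<inter> B) < card B" if "q = 1"
            proof (rule psubset_card_mono[OF finB])
              have "w \<notin> T" using q(2)[OF that] wH H by blast
              moreover have "E x w" using True sgD(4) by blast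
              ultimately obtain b where "b \<in> B" "\<not> E w b" using sgD(4) unfolding T_def by blast
              then have "\<not> B \<subseteq> nbrs E w" by auto
              then show "nbrs E w \<inter> B \<subset> B" by blast
            qed
            ultimately show ?thesis using c q(1) B2 by (cases "nbrs E w \<inter> B = {}") auto
          next
            case False
            then have s: "nbrs E w \<inter> H \<subseteq> T1 \<union> B" by (auto simp: H_def)
            have cTB': "card (T1 \<union> B) = q + card B"
              using finT1 finB T1_out by (simp add: card_Un_disjoint q_def)
            show ?thesis
            proof (cases "nbrs E w \<inter> B = {}")
              case True
              then have "nbrs E w \<inter> H \<subseteq> T1" using s by blast
              then have "card (nbrs E w \<inter> H) \<le> q" unfolding q_def by (rule card_mono[OF finT1])
              then show ?thesis using True B2 by simp
            next
              case nB: False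
              have "\<not> T1 \<union> B \<subseteq> nbrs E w"
              proof
                assume a: "T1 \<union> B \<subseteq> nbrs E w"
                have wu: "E w u" "E u w" if "u \<in> T1 \<union> B" for u
                proof -
                  have "u \<in> nbrs E w" using that a by blast
                  then show "E w u" "E u w" using sgD(4) by auto
                qed
                obtain t where t: "t \<in> T1" using ne1 by auto
                then have "E t w" "E x t" using wu xT1 by auto
                moreover have "clique E (insert w B)" using wu B(2) by (auto simp: clique_def)
                ultimately have "P (insert w B)"
                  using wH H(2) B(1) xT(3)[OF t] by (auto simp: P_def)
                then have "card (insert w B) \<le> card B" by (rule Bmax)
                moreover have "w \<notin> B" using wH H(3) by blast
                ultimately show False using finB by simp
              qed
              then have "nbrs E w \<inter> H \<subset> T1 \<union> B" using s by blast
              then have "card (nbrs E w \<inter> H) < q + card B"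
                using psubset_card_mono[of "T1 \<union> B"] finT1 finB cTB' by simp
              then show ?thesis using nB B2 by simp
            qed
          qed
        qed
        \<comment> \<open>One member of \<open>T1\<close> gives the lengths \<open>2\<close> to
          \<open>card B + 1\<close>. A second member, visited from within \<open>B\<close>, gives
          \<open>card B + 2\<close>.\<close>
        show "has_path E H x b (2 + 1 * i)" if bi: "b \<in> B" "i < card B + q - 1" for b i
        proof (cases "i < card B")
          case True
          obtain t where t: "t \<in> T1" using ne1 by auto
          have "has_path E (insert t B) t b (1 + i)"
            by (rule clique_path) (use cTB[OF t] finB bi True in auto)
          then have "has_path E (insert x (insert t B)) x b (Suc (1 + i))"
            by (rule has_path_Cons[where E = E, rotated]) (use t xT bi T1_out B in auto)
          then show ?thesis using t by (auto simp: H_def elim!: has_path_mono)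
        next
          case False
          then have i: "i = card B" "card T1 = 2" using bi(2) q(1) by (auto simp: q_def)
          then obtain t t' where t: "t \<in> T1" "t' \<in> T1" "t \<noteq> t'" by (auto simp: card_2_iff)
          have "\<not> B \<subseteq> {b}" using B2 card_le_1_of_subset_singleton[of B b] by auto
          then obtain b' where b': "b' \<in> B" "b' \<noteq> b" by blast
          have "has_path E (insert t' B) b' b (card B)"
            by (rule clique_path) (use cTB[OF t(2)] finB bi b' B2 in auto)
          then have "has_path E (insert t (insert t' B)) t b (Suc (card B))"
            by (rule has_path_Cons[where E = E, rotated]) (use t xT b' cTB(2) in auto)
          then have "has_path E (insert x (insert t (insert t' B))) x b (Suc (Suc (card B)))"
            by (rule has_path_Cons[where E = E, rotated]) (use t xT b' T1_out B in auto)
          then show ?thesis using t i by (auto simp: H_def elim!: has_path_mono)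
        qed
        show "?D - {y} \<noteq> {}" by (rule reg(7)[OF n])
        show "nbrs E w \<subseteq> ?D \<union> H" if "w \<in> ?D - {y}" for w using reg(6) that by blast
        show "has_path E {y} y y 0" by (rule has_path_refl) simp
      qed (use reg(2,3,5) H B2 q(1) rc in auto)
    qed
    then have "\<exists>Z c. Z \<noteq> {} \<and> Z \<subseteq> ?D - {y} \<and> c \<in> ?D - Z \<and> boundary E Z \<subseteq> insert c (H - B)"
      by (intro not_linked_gap[OF reg(1)]) (use reg(4,6) DB in auto)
    then obtain Z c where Z: "Z \<noteq> {}" "Z \<subseteq> ?D - {y}" "c \<in> ?D" "c \<notin> Z"
        "boundary E Z \<subseteq> insert c (insert x T1)"
      unfolding HB by blast
    have Zxy: "Z \<subseteq> V - {x, y}" using Z(2) reg(5) by blast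
    have bZD: "boundary E Z \<inter> ?D \<subseteq> {c}" using Z(5) DB by blast
    have anchZ: "anchored E (?D - Z) y" by (rule anchored_diff[OF reg(1) Z(2,4) bZD sgD(4)])
    have b0Z: "b0 \<notin> Z" "b0 \<notin> insert c (insert x T1)" using b0 Z DB B T1_out by blast+
    have nbZ: "nbrs E w \<subseteq> Z \<union> insert c (insert x T1)" if "w \<in> Z" for w
      using nbrs_Un_boundary[OF that, of E] Z(5) by blast
    show False
    proof (cases "q = 1")
      case True
      then obtain t where t: "T1 = {t}" by (auto simp: q_def card_1_singleton_iff)
      have "boundary E ?D \<inter> B \<noteq> {}"
      proof
        assume "boundary E ?D \<inter> B = {}"
        from reach_complement_boundary[OF sg H(3) this]
        have "boundary E (V - ?D - {x, t}) \<subseteq> {x, t}" using HB t by auto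
        moreover have "b0 \<in> V - ?D - {x, t}" using b0 DB B T1_out t by auto
        ultimately show False
          by (intro no_2_cut[of "V - ?D - {x, t}" x t y]) (use reg(3) rc T1_out t in auto)
      qed
      then obtain d b where d: "d \<in> ?D" "b \<in> B" "E d b" by (auto simp: boundary_def)
      have "d \<notin> Z"
      proof
        assume "d \<in> Z"
        then have "b \<in> Z \<union> insert c (insert x T1)" using nbrs_subsetD[OF nbZ d(3)] by blast
        then show False using d Z DB B T1_out by blast
      qed
      then obtain n where n: "has_path E (?D - Z) d y n" using anchored_path[OF anchZ] d(1) by blast
      have bD: "b \<notin> ?D - Z" using d DB by blast
      have "has_path E (insert b (?D - Z)) b y (Suc n)"
        by (rule has_path_Cons[where E = E, OF sgD(4)[OF d(3)] n bD])
      then have n': "has_path E (insert b (?D - Z)) y b (Suc n)" by (rule has_path_sym) (rule sgD(4))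
      show False
      \<comment> \<open>The attachments are \<open>c\<close>, \<open>x\<close> and \<open>t\<close>.
        The two lengths from \<open>y\<close> to \<open>t\<close> come from entering the clique
        \<open>insert t B\<close> at \<open>b\<close>.\<close>
      proof (rule three_cut[OF Z(1) Zxy, where c = c and p = t and v = b0 and e = 1 and l = "Suc n + 1"])
        fix i :: nat assume i: "i < 2"
        have "has_path E (insert t B) b t (1 + i)"
          by (rule clique_path) (use cTB t finB d i B2 in auto)
        then have "has_path E (V - insert x Z) y t (Suc n + (1 + i))"
          by (rule has_path_join[OF n']) (use d DB B T1_out t Z(2) reg(2) H in auto)
        then show "has_path E (V - insert x Z) y t (Suc n + 1 + 1 * i)" by simp
      qed (use Z t T1_out DB b0 b0Z B in auto)
    next
      case False
      then have q2: "card T1 = 2" using q(1) by (simp add: q_def)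
      obtain n where n: "has_path E (?D - Z) c y n" using anchored_path[OF anchZ] Z(3,4) by blast
      have l: "linked E T1 (insert c Z) c"
      proof (rule gap_linked[OF reg(1) Z(2) _ bZD])
        fix W assume W: "W \<noteq> {}" "W \<subseteq> Z" "boundary E W \<inter> T1 = {}"
        have b: "boundary E W \<subseteq> Z \<union> insert c (insert x T1)"
          using boundary_subset_Un[OF W(2), of E] Z(5) by blast
        have "3 \<le> card (boundary E W)"
        proof (rule separator[OF W(1)])
          show "W \<union> boundary E W \<noteq> V" using b W(2) b0 b0Z B by blast
        qed (use W Zxy in blast)
        moreover have "boundary E W \<subseteq> insert x (boundary E W \<inter> insert c Z)" using b W(3) by blast
        moreover have "finite (boundary E W \<inter> insert c Z)" using finite_boundary[OF sg] by blast
        ultimately show "2 \<le> card (boundary E W \<inter> insert c Z)" by (rule card_ge_2_of_insert)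
      qed (use Z in auto)
      have cV: "c \<in> V" using Z(3) reg(2) by blast
      show False
      \<comment> \<open>Now \<open>T1\<close> is contracted instead of \<open>B\<close>, and
        \<open>c\<close> is the target. Lengths 3 and 4 from \<open>x\<close> to one member of
        \<open>T1\<close> run through the other member and \<open>B\<close>.\<close>
      proof (rule core_contra[OF _ _ H(4) ne1(1) _ _ l, where r = 2 and e = 1 and l = 3 and F = "?D - Z" and n = n])
        show "card (insert c Z) + 1 < card V"
          by (rule card_two_outside[OF rc(1), of _ x b0]) (use Z Zxy cV b0 b0Z B DB rc in auto)
        show "nbrs E w \<subseteq> insert c Z \<union> H" if "w \<in> insert c Z - {c}" for w
          using nbZ[of w] that unfolding H_def by blast
        show "card (nbrs E w \<inter> H) + 1 \<le> 2 + (if nbrs E w \<inter> T1 = {} then 0 else 1)"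
          if w: "w \<in> insert c Z - {c}" for w
        proof -
          have s: "nbrs E w \<inter> H \<subseteq> insert x T1" using nbZ[of w] w Z(2,3) DB B reg(2) by blast
          show ?thesis
          proof (cases "E w x")
            case True
            then have "nbrs E w \<inter> H \<subseteq> {x}" using s no_T1_nbr[OF True] by blast
            then have "card (nbrs E w \<inter> H) \<le> 1" by (rule card_le_1_of_subset_singleton)
            then show ?thesis by simp
          next
            case False
            then have s': "nbrs E w \<inter> H \<subseteq> nbrs E w \<inter> T1" using s by auto
            show ?thesis
            proof (cases "nbrs E w \<inter> T1 = {}")
              case True
              then have "nbrs E w \<inter> H = {}" using s' by blast
              then show ?thesis by simp
            next
              case False
              have "card (nbrs E w \<inter> H) \<le> card T1" using s' finT1 by (intro card_mono) auto
              then show ?thesis using q2 False by simp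
            qed
          qed
        qed
        show "has_path E H x a (3 + 1 * i)" if a: "a \<in> T1" "i < 2" for a i
        proof -
          have "\<not> T1 \<subseteq> {a}" using q2 card_le_1_of_subset_singleton[of T1 a] by auto
          then obtain t where t: "t \<in> T1" "t \<noteq> a" by blast
          have "has_path E (insert a B) b0 a (1 + i)"
            by (rule clique_path) (use cTB[OF a(1)] finB b0 a B2 in auto)
          then have "has_path E (insert t (insert a B)) t a (Suc (1 + i))"
            by (rule has_path_Cons[where E = E, rotated]) (use t xT b0 cTB(2) in auto)
          then have "has_path E (insert x (insert t (insert a B))) x a (Suc (Suc (1 + i)))"
            by (rule has_path_Cons[where E = E, rotated]) (use t xT b0 a T1_out B in auto)
          then show ?thesis using t a by (auto simp: H_def numeral_3_eq_3 elim!: has_path_mono)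
        qed
        show "(?D - Z) \<inter> (H \<union> insert c Z) = {c}" using Z(3,4) reg(2) by blast
        show "H \<inter> insert c Z = {}" using Z(2,3) reg(2) by blast
      qed (use n Z Zxy cV reg(2) H in auto)
    qed
  qed
  \<comment> \<open>A neighbour of \<open>y\<close> in \<open>B\<close> is adjacent to every other
    neighbour of \<open>y\<close>, which would form a triangle at \<open>y\<close>.\<close>
  have B_one: "nbrs E y \<inter> B = {}"
  proof (rule ccontr)
    assume "\<not> ?thesis"
    then obtain b where b: "b \<in> B" "E y b" by auto
    have "nbrs E y \<subseteq> {b}"
    proof
      fix u assume u: "u \<in> nbrs E y"
      then have "u \<noteq> x" using nonadj sgD(4) by auto
      then have "u \<in> T1 \<union> B" using u nyH by (auto simp: H_def)
      then have "u \<noteq> b \<Longrightarrow> E u b" using b(1) xT B(2) by (auto simp: clique_def)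
      then show "u \<in> {b}" using sw.no_triangle[of u b] u b by auto
    qed
    then show False using card_nbrs_y card_le_1_of_subset_singleton by fastforce
  qed
  have "nbrs E y \<subseteq> T1" using nyH B_one nonadj sgD(4) by (fastforce simp: H_def)
  moreover have "card T1 \<le> card (nbrs E y)" using card_nbrs_y q(1) by (auto simp: q_def)
  ultimately have N: "nbrs E y = T1" by (rule card_seteq[OF finT1])
  have "card (nbrs E y) = 2" using N card_nbrs_y q(1) by (auto simp: q_def)
  moreover obtain t where t: "t \<in> T1" using ne1 by auto
  moreover have "E y t" using t N by (metis nbrs_iff)
  moreover have "\<not> B \<subseteq> {b0}" using B2 card_le_1_of_subset_singleton[of B b0] by auto
  then obtain b' where "b' \<in> B" "b' \<noteq> b0" by blast
  moreover have "E b0 b'" using calculation b0 B(2) by (auto simp: clique_def)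
  ultimately show ?thesis using that[of t b0 b'] T1x N xT b0 by auto
qed

text \<open>Applying the previous case at both roots shows that they have the same two neighbours,
  and these separate \<open>b\<close> from the roots.\<close>

lemma no_nbr_triangle:
  assumes "E x t" "E t b" "E t c" "E b c"
  shows False
proof -
  interpret sw: critical V E y x k by (rule swap)
  obtain t' b' c' where 1: "nbrs E y \<subseteq> nbrs E x" "card (nbrs E y) = 2"
      "E y t'" "E t' b'" "E t' c'" "E b' c'"
    using clique_nbr_case[OF assms] by blast
  have 2: "nbrs E x \<subseteq> nbrs E y" using sw.clique_nbr_case[OF 1(3-6)] by blast
  then have N: "nbrs E x = nbrs E y" using 1(1) by blast
  have b: "b \<in> V" "b \<notin> nbrs E x" "b \<noteq> x" "b \<noteq> y"
  proof -
    show "b \<in> V" using assms sgD(2) by blast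
    show nb: "b \<notin> nbrs E x" using no_triangle[of t b] assms by auto
    show "b \<noteq> x" using no_triangle[of t c] assms by auto
    show "b \<noteq> y" using sw.no_triangle[of t c] assms sgD(4) by blast
  qed
  let ?W = "V - {x, y} - nbrs E x"
  have "boundary E ?W \<subseteq> nbrs E x"
  proof
    fix u assume "u \<in> boundary E ?W"
    then obtain w where w: "w \<in> ?W" "E w u" "u \<notin> ?W" unfolding boundary_def by blast
    have "w \<notin> nbrs E x" "w \<notin> nbrs E y" using w(1) N by blast+
    then have "u \<noteq> x" "u \<noteq> y" using w(2) sgD(4) by auto
    then show "u \<in> nbrs E x" using w sgD(3) by blast
  qed
  moreover obtain p q where "nbrs E x = {p, q}" using 1(2) N by (metis card_2_iff)
  moreover have "x \<notin> nbrs E x" using sgD(5) by simp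
  ultimately show False
    by (intro no_2_cut[of ?W p q x]) (use b rc in auto)
qed

section \<open>Complete bipartite cores\<close>

lemma bipartite_gap:
  assumes S: "x \<in> S" "S \<subseteq> V - {y}" and T: "T \<subseteq> V - {y}" "T \<noteq> {}"
    and ST: "\<And>s t. s \<in> S \<Longrightarrow> t \<in> T \<Longrightarrow> E s t" "S \<inter> T = {}" "card S \<le> card T + 1" "3 \<le> card S"
    and D: "anchored E D y'" "D \<subseteq> V - (S \<union> T)" "D - {y'} \<subseteq> V - {x, y}"
    and Z: "Z \<noteq> {}" "Z \<subseteq> D - {y'}" "c \<in> D" "c \<notin> Z" "boundary E Z \<subseteq> insert c S"
    and loss: "\<And>w. w \<in> Z \<Longrightarrow> card (nbrs E w \<inter> S) < card S"
    and F: "has_path E F y' y n" "F \<subseteq> V" "F \<inter> (S \<union> T \<union> D) = {y'}"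
  shows False
proof -
  let ?A = "S - {x}" and ?H = "S \<union> T"
  have fin: "finite S" "finite T" using S T finite_sub by blast+
  have cA: "card ?A = card S - 1" using S fin by simp
  obtain t where t: "t \<in> T" using T by auto
  have Zxy: "Z \<subseteq> V - {x, y}" using Z D by blast
  have bZD: "boundary E Z \<inter> D \<subseteq> {c}" using Z(5) D(2) by blast
  have anchZ: "anchored E (D - Z) y'" by (rule anchored_diff[OF D(1) Z(2,4) bZD sgD(4)])
  obtain m where m: "has_path E (D - Z) c y' m" using anchored_path[OF anchZ] Z(3,4) by blast
  have nbZ: "nbrs E w \<subseteq> Z \<union> insert c S" if "w \<in> Z" for w
    using nbrs_Un_boundary[OF that, of E] Z(5) by blast
  have DH: "D \<inter> S = {}" "D \<inter> T = {}" using D(2) by blast+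
  have y'D: "y' \<in> D" using D(1) by (simp add: anchored_def)
  have F': "F \<inter> (S \<union> T) = {}" "F \<inter> D = {y'}"
  proof -
    have "v = y'" if "v \<in> F" "v \<in> S \<union> T \<union> D" for v using F(3) that by blast
    then show "F \<inter> (S \<union> T) = {}" using y'D D(2) by blast
    show "F \<inter> D = {y'}" using F(3) y'D by blast
  qed
  have y'Z: "y' \<notin> Z" using Z(2) by blast
  \<comment> \<open>\<open>y'\<close> is \<open>y\<close> itself in one application and a neighbour
    of \<open>y\<close> in the other; \<open>F\<close> bridges the difference.\<close>
  have cy: "has_path E ((D - Z) \<union> F) c y (m + n)"
    by (rule has_path_join[OF m F(1)]) (use F' in blast)+
  have A0: "?A \<noteq> {}" using cA ST(4) by force
  have tZ: "t \<notin> Z \<union> insert c S" using t Z(2,3) DH ST(2) by blast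
  have l: "linked E ?A (insert c Z) c"
  proof (rule gap_linked[OF D(1) Z(2) _ bZD])
    fix W assume W: "W \<noteq> {}" "W \<subseteq> Z" "boundary E W \<inter> ?A = {}"
    have b: "boundary E W \<subseteq> Z \<union> insert c S"
      using boundary_subset_Un[OF W(2), of E] Z(5) by blast
    have "3 \<le> card (boundary E W)"
    proof (rule separator[OF W(1)])
      show "W \<union> boundary E W \<noteq> V" using b W(2) tZ t T(1) by blast
    qed (use W Zxy in blast)
    moreover have "boundary E W \<subseteq> insert x (boundary E W \<inter> insert c Z)" using b W(3) by blast
    moreover have "finite (boundary E W \<inter> insert c Z)" using finite_boundary[OF sg] by blast
    ultimately show "2 \<le> card (boundary E W \<inter> insert c Z)" by (rule card_ge_2_of_insert)
  qed (use Z in blast)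
  have cV: "c \<in> V" using Z(3) D(2) by blast
  show False
  \<comment> \<open>As \<open>Z\<close> sees \<open>S\<close> and not \<open>T\<close>, the side
    \<open>S - {x}\<close> is contracted and the lengths are even. A vertex whose only neighbour in
    \<open>S\<close> is \<open>x\<close> loses it without compensation; the budget
    \<open>card S - 2\<close> covers this thanks to \<open>3 \<le> card S\<close>.\<close>
  proof (rule core_contra[OF _ _ _ A0 _ _ l, where H = ?H and r = "card S - 1" and e = 2 and l = 2
        and F = "(D - Z) \<union> F" and n = "m + n"])
    show "card (insert c Z) + 1 < card V"
      by (rule card_two_outside[OF rc(1), of _ x t]) (use Z(3,4) Zxy cV t tZ S T DH rc ST(2) in blast)+
    show "nbrs E w \<subseteq> insert c Z \<union> ?H" if "w \<in> insert c Z - {c}" for w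
      using nbZ[of w] that by blast
    show "card (nbrs E w \<inter> ?H) + 1 \<le> card S - 1 + (if nbrs E w \<inter> ?A = {} then 0 else 1)"
      if w: "w \<in> insert c Z - {c}" for w
    proof -
      have wZ: "w \<in> Z" using w by blast
      have s: "nbrs E w \<inter> ?H = nbrs E w \<inter> S" using nbZ[OF wZ] Z(2,3) DH by blast
      show ?thesis
      proof (cases "nbrs E w \<inter> ?A = {}")
        case True
        then have "nbrs E w \<inter> S \<subseteq> {x}" by blast
        then have "card (nbrs E w \<inter> S) \<le> 1" by (rule card_le_1_of_subset_singleton)
        then show ?thesis unfolding s using True ST(4) by simp
      next
        case False
        then show ?thesis unfolding s using loss[OF wZ] by simp
      qed
    qed
    show "has_path E ?H x a (2 + 2 * i)" if a: "a \<in> ?A" "i < card S - 1" for a i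
      by (rule bipartite_path_same) (use fin ST S a sgD(4) in auto)
    show "((D - Z) \<union> F) \<inter> (?H \<union> insert c Z) = {c}" using F' DH Z(2-4) y'Z by blast
    show "?H \<inter> insert c Z = {}" using DH Z(2,3) by blast
    show "insert c Z - {c} \<noteq> {}" "insert c Z - {c} \<subseteq> V - {x, y}" using Z(1,4) Zxy by blast+
    show "?H \<subseteq> V" "insert c Z \<subseteq> V" "(D - Z) \<union> F \<subseteq> V" "?A \<subseteq> ?H" using S T cV Zxy D F by blast+
    show "1 \<le> card S - 1" using ST(4) by simp
  qed (use cy in auto)
qed

text \<open>With sides \<open>{x, u}\<close> and \<open>T\<close>, contracting \<open>{x, u}\<close> would mix parities.  Instead the two
  \<open>u\<close>-\<open>y\<close> lengths needed for the 3-cut come from the case \<open>k = 2\<close>, with \<open>c\<close> exceptional; maximality of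
  \<open>Z\<close> makes the remaining graph rooted.\<close>

lemma pair_gap:
  assumes k3: "3 \<le> k" and S: "S = {x, u}" "u \<noteq> x" "S \<subseteq> V - {y}" and T: "T \<subseteq> V - {y}" "T \<noteq> {}"
    and ST: "\<And>s t. s \<in> S \<Longrightarrow> t \<in> T \<Longrightarrow> E s t" "S \<inter> T = {}"
    and Z: "Z \<noteq> {}" "Z \<subseteq> reach E (V - (S \<union> T)) y - {y}" "c \<in> reach E (V - (S \<union> T)) y" "c \<notin> Z"
      "boundary E Z \<subseteq> insert c S"
    and Zmax: "\<And>Z' c'. Z' \<noteq> {} \<Longrightarrow> Z' \<subseteq> reach E (V - (S \<union> T)) y - {y}
      \<Longrightarrow> c' \<in> reach E (V - (S \<union> T)) y - Z' \<Longrightarrow> boundary E Z' \<subseteq> insert c' S \<Longrightarrow> card Z' \<le> card Z"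
  shows False
proof -
  let ?H = "S \<union> T"
  let ?D = "reach E (V - ?H) y"
  have H: "?H \<subseteq> V - {y}" "x \<in> ?H" using S T by auto
  note reg = region[OF H]
  have DH: "?D \<inter> S = {}" "?D \<inter> T = {}" "x \<notin> ?D" "u \<notin> ?D" using reg(2) S(1) by blast+
  have uV: "u \<in> V" "u \<noteq> y" using S by auto
  have Zxy: "Z \<subseteq> V - {x, y}" using Z(2) reg(5) by blast
  obtain t where t: "t \<in> T" using T by auto
  have cV: "c \<in> V" "c \<noteq> x" "c \<noteq> u" "c \<notin> T" using Z(3) DH reg(2) by blast+
  \<comment> \<open>The graph in which two \<open>u\<close>-\<open>y\<close> lengths are sought,
    avoiding what the 3-cut argument uses. Edges are restricted too because
    \<open>simple_graph\<close> confines them to the vertex set.\<close>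
  define V4 where "V4 = V - insert x Z"
  define E4 where "E4 a b \<longleftrightarrow> E a b \<and> a \<in> V4 \<and> b \<in> V4" for a b
  have TV4: "T \<subseteq> V4" using T Z(2) DH ST(2) S(1) unfolding V4_def by blast
  have uV4: "u \<in> V4" "y \<in> V4" using uV Z(2) DH rc S(2) unfolding V4_def by blast+
  have sg4: "simple_graph V4 E4"
    unfolding simple_graph_def E4_def using rc(1) sgD(4,5) by (auto simp: V4_def)
  have root4: "rooted V4 E4 u y"
    unfolding rooted_def
  proof (intro conjI allI impI)
    show "simple_graph V4 E4" "u \<in> V4" "y \<in> V4" "u \<noteq> y" using sg4 uV4 uV by auto
    fix W assume W: "W \<noteq> {} \<and> W \<subseteq> V4 - {u, y}"
    have b4: "boundary E4 W = boundary E W \<inter> V4" using W by (auto simp: boundary_def E4_def)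
    show "2 \<le> card (boundary E4 W)"
    proof (rule ccontr)
      assume n: "\<not> 2 \<le> card (boundary E4 W)"
      obtain e where "boundary E4 W \<subseteq> {e}" by (rule card_le_1E[OF finite_boundary[OF sg4] n])
      then have e: "boundary E W \<inter> V4 \<subseteq> {e}" unfolding b4 .
      have WV: "W \<subseteq> V - {x, y}" "W \<inter> Z = {}" using W unfolding V4_def by blast+
      show False
      \<comment> \<open>From outside, \<open>Z\<close> is seen only by \<open>c\<close>,
        \<open>x\<close> and \<open>u\<close>. Without \<open>c\<close>, the set \<open>W\<close>
        misses \<open>Z\<close>, and its boundary in the whole graph lies in \<open>{e, x}\<close>,
        a forbidden 2-cut.\<close>
      proof (cases "c \<in> W")
        case False
        have "boundary E W \<inter> Z = {}"
        proof (rule ccontr)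
          assume "\<not> ?thesis"
          then obtain z w where zw: "z \<in> Z" "w \<in> W" "E w z" by (auto simp: boundary_def)
          then have "w \<in> Z \<union> boundary E Z" using sgD(4)[OF zw(3)] by (auto simp: boundary_def)
          then have "w \<in> insert c S" using Z(5) WV(2) zw(2) by blast
          then show False using False zw(2) W S(1) WV(1) by blast
        qed
        moreover have "boundary E W \<subseteq> V" using boundary_subset[OF sg] by blast
        ultimately have "boundary E W \<subseteq> {e, x}" using e unfolding V4_def by blast
        moreover obtain z where z: "z \<in> Z" using Z(1) by auto
        moreover have "z \<notin> boundary E W" using z \<open>boundary E W \<inter> Z = {}\<close> by blast
        ultimately have "3 \<le> card (boundary E W)" "card (boundary E W) \<le> 2"
          using separator[of W] W WV Zxy card_subset_pair_le_2[of "boundary E W" e x] by blast+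
        then show False by simp
      next
        case True
        let ?W = "W \<union> Z"
        have b: "boundary E ?W \<subseteq> {e, x, u}"
        proof
          fix v assume "v \<in> boundary E ?W"
          then obtain w where w: "w \<in> ?W" "E w v" "v \<notin> ?W" unfolding boundary_def by blast
          show "v \<in> {e, x, u}"
          proof (cases "w \<in> W")
            case True
            then have "v \<in> boundary E W" using w by (auto simp: boundary_def)
            then show ?thesis using e w sgD(3)[OF w(2)] unfolding V4_def by blast
          next
            case False
            then have "v \<in> boundary E Z" using w by (auto simp: boundary_def)
            then show ?thesis using Z(5) \<open>c \<in> W\<close> w(3) S(1) by blast
          qed
        qed
        have WZ: "?W \<subseteq> V - {x, y}" using WV Zxy by blast
        have eu: "e \<noteq> u"
        proof
          assume "e = u"
          then have "boundary E ?W \<subseteq> {x, u}" using b by blast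
          moreover have "?W \<noteq> {}" using Z(1) by blast
          ultimately show False
            using no_2_cut[OF _ WZ, of x u y] WZ rc(3,4) uV by blast
        qed
        have TW: "T \<inter> W = {}"
        proof (rule ccontr)
          assume "\<not> ?thesis"
          then obtain s where s: "s \<in> T" "s \<in> W" by auto
          then have "E s u" using ST(1)[of u s] S(1) sgD(4) by simp
          then have "u \<in> boundary E W \<inter> V4" using s W uV4 by (auto simp: boundary_def)
          then show False using e eu by blast
        qed
        \<comment> \<open>A gap larger than \<open>Z\<close>, with \<open>e\<close> as its
          attachment, against maximality.\<close>
        define W'' where "W'' = ?W \<inter> ?D"
        have c'': "c \<in> W''" "Z \<subseteq> W''" using True Z(2,3) by (auto simp: W''_def)
        have W''D: "W'' \<subseteq> ?D - {y}" using WZ unfolding W''_def by blast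
        have uW: "u \<notin> W" using W by blast
        have b'': "boundary E W'' \<subseteq> {e, x, u}"
        proof
          fix v assume "v \<in> boundary E W''"
          then obtain w where w: "w \<in> ?W" "w \<in> ?D" "E w v" "v \<notin> W''"
            unfolding boundary_def W''_def by blast
          have vD: "v \<in> ?D \<union> ?H" by (rule nbrs_subsetD[OF reg(6)[OF w(2)] w(3)])
          show "v \<in> {e, x, u}"
          proof (cases "v \<in> ?W")
            case True
            then have "v \<in> ?H" using w(4) vD unfolding W''_def by blast
            moreover have "v \<notin> Z" using \<open>v \<in> ?H\<close> Z(2) DH by blast
            ultimately show ?thesis using True TW S(1) uW WV by blast
          next
            case False
            then have "v \<in> boundary E ?W" using w by (auto simp: boundary_def)
            then show ?thesis using b by blast
          qed
        qed
        have W''0: "W'' \<noteq> {}" using c'' by blast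
        have "boundary E W'' \<inter> ?D \<noteq> {}" by (rule anchored_boundary[OF reg(1) W''0 W''D])
        then have eD: "e \<in> ?D" "e \<in> boundary E W''" using b'' DH by blast+
        then have "e \<in> ?D - W''" by (auto simp: boundary_def)
        moreover have "boundary E W'' \<subseteq> insert e S" using b'' S(1) by blast
        ultimately have "card W'' \<le> card Z" using Zmax[OF W''0 W''D] by blast
        moreover have "Z \<subset> W''" using c'' Z(4) by blast
        moreover have "finite W''" using W''D reg(4) finite_subset by blast
        ultimately show False using psubset_card_mono[of W'' Z] by simp
      qed
    qed
  qed
  have "admissible E4 V4 u y 2"
  \<comment> \<open>Vertices other than the roots and \<open>c\<close> have no neighbour in
    \<open>Z\<close> and lose at most \<open>x\<close>, so they keep degree at least
    \<open>k \<ge> 3\<close>. The loss at \<open>c\<close> is not bounded.\<close>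
  proof (rule two_admissible[OF root4, where z = c])
    have "t \<in> V4 - {u, y, c}" using t TV4 T cV ST(2) S(1) by blast
    then show "V4 - {u, y, c} \<noteq> {}" by blast
    fix v assume v: "v \<in> V4 - {u, y, c}"
    have "nbrs E v \<inter> Z = {}"
    proof (rule ccontr)
      assume "\<not> ?thesis"
      then obtain z where z: "z \<in> Z" "E v z" by auto
      then have "v \<in> Z \<union> boundary E Z" using sgD(4)[OF z(2)] by (auto simp: boundary_def)
      then show False using v Z(5) S(1) unfolding V4_def by blast
    qed
    then have "nbrs E v - {x} \<subseteq> nbrs E4 v"
      using v sgD(3) by (auto simp: E4_def V4_def)
    then have "card (nbrs E v - {x}) \<le> card (nbrs E4 v)" by (rule card_mono[OF finite_nbrs[OF sg4]])
    moreover have "card (nbrs E v) - 1 \<le> card (nbrs E v - {x})"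
      by (metis card_Diff_singleton_if diff_le_self order_refl)
    moreover have "k + 1 \<le> card (nbrs E v)"
      using deg[of v] v by (auto simp: degree_eq_card_nbrs V4_def)
    ultimately show "3 \<le> degree E4 v" using k3 unfolding degree_eq_card_nbrs by linarith
  qed
  then obtain l d where ld: "d \<in> {1, 2}" "\<And>i. i < 2 \<Longrightarrow> has_path E4 V4 u y (l + d * i)"
    unfolding admissible_def by blast
  show False
  proof (rule three_cut[OF Z(1) Zxy, where c = c and p = u and v = t and e = d and l = l])
    show "boundary E Z \<subseteq> {c, x, u}" using Z(5) S(1) by blast
    show "t \<in> V" "t \<notin> Z" "t \<notin> {c, x, u}" using t T Z(2) DH cV ST(2) S(1) by blast+
    fix i :: nat assume "i < 2"
    then have "has_path E V4 u y (l + d * i)"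
      by (rule has_path_mono_edges[OF ld(2)]) (simp add: E4_def)
    then show "has_path E (V - insert x Z) y u (l + d * i)"
      unfolding V4_def by (rule has_path_sym) (rule sgD(4))
  qed (use uV S(2) Z(2) DH ld(1) in blast)+
qed

text \<open>\<open>S\<close> is largest among the sets containing \<open>x\<close> with at least as
  many common neighbours as members. A vertex with more than \<open>card S\<close> neighbours in
  \<open>T\<close> could join \<open>S\<close>; a vertex outside \<open>T\<close> misses a member of
  \<open>S\<close>; and no vertex sees both sides. Together these bound the loss by
  \<open>card S - 1\<close>.\<close>

lemma bipartite_case:
  "\<exists>S T. x \<in> S \<and> S \<subseteq> V - {y} \<and> T \<subseteq> nbrs E x \<and> (\<forall>s\<in>S. \<forall>t\<in>T. E s t) \<and> card S \<le> card T \<and> S \<inter> T = {}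
    \<and> (\<forall>w\<in>V - {y} - S - T. card (nbrs E w \<inter> T) \<le> card S) \<and> (nbrs E y \<subseteq> T \<or> nbrs E y \<subseteq> S - {x})"
proof -
  interpret sw: critical V E y x k by (rule swap)
  define CN where "CN S = {t. \<forall>s\<in>S. E s t}" for S
  define P where "P S \<longleftrightarrow> x \<in> S \<and> S \<subseteq> V - {y} \<and> card S \<le> card (CN S)" for S
  have "CN {x} = nbrs E x" by (auto simp: CN_def)
  then have "P {x}" using sw.card_nbrs_y rc by (simp add: P_def)
  then have "\<exists>S. P S \<and> (\<forall>S'. P S' \<longrightarrow> card S' \<le> card S)"
    by (rule ex_max_card[OF rc(1)]) (auto simp: P_def)
  then obtain S where PS: "P S" and Smax: "\<And>S'. P S' \<Longrightarrow> card S' \<le> card S" by blast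
  define T where "T = CN S"
  have S: "x \<in> S" "S \<subseteq> V - {y}" "card S \<le> card T" using PS by (auto simp: P_def T_def)
  have ST: "E s t" "E t s" if "s \<in> S" "t \<in> T" for s t
    using that sgD(4) by (auto simp: T_def CN_def)
  have Tx: "E x t" if "t \<in> T" for t using ST(1) S(1) that by blast
  have TV: "T \<subseteq> V - {y}" using Tx sgD(3) nonadj by blast
  have disj: "S \<inter> T = {}" using ST(1) sgD(5) by blast
  have fin: "finite S" "finite T" using S(2) TV finite_sub by blast+
  have S1: "1 \<le> card S" using S(1) fin card_gt_0_iff[of S] by (auto simp: Suc_le_eq)
  then have T0: "T \<noteq> {}" using S(3) by auto
  then obtain t0 where t0: "t0 \<in> T" by auto
  have maxT: "card (nbrs E w \<inter> T) \<le> card S" if w: "w \<in> V - {y} - S - T" for w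
  proof (rule ccontr)
    assume n: "\<not> ?thesis"
    have "CN (insert w S) = nbrs E w \<inter> T" by (auto simp: CN_def T_def)
    then have "P (insert w S)" using w S n fin by (simp add: P_def)
    then have "card (insert w S) \<le> card S" by (rule Smax)
    then show False using w fin by simp
  qed
  have maxS: "card (nbrs E w \<inter> S) < card S" if w: "w \<in> V - {y} - S - T" for w
  proof -
    obtain s where "s \<in> S" "\<not> E s w" using w unfolding T_def CN_def by blast
    then have "s \<in> S" "s \<notin> nbrs E w" using sgD(4) by auto
    then have "nbrs E w \<inter> S \<subset> S" by blast
    then show ?thesis by (rule psubset_card_mono[OF fin(1)])
  qed
  \<comment> \<open>Neighbours on both sides would give a triangle \<open>w s t\<close> with
    \<open>t\<close> adjacent to \<open>x\<close>.\<close>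
  have excl: "nbrs E w \<inter> S = {}" if wT: "nbrs E w \<inter> T \<noteq> {}" for w
  proof (rule ccontr)
    assume "nbrs E w \<inter> S \<noteq> {}"
    then obtain s t where st: "s \<in> S" "E w s" "t \<in> T" "E w t" using wT by auto
    show False by (rule no_nbr_triangle[OF Tx[OF st(3)] sgD(4)[OF st(4)] ST(2)[OF st(1,3)] st(2)])
  qed
  define H where "H = S \<union> T"
  have H: "H \<subseteq> V - {y}" "x \<in> H" "T \<subseteq> H" using S TV by (auto simp: H_def)
  have HT: "H - T = S" using disj by (auto simp: H_def)
  note reg = region[OF H(1,2)]
  let ?D = "reach E (V - H) y"
  have DH: "?D \<inter> S = {}" "?D \<inter> T = {}" using reg(2) by (auto simp: H_def)
  have paths: "has_path E H x t (1 + 2 * i)" if "t \<in> T" "i < card S" for t i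
    unfolding H_def by (rule bipartite_path_opposite) (use fin ST disj S that in auto)
  have Dw: "w \<in> V - {y} - S - T" if "w \<in> ?D - {y}" for w using that reg(2) by (auto simp: H_def)
  have nyH: "nbrs E y \<subseteq> H"
  proof (rule ccontr)
    assume n: "\<not> nbrs E y \<subseteq> H"
    have "\<not> linked E T ?D y"
    proof
      assume l: "linked E T ?D y"
      show False
      proof (rule core_contra[OF _ _ H(3) T0 _ _ l, where r = "card S" and e = 2 and l = 1 and F = "{y}" and n = 0])
        show "card ?D + 1 < card V"
          by (rule card_two_outside[OF rc(1), of _ x t0]) (use reg(2) S H t0 TV disj DH rc in auto)
        show "card (nbrs E w \<inter> H) + 1 \<le> card S + (if nbrs E w \<inter> T = {} then 0 else 1)"
          if w: "w \<in> ?D - {y}" for w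
        proof (cases "nbrs E w \<inter> T = {}")
          case True
          then have "nbrs E w \<inter> H = nbrs E w \<inter> S" unfolding H_def by blast
          then show ?thesis using True maxS[OF Dw[OF w]] by simp
        next
          case False
          then have "nbrs E w \<inter> H = nbrs E w \<inter> T" using excl unfolding H_def by blast
          then show ?thesis using False maxT[OF Dw[OF w]] by simp
        qed
        show "?D - {y} \<noteq> {}" by (rule reg(7)[OF n])
        show "nbrs E w \<subseteq> ?D \<union> H" if "w \<in> ?D - {y}" for w using reg(6) that by blast
        show "has_path E {y} y y 0" by (rule has_path_refl) simp
      qed (use reg(2,3,5) H S1 paths rc in auto)
    qed
    then have "\<exists>Z c. Z \<noteq> {} \<and> Z \<subseteq> ?D - {y} \<and> c \<in> ?D - Z \<and> boundary E Z \<subseteq> insert c (H - T)"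
      by (intro not_linked_gap[OF reg(1)]) (use reg(4,6) DH in auto)
    then have gap: "\<exists>Z. \<exists>c. Z \<noteq> {} \<and> Z \<subseteq> ?D - {y} \<and> c \<in> ?D - Z \<and> boundary E Z \<subseteq> insert c S"
      unfolding HT .
    \<comment> \<open>A largest gap is chosen because the case \<open>card S = 2\<close>,
      \<open>3 \<le> k\<close> relies on maximality.\<close>
    define Q where "Q Z \<longleftrightarrow> (\<exists>c. Z \<noteq> {} \<and> Z \<subseteq> ?D - {y} \<and> c \<in> ?D - Z \<and> boundary E Z \<subseteq> insert c S)" for Z
    obtain Z0 where "Q Z0" using gap unfolding Q_def by blast
    then have "\<exists>Z. Q Z \<and> (\<forall>Z'. Q Z' \<longrightarrow> card Z' \<le> card Z)"
      by (rule ex_max_card[OF reg(4)]) (auto simp: Q_def)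
    then obtain Z where QZ: "Q Z" and Zmax: "\<And>Z'. Q Z' \<Longrightarrow> card Z' \<le> card Z" by blast
    then obtain c where Z: "Z \<noteq> {}" "Z \<subseteq> ?D - {y}" "c \<in> ?D" "c \<notin> Z" "boundary E Z \<subseteq> insert c S"
      unfolding Q_def by blast
    have Zxy: "Z \<subseteq> V - {x, y}" using Z(2) reg(5) by blast
    have "t0 \<notin> Z" "t0 \<notin> insert c S" using t0 Z(2,3) DH disj by blast+
    then have "3 \<le> card (boundary E Z)"
      using separator[OF Z(1) Zxy] Z(5) t0 TV by blast
    also have "\<dots> \<le> card (insert c S)" using Z(5) fin by (intro card_mono) auto
    also have "\<dots> \<le> card S + 1" using fin by (simp add: card_insert_if)
    finally have S2: "2 \<le> card S" by simp
    show False
    proof (cases "3 \<le> card S")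
      case True
      show False
      proof (rule bipartite_gap[OF S(1,2) TV T0 ST(1) disj _ True reg(1) _ reg(5) Z, where F = "{y}" and n = 0])
        show "card (nbrs E w \<inter> S) < card S" if "w \<in> Z" for w using maxS[OF Dw] Z(2) that by blast
        show "has_path E {y} y y 0" by (rule has_path_refl) simp
      qed (use reg(2,3) H S rc in \<open>auto simp: H_def\<close>)
    next
      case False
      then have "card S = 2" using S2 by simp
      then obtain a b where "S = {a, b}" "a \<noteq> b" by (auto simp: card_2_iff)
      then obtain u where u: "S = {x, u}" "u \<noteq> x" using S(1) by auto
      show False
      proof (cases "k = 2")
        case True
        \<comment> \<open>For \<open>k = 2\<close> the lengths 1 and 3 of the core are all that is
          needed, once the component of \<open>y\<close> sees \<open>T\<close>.\<close>
        have "boundary E ?D \<inter> T \<noteq> {}"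
        proof
          assume "boundary E ?D \<inter> T = {}"
          from reach_complement_boundary[OF sg H(3) this]
          have b: "boundary E (V - ?D - S) \<subseteq> {x, u}" unfolding HT using u by simp
          have "t0 \<in> V - ?D - S" using t0 TV DH disj by blast
          then show False using no_2_cut[OF _ _ b, of y] reg(3) u S(2) rc by blast
        qed
        then have "admissible E V x y k"
          by (rule direct_admissible[OF sg H(1) rc(3) _ H(3), where l = 1 and e = 2])
            (use paths True \<open>card S = 2\<close> in auto)
        then show False using counter by simp
      next
        case False
        then have "3 \<le> k" using k2 by simp
        show False
        proof (rule pair_gap[OF \<open>3 \<le> k\<close> u S(2) TV T0 ST(1) disj Z[unfolded H_def]])
          fix Z' c'
          assume "Z' \<noteq> {}" "Z' \<subseteq> reach E (V - (S \<union> T)) y - {y}"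
            "c' \<in> reach E (V - (S \<union> T)) y - Z'" "boundary E Z' \<subseteq> insert c' S"
          then have "Q Z'" unfolding Q_def H_def by blast
          then show "card Z' \<le> card Z" by (rule Zmax)
        qed
      qed
    qed
  qed
  have "x \<notin> nbrs E y" using nonadj sgD(4) by auto
  then have "nbrs E y \<subseteq> T \<or> nbrs E y \<subseteq> S - {x}"
    using nyH excl[of y] unfolding H_def by blast
  moreover have "T \<subseteq> nbrs E x" using Tx by auto
  ultimately show ?thesis
    using S disj ST(1) maxT by (intro exI[of _ S] exI[of _ T]) simp
qed

text \<open>A common neighbour \<open>t0\<close> leaves \<open>T\<close> and becomes the target,
  with the edge from \<open>t0\<close> to \<open>y\<close> as last stretch. Fewer than
  \<open>k\<close> members in \<open>S\<close> can be assumed, as otherwise the core alone gives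
  \<open>k\<close> lengths.\<close>

lemma twin_bipartite:
  assumes N: "nbrs E x = T" "nbrs E y = T"
    and S: "x \<in> S" "S \<subseteq> V - {y}" "\<And>s t. s \<in> S \<Longrightarrow> t \<in> T \<Longrightarrow> E s t" "card S \<le> card T" "S \<inter> T = {}"
    and maxT: "\<And>w. w \<in> V - {y} - S - T \<Longrightarrow> card (nbrs E w \<inter> T) \<le> card S"
  shows False
proof -
  have adj: "E x u \<longleftrightarrow> u \<in> T" "E u x \<longleftrightarrow> u \<in> T" "E y u \<longleftrightarrow> u \<in> T" "E u y \<longleftrightarrow> u \<in> T" for u
  proof -
    show "E x u \<longleftrightarrow> u \<in> T" using N(1) by (metis nbrs_iff)
    then show "E u x \<longleftrightarrow> u \<in> T" using sgD(4) by blast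
    show "E y u \<longleftrightarrow> u \<in> T" using N(2) by (metis nbrs_iff)
    then show "E u y \<longleftrightarrow> u \<in> T" using sgD(4) by blast
  qed
  have TV: "T \<subseteq> V - {x, y}" using adj sgD nonadj by blast
  have fin: "finite S" "finite T" using S(2) TV by (auto intro: finite_sub)
  have indep: "\<not> E u v" if "u \<in> T" "v \<in> T" for u v using no_triangle[of u v] that adj(1) by auto
  have T2: "2 \<le> card T" using card_nbrs_y N by simp
  then obtain t0 where t0: "t0 \<in> T" by fastforce
  have excl: "\<not> E w s" if "E w t" "t \<in> T" "s \<in> S" for w s t
    using no_nbr_triangle[of t w s] that adj(1)[of t] sgD(4)[of w t] S(3)[of s t] sgD(4)[of s t]
    by blast
  have Sk: "card S < k"
  proof (rule ccontr)
    assume n: "\<not> ?thesis"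
    have "has_path E V x y (2 + 2 * i)" if "i < k" for i
    proof -
      have p: "has_path E (S \<union> T) x t0 (1 + 2 * i)"
        by (rule bipartite_path_opposite) (use fin S t0 n that sgD(4) in auto)
      have q: "has_path E {t0, y} t0 y 1" using t0 adj TV by (intro has_path_edge) auto
      have "has_path E V x y (1 + 2 * i + 1)"
        by (rule has_path_join[OF p q]) (use S TV t0 rc in auto)
      then show ?thesis by simp
    qed
    then have "admissible E V x y k" unfolding admissible_def
      by (intro exI[of _ 2] exI[of _ 2]) auto
    then show False using counter by simp
  qed
  have T3: "3 \<le> card T"
  proof -
    let ?W = "V - {x, y} - T"
    have b: "boundary E ?W \<subseteq> T"
    proof
      fix u assume "u \<in> boundary E ?W"
      then obtain w where w: "w \<in> ?W" "E w u" "u \<notin> ?W" unfolding boundary_def by blast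
      then have "u \<noteq> x" "u \<noteq> y" using adj by blast+
      then show "u \<in> T" using w sgD(3) by blast
    qed
    have W0: "?W \<noteq> {}"
    proof
      assume W0: "?W = {}"
      have "nbrs E t0 \<subseteq> {x, y}"
      proof
        fix u assume "u \<in> nbrs E t0"
        then have "u \<in> V" "u \<notin> T" using indep t0 sgD(3) by auto
        then show "u \<in> {x, y}" using W0 by blast
      qed
      then have "card (nbrs E t0) \<le> 2" by (rule card_subset_pair_le_2)
      then show False using deg[of t0] t0 TV k2 by (auto simp: degree_eq_card_nbrs)
    qed
    have "3 \<le> card (boundary E ?W)" by (rule separator[OF W0]) (use b TV rc in blast)+
    also have "\<dots> \<le> card T" by (rule card_mono[OF fin(2) b])
    finally show ?thesis .
  qed
  define T' where "T' = T - {t0}"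
  have cT': "card T' = card T - 1" using t0 fin by (simp add: T'_def)
  \<comment> \<open>Removing \<open>t0\<close> may leave \<open>T'\<close> smaller than
    \<open>S\<close>. Then a vertex other than \<open>x\<close> is dropped from \<open>S\<close>,
    and the bound survives because \<open>T'\<close> itself has only \<open>card S0\<close>
    elements.\<close>
  have "\<exists>S0\<subseteq>S. x \<in> S0 \<and> card S0 \<le> card T'
      \<and> (\<forall>w\<in>V - {x, y} - S0 - T. card (nbrs E w \<inter> T') \<le> card S0)"
  proof (cases "card S < card T")
    case True
    have "card (nbrs E w \<inter> T') \<le> card S" if "w \<in> V - {x, y} - S - T" for w
    proof -
      have "card (nbrs E w \<inter> T') \<le> card (nbrs E w \<inter> T)"
        using fin by (intro card_mono) (auto simp: T'_def)
      also have "\<dots> \<le> card S" using that by (intro maxT) auto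
      finally show ?thesis .
    qed
    then show ?thesis using True cT' S(1) by (intro exI[of _ S]) auto
  next
    case False
    then have c: "card S = card T" using S(4) by simp
    have "\<not> S \<subseteq> {x}" using c T3 card_le_1_of_subset_singleton[of S x] by auto
    then obtain u where u: "u \<in> S" "u \<noteq> x" by blast
    have c0: "card (S - {u}) = card T'" using u fin c cT' by simp
    have "card (nbrs E w \<inter> T') \<le> card (S - {u})" for w
      unfolding c0 using fin by (intro card_mono) (auto simp: T'_def)
    then show ?thesis using u S(1) c0 by (intro exI[of _ "S - {u}"]) auto
  qed
  then obtain S0 where S0: "S0 \<subseteq> S" "x \<in> S0" "card S0 \<le> card T'"
    and max0: "\<And>w. w \<in> V - {x, y} - S0 - T \<Longrightarrow> card (nbrs E w \<inter> T') \<le> card S0" by blast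
  have fin0: "finite S0" "finite T'" using S0(1) fin by (auto simp: T'_def intro: finite_subset)
  have S0k: "card S0 < k" using card_mono[OF fin(1) S0(1)] Sk by simp
  have S01: "1 \<le> card S0" using S0(2) fin0 card_gt_0_iff[of S0] by (auto simp: Suc_le_eq)
  have T'0: "T' \<noteq> {}" using cT' T3 by force
  then obtain t1 where t1: "t1 \<in> T'" by auto
  define H where "H = S0 \<union> T'"
  have TT: "T = insert t0 T'" "t0 \<notin> T'" "T' \<subseteq> T" using t0 by (auto simp: T'_def)
  have HV: "H \<subseteq> V - {y}" "x \<in> H" "T' \<subseteq> H" using S0 S(2) TV TT by (auto simp: H_def)
  have t0H: "t0 \<in> V - {y} - H" using t0 TV S0(1) S(5) TT by (auto simp: H_def)
  have disj: "S0 \<inter> T' = {}" "S0 \<inter> T = {}" using S0(1) S(5) TT by blast+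
  let ?D = "reach E (V - {y} - H) t0"
  have D: "?D \<subseteq> V - {y} - H" by (rule reach_subset)
  have tD: "t0 \<in> ?D" by (rule reach_self[OF t0H])
  have anch: "anchored E ?D t0" by (rule reach_anchored[OF t0H])
  have Dw: "w \<in> V - {x, y} - S0 - T" if "w \<in> ?D - {t0}" for w
    using that D HV TT unfolding H_def by blast
  have nb: "nbrs E w \<subseteq> ?D \<union> H" if w: "w \<in> ?D - {t0}" for w
  proof
    fix u assume "u \<in> nbrs E w"
    then have u: "E w u" by simp
    have "u \<noteq> y" using Dw[OF w] adj u by blast
    then show "u \<in> ?D \<union> H"
      using reach_step[of w E "V - {y} - H" t0 u] w sgD(4)[OF u] sgD(3)[OF u] by blast
  qed
  \<comment> \<open>The degree of \<open>t0\<close> exceeds \<open>card S0 + 1\<close>, and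
    \<open>t0\<close> has no neighbour in \<open>T\<close>.\<close>
  have D0: "?D - {t0} \<noteq> {}"
  proof -
    have "card (insert y S0) \<le> k" using S0k fin0 by (simp add: card_insert_if)
    moreover have "k + 1 \<le> card (nbrs E t0)" using deg[of t0] t0 TV by (auto simp: degree_eq_card_nbrs)
    moreover have "card (nbrs E t0) \<le> card (insert y S0)" if "nbrs E t0 \<subseteq> insert y S0"
      using fin0 that by (intro card_mono) auto
    ultimately have "\<not> nbrs E t0 \<subseteq> insert y S0" by linarith
    then obtain v where "v \<in> nbrs E t0" "v \<notin> insert y S0" by blast
    then have v: "E t0 v" "v \<noteq> y" "v \<notin> S0" by auto
    then have "v \<notin> T" using indep t0 by blast
    then have "v \<in> V - {y} - H" using v sgD(3) TT by (auto simp: H_def)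
    then have "v \<in> ?D" using reach_step[OF tD sgD(4)[OF v(1)]] by blast
    then show ?thesis using v(1) sgD(5) by blast
  qed
  have max1: "card (nbrs E w \<inter> S0) < card S0" if w: "w \<in> ?D - {t0}" for w
  proof -
    have "x \<notin> nbrs E w" using Dw[OF w] adj by auto
    then have "nbrs E w \<inter> S0 \<subset> S0" using S0(2) by blast
    then show ?thesis by (rule psubset_card_mono[OF fin0(1)])
  qed
  have q: "has_path E {t0, y} t0 y 1" using t0 adj TV by (intro has_path_edge) auto
  have xD: "x \<notin> ?D" "t1 \<notin> ?D" using D HV(2,3) t1 by blast+
  show False
  proof (cases "linked E T' ?D t0")
    case True
    show False
    proof (rule core_contra[OF _ _ HV(3) T'0 _ _ True, where r = "card S0" and e = 2 and l = 1 and F = "{t0, y}" and n = 1])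
      show "card ?D + 1 < card V"
        by (rule card_two_outside[OF rc(1), of _ x y]) (use D xD rc in auto)
      show "card (nbrs E w \<inter> H) + 1 \<le> card S0 + (if nbrs E w \<inter> T' = {} then 0 else 1)"
        if w: "w \<in> ?D - {t0}" for w
      proof (cases "nbrs E w \<inter> T' = {}")
        case True
        then have "nbrs E w \<inter> H = nbrs E w \<inter> S0" unfolding H_def by blast
        then show ?thesis using True max1[OF w] by simp
      next
        case False
        then obtain t where "E w t" "t \<in> T'" by auto
        then have "\<not> E w s" if "s \<in> S" for s using excl[of w t s] TT(3) that by blast
        then have "nbrs E w \<inter> S0 = {}" using S0(1) by fastforce
        then have "nbrs E w \<inter> H = nbrs E w \<inter> T'" unfolding H_def by blast
        then show ?thesis using False max0[OF Dw[OF w]] by simp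
      qed
      show "has_path E H x t (1 + 2 * i)" if "t \<in> T'" "i < card S0" for t i
        unfolding H_def
        by (rule bipartite_path_opposite) (use fin0 S0 S(3) disj TT that sgD(4) in auto)
      show "{t0, y} \<inter> (H \<union> ?D) = {t0}" using tD t0H HV(1) D by blast
      show "?D - {t0} \<subseteq> V - {x, y}" using Dw by blast
    qed (use D HV D0 nb S01 q t0 TV rc in auto)
  next
    case False
    have "\<exists>Z c. Z \<noteq> {} \<and> Z \<subseteq> ?D - {t0} \<and> c \<in> ?D - Z \<and> boundary E Z \<subseteq> insert c (H - T')"
    proof (rule not_linked_gap[OF anch _ False])
      show "T' \<inter> ?D = {}" using D HV(3) by blast
      show "finite ?D" using D by (intro finite_sub) blast
    qed (rule nb)
    moreover have "H - T' = S0" using disj by (auto simp: H_def)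
    ultimately obtain Z c where Z: "Z \<noteq> {}" "Z \<subseteq> ?D - {t0}" "c \<in> ?D" "c \<notin> Z"
        "boundary E Z \<subseteq> insert c S0" by auto
    \<comment> \<open>All neighbours of \<open>x\<close> lie in \<open>T\<close>. The three
      attachments of \<open>Z\<close> thus include two members of \<open>S0\<close> other than
      \<open>x\<close>, which forces \<open>3 \<le> card S0\<close>.\<close>
    have "x \<notin> boundary E Z"
    proof
      assume "x \<in> boundary E Z"
      then obtain w where "w \<in> Z" "E w x" unfolding boundary_def by blast
      then show False using Dw[of w] Z(2) adj by blast
    qed
    then have bZ: "boundary E Z \<subseteq> insert c (S0 - {x})" using Z(5) by blast
    have "t1 \<notin> Z" "t1 \<notin> insert c S0" using t1 xD Z(2,3) disj by blast+
    then have "3 \<le> card (boundary E Z)"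
      using separator[OF Z(1)] Z(2,5) Dw t1 TT(3) TV by blast
    then have "2 \<le> card (S0 - {x})" by (rule card_ge_2_of_insert[OF _ bZ]) (use fin0 in auto)
    then have S3: "3 \<le> card S0" using S0(2) fin0 by simp
    show False
    proof (rule bipartite_gap[OF S0(2) _ _ T'0 _ disj(1) _ S3 anch _ _ Z, where F = "{t0, y}" and n = 1])
      show "card (nbrs E w \<inter> S0) < card S0" if "w \<in> Z" for w using max1 Z(2) that by blast
      show "{t0, y} \<inter> (S0 \<union> T' \<union> ?D) = {t0}" using tD t0H HV(1) D unfolding H_def by blast
      show "?D - {t0} \<subseteq> V - {x, y}" using Dw by blast
      show "?D \<subseteq> V - (S0 \<union> T')" using D unfolding H_def by blast
    qed (use q t0 TV TT rc S0 S in auto)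
  qed
qed

lemma contradiction: False
proof -
  interpret sw: critical V E y x k by (rule swap)
  obtain S T where 1: "x \<in> S" "S \<subseteq> V - {y}" "T \<subseteq> nbrs E x" "\<forall>s\<in>S. \<forall>t\<in>T. E s t"
      "card S \<le> card T" "S \<inter> T = {}" "\<forall>w\<in>V - {y} - S - T. card (nbrs E w \<inter> T) \<le> card S"
      "nbrs E y \<subseteq> T \<or> nbrs E y \<subseteq> S - {x}"
    using bipartite_case by blast
  obtain S' T' where 2: "y \<in> S'" "S' \<subseteq> V - {x}" "T' \<subseteq> nbrs E y" "card S' \<le> card T'" "S' \<inter> T' = {}"
      "nbrs E x \<subseteq> T' \<or> nbrs E x \<subseteq> S' - {y}"
    using sw.bipartite_case by blast
  have fin: "finite S" "finite S'" using 1(2) 2(2) finite_sub by blast+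
  have pos: "1 \<le> card S" "1 \<le> card S'" using 1(1) 2(1) fin card_gt_0_iff by (fastforce simp: Suc_le_eq)+
  then have ne: "T \<noteq> {}" "T' \<noteq> {}" using 1(5) 2(4) by auto
  have "nbrs E y \<subseteq> T \<and> nbrs E x \<subseteq> T'"
  proof (rule ccontr)
    assume "\<not> ?thesis"
    then consider "nbrs E y \<subseteq> T" "nbrs E x \<subseteq> S' - {y}" | "nbrs E y \<subseteq> S - {x}" "nbrs E x \<subseteq> T'"
      | "nbrs E y \<subseteq> S - {x}" "nbrs E x \<subseteq> S' - {y}"
      using 1(8) 2(6) by blast
    then show False
    proof cases
      case 1
      then have "T' \<subseteq> S'" using \<open>T \<subseteq> nbrs E x\<close> 2(3) by blast
      then show False using 2(5) ne by blast
    next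
      case 2
      then have "T \<subseteq> S" using \<open>T \<subseteq> nbrs E x\<close> \<open>T' \<subseteq> nbrs E y\<close> by blast
      then show False using 1(6) ne by blast
    next
      case 3
      \<comment> \<open>The sizes chase each other:
        \<open>card T' < card S \<le> card T < card S' \<le> card T'\<close>.\<close>
      have "card T' \<le> card (S - {x})" using 2(3) 3(1) fin by (intro card_mono) auto
      moreover have "card T \<le> card (S' - {y})" using 1(3) 3(2) fin by (intro card_mono) auto
      ultimately show False using 1(1,5) 2(1,4) fin pos by simp
    qed
  qed
  then have "nbrs E x = T" "nbrs E y = T" using 1(3) 2(3) by blast+
  then show False using twin_bipartite[of T S] 1 by blast
qed

end

section \<open>The induction on the number of vertices\<close>

theorem admissible_paths:
  fixes V :: "'a set"
  assumes "rooted V E x y" "V - {x, y} \<noteq> {}" "\<And>v. v \<in> V - {x, y} \<Longrightarrow> k + 1 \<le> degree E v"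
  shows "admissible E V x y k"
  using assms
proof (induction "card V" arbitrary: V E x y k rule: less_induct)
  case less
  show ?case
  proof (cases "2 \<le> k")
    case True
    have "admissible (del_edge E x y) V x y k"
    proof (rule ccontr)
      assume neg: "\<not> ?thesis"
      interpret critical V "del_edge E x y" x y k
      proof unfold_locales
        show "rooted V (del_edge E x y) x y" by (rule del_edge_rooted[OF less.prems(1)])
        show "\<not> del_edge E x y x y" by (simp add: del_edge_def)
        show "k + 1 \<le> degree (del_edge E x y) v" if "v \<in> V - {x, y}" for v
          using less.prems(3)[OF that] that by (subst del_edge_degree) auto
        show "admissible_thm V'" if "card V' < card V" for V' :: "'a set"
          unfolding admissible_thm_def using less.hyps[OF that] by blast
      qed (use less.prems True neg in auto)
      show False by (rule contradiction)
    qed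
    then show ?thesis by (rule del_edge_admissible)
  next
    case False
    \<comment> \<open>For \<open>k \<le> 1\<close> one path of length at least 2 suffices, and a
      path through a third vertex is one.\<close>
    obtain w where w: "w \<in> V" "w \<noteq> x" "w \<noteq> y" using less.prems(2) by auto
    obtain p where p: "is_path E V x y p" "w \<in> set p"
      using rooted_path_through[OF less.prems(1) w(1) less.prems(2)] by blast
    have "{x, y, w} \<subseteq> set p" using p unfolding is_path_def by auto
    then have "card {x, y, w} \<le> length p" by (metis card_length card_mono finite_set le_trans)
    then have "3 \<le> length p" using w rooted_basic(4)[OF less.prems(1)] by simp
    then have "2 \<le> length p - 1" by simp
    moreover have "has_path E V x y (length p - 1)"
      using p(1) unfolding has_path_def is_path_def by (auto intro!: exI[of _ p])
    then have "has_path E V x y (length p - 1 + 1 * i)" if "i < k" for i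
      using False that by (cases i) auto
    ultimately show ?thesis unfolding admissible_def by blast
  qed
qed

corollary admissible_thm: "admissible_thm V"
  unfolding admissible_thm_def
proof (intro allI impI)
  fix E x y k
  assume "rooted V E x y" "V - {x, y} \<noteq> {}" "\<forall>v\<in>V - {x, y}. k + 1 \<le> degree E v"
  then show "admissible E V x y k" by (intro admissible_paths) simp_all
qed

section \<open>Cycles of consecutive lengths\<close>

text \<open>With at most one outer neighbour, deleting it leaves a connected set that meets both
  \<open>W\<close> and its complement, although no edge leaves \<open>W\<close> inside it.\<close>

lemma two_connected_boundary:
  assumes "simple_graph V E" "two_connected V E" "W \<noteq> {}" "W \<subseteq> V" "W \<union> boundary E W \<noteq> V"
  shows "2 \<le> card (boundary E W)"
proof (rule ccontr)
  assume n: "\<not> ?thesis"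
  have bV: "boundary E W \<subseteq> V - W" by (rule boundary_subset[OF assms(1)])
  have "\<exists>S\<subseteq>V. connected_on S E \<and> W \<subseteq> S \<and> boundary E W \<inter> S = {} \<and> S - W \<noteq> {}"
  proof (cases "boundary E W = {}")
    case True
    then show ?thesis using assms by (intro exI[of _ V]) (auto simp: two_connected_def)
  next
    case False
    obtain v where v: "boundary E W \<subseteq> {v}" by (rule card_le_1E[OF finite_boundary[OF assms(1)] n])
    then have v: "boundary E W = {v}" using False by blast
    then have "v \<in> V" "v \<notin> W" using bV by auto
    then have "connected_on (V - {v}) E" using assms(2) by (simp add: two_connected_def)
    then show ?thesis using v assms(4,5) \<open>v \<notin> W\<close> \<open>v \<in> V\<close> by (intro exI[of _ "V - {v}"]) auto
  qed
  then obtain S where S: "connected_on S E" "W \<subseteq> S" "boundary E W \<inter> S = {}" "S - W \<noteq> {}" by blast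
  obtain w u where w: "w \<in> W" and u: "u \<in> S" "u \<notin> W" using assms(3) S(4) by blast
  have "(\<lambda>x y. E x y \<and> x \<in> S \<and> y \<in> S)\<^sup>*\<^sup>* w u"
    using S(1,2) w u unfolding connected_on_def by blast
  then have "u \<in> W"
  proof (induction rule: rtranclp_induct)
    case (step y z)
    then show ?case using boundaryI[of y W E z] S(3) by blast
  qed (rule w)
  then show False using u by simp
qed

lemma cycle_from_paths:
  assumes "has_path E S1 u v n" "has_path E S2 v u l" "S1 \<inter> S2 \<subseteq> {u, v}" "S1 \<union> S2 \<subseteq> V"
    and "u \<noteq> v" "3 \<le> n + l"
  shows "has_cycle_of_length V E (n + l)"
proof -
  obtain p where p: "p \<noteq> []" "hd p = u" "last p = v" "distinct p" "set p \<subseteq> S1"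
      "successively E p" "length p = Suc n"
    using assms(1) unfolding has_path_def by blast
  obtain q where q: "q \<noteq> []" "hd q = v" "last q = u" "distinct q" "set q \<subseteq> S2"
      "successively E q" "length q = Suc l"
    using assms(2) unfolding has_path_def by blast
  obtain q1 where q1: "q = v # q1" using q(1,2) by (cases q) auto
  then have "q1 \<noteq> []" "last q1 = u" using q(3) assms(5) by auto
  then obtain q2 where q2: "q1 = q2 @ [u]" by (metis append_butlast_last_id)
  have suc: "successively E (q2 @ [u])" "E v (hd (q2 @ [u]))"
    using q(6) unfolding q1 q2 by (auto simp: successively_Cons)
  define cs where "cs = p @ q2"
  have "successively E (p @ (q2 @ [u]))"
    using p(3,6) suc by (simp add: successively_append_iff)
  then have s: "successively E cs" "E (last cs) u"
    using p(1) unfolding cs_def by (cases "q2 = []"; simp add: successively_append_iff)+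
  have "distinct cs"
    unfolding cs_def using p(4,5) q(4,5) assms(3) unfolding q1 q2 by auto
  moreover have "set cs \<subseteq> V" unfolding cs_def using p(5) q(5) assms(4) unfolding q1 q2 by auto
  moreover have len: "length cs = n + l" unfolding cs_def using p(7) q(7) unfolding q1 q2 by simp
  moreover have "hd cs = u" unfolding cs_def using p(1,2) by simp
  moreover have "\<forall>i<length cs - 1. E (cs ! i) (cs ! Suc i)"
    using s(1) unfolding successively_conv_nth by auto
  ultimately have "is_cycle V E cs" unfolding is_cycle_def using s(2) assms(6) by simp
  then show ?thesis unfolding has_cycle_of_length_def using len by blast
qed

lemma core_cycles:
  assumes sg: "simple_graph V E" and "H \<subseteq> V" "R \<subseteq> V" "A \<subseteq> H" "A \<noteq> {}" "H \<inter> R = {}"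
    and "linked E A R c" "R - {c} \<noteq> {}" "\<And>w. w \<in> R - {c} \<Longrightarrow> nbrs E w \<subseteq> R \<union> H"
    and deg: "\<And>w. w \<in> R - {c} \<Longrightarrow> m = 1 \<or>
      card (nbrs E w \<inter> H) + (m + 1) \<le> degree E w + (if nbrs E w \<inter> A = {} then 0 else 1)"
    and paths: "\<And>a j. a \<in> A \<Longrightarrow> j < r \<Longrightarrow> has_path E F c a (l + j)" and F: "F \<subseteq> V" "F \<inter> R \<subseteq> {c}"
    and "1 \<le> l" "1 \<le> m" "m = 1 \<or> 2 \<le> r" "k + 1 \<le> m + r"
  shows "\<exists>l. \<forall>i<k. has_cycle_of_length V E (l + i)"
proof -
  \<comment> \<open>The full theorem takes the place of the induction hypothesis, so the size bound
    is met by \<open>lessI\<close>.\<close>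
  have "admissible_from E A R c m"
    by (rule core_paths[OF admissible_thm sg assms(2-6) lessI assms(7-9)]) (use deg in auto)
  then obtain l' d where l': "2 \<le> l'" "d \<in> {1, 2}"
      "\<And>i. i < m \<Longrightarrow> \<exists>a\<in>A. has_path E (insert a R) a c (l' + d * i)"
    unfolding admissible_from_def by blast
  have "c \<in> R" using assms(7) by (simp add: linked_def)
  have P: "has_cycle_of_length V E (l' + d * i + (l + j))" if ij: "i < m" "j < r" for i j
  proof -
    obtain a where a: "a \<in> A" "has_path E (insert a R) a c (l' + d * i)" using l'(3)[OF ij(1)] by blast
    show ?thesis
      by (rule cycle_from_paths[OF a(2) paths[OF a(1) ij(2)]])
        (use assms a(1) l'(1) F \<open>c \<in> R\<close> in auto)
  qed
  have "has_cycle_of_length V E (l' + l + i)" if "i < k" for i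
    by (rule ap_sum_consecutive[where m = m and r = r and d = d and k = k]) (use P l' assms that in auto)
  then show ?thesis by blast
qed

locale cycles =
  fixes V :: "'a set" and E and k :: nat
  assumes sg: "simple_graph V E" and tc: "two_connected V E"
    and deg: "\<And>v. v \<in> V \<Longrightarrow> k \<le> degree E v"
begin

lemmas sgD = simple_graphD[OF sg]

lemma finite_sub: "S \<subseteq> V \<Longrightarrow> finite S" using sgD(1) finite_subset by blast

lemmas separator = two_connected_boundary[OF sg tc]

lemma region:
  assumes "H \<subseteq> V - {x}" "x \<in> V"
  defines "R \<equiv> reach E (V - H) x"
  shows "anchored E R x" "R \<subseteq> V - H" "x \<in> R" "finite R"
    "\<And>w. w \<in> R \<Longrightarrow> nbrs E w \<subseteq> R \<union> H" "\<not> nbrs E x \<subseteq> H \<Longrightarrow> R - {x} \<noteq> {}"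
proof -
  have x: "x \<in> V - H" using assms by auto
  show a: "anchored E R x" unfolding R_def by (rule reach_anchored[OF x])
  show R: "R \<subseteq> V - H" unfolding R_def by (rule reach_subset)
  show xR: "x \<in> R" unfolding R_def by (rule reach_self[OF x])
  show "finite R" using R by (intro finite_sub) auto
  show nb: "nbrs E w \<subseteq> R \<union> H" if "w \<in> R" for w
  proof
    fix u assume "u \<in> nbrs E w"
    then have "E u w" "u \<in> V" using sgD by auto
    then show "u \<in> R \<union> H" using that reach_step[of w E "V - H" x u] unfolding R_def by auto
  qed
  assume "\<not> nbrs E x \<subseteq> H"
  then obtain u where "E x u" "u \<notin> H" unfolding nbrs_def by blast
  then show "R - {x} \<noteq> {}" using nbrs_subsetD[OF nb[OF xR]] sgD(5) by blast
qed

text \<open>The clique offers \<open>card K - 1\<close> consecutive lengths from \<open>x\<close> to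
  each contracted vertex. \<open>m\<close> is left open: it is 1 when these lengths suffice and
  \<open>k - card K + 2\<close> otherwise.\<close>

lemma clique_cycles:
  assumes K: "K \<subseteq> V" "clique E K" "x \<in> K" "2 \<le> card K" and v: "E x v" "v \<notin> K"
    and m: "1 \<le> m" "m = 1 \<or> 3 \<le> card K" "k' + 2 \<le> m + card K"
    and loss: "\<And>w. w \<in> V - K \<Longrightarrow> m = 1 \<or>
      card (nbrs E w \<inter> (K - {x})) + (m + 1) \<le> degree E w + (if nbrs E w \<inter> (K - {x}) = {} then 0 else 1)"
  shows "\<exists>l. \<forall>i<k'. has_cycle_of_length V E (l + i)"
proof -
  let ?A = "K - {x}"
  have fin: "finite K" using K(1) by (rule finite_sub)
  have cA: "card ?A = card K - 1" using K fin by simp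
  then have A0: "?A \<noteq> {}" using K(4) by force
  then obtain a where a: "a \<in> ?A" by blast
  have xV: "x \<in> V" using K by blast
  have A: "?A \<subseteq> V - {x}" using K by blast
  note reg = region[OF A xV]
  let ?R = "reach E (V - ?A) x"
  have l: "linked E ?A ?R x"
  proof (rule anchored_linked[OF reg(1)])
    show "?A \<inter> ?R = {}" using reg(2) by blast
    fix W assume W: "W \<noteq> {}" "W \<subseteq> ?R - {x}" "boundary E W \<inter> ?A = {}"
    have "boundary E W \<subseteq> ?R \<union> ?A"
    proof
      fix u assume "u \<in> boundary E W"
      then obtain w where w: "w \<in> W" "E w u" unfolding boundary_def by blast
      then have "w \<in> ?R" using W(2) by blast
      then show "u \<in> ?R \<union> ?A" by (rule nbrs_subsetD[OF reg(5) w(2)])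
    qed
    then have b: "boundary E W \<inter> ?R = boundary E W" using W(3) by blast
    have "2 \<le> card (boundary E W)"
    proof (rule separator[OF W(1)])
      show "W \<subseteq> V" using W(2) reg(2) by blast
      show "W \<union> boundary E W \<noteq> V" using a K(1) W(2,3) reg(2) by blast
    qed
    then show "2 \<le> card (boundary E W \<inter> ?R)" unfolding b .
  qed
  show ?thesis
  proof (rule core_cycles[OF sg _ _ subset_refl A0 _ l, where m = m and r = "card K - 1" and l = 1 and F = K])
    show "?R - {x} \<noteq> {}" by (rule reg(6)) (use v in auto)
    show "nbrs E w \<subseteq> ?R \<union> ?A" if "w \<in> ?R - {x}" for w using reg(5) that by blast
    show "m = 1 \<or> card (nbrs E w \<inter> ?A) + (m + 1) \<le> degree E w + (if nbrs E w \<inter> ?A = {} then 0 else 1)"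
      if "w \<in> ?R - {x}" for w by (rule loss) (use that reg(2) in blast)
    show "has_path E K x b (1 + j)" if "b \<in> ?A" "j < card K - 1" for b j
      by (rule clique_path) (use fin K that in auto)
  qed (use reg(2) K m in auto)
qed

text \<open>If only \<open>K - {x}\<close> were contracted, \<open>w1\<close> could lose one
  neighbour too many. Deleted from the region, \<open>w1\<close> is available to the closing paths,
  whose lengths then extend to \<open>card K\<close>.\<close>

lemma near_clique_cycles:
  assumes K: "K \<subseteq> V" "clique E K" "x \<in> K" "3 \<le> card K" "card K \<le> k"
    and maximal: "\<And>K'. K' \<subseteq> V \<Longrightarrow> clique E K' \<Longrightarrow> card K' \<le> card K"
    and w1: "w1 \<in> V - K" "K - {x} \<subseteq> nbrs E w1"
  shows "\<exists>l. \<forall>i<k. has_cycle_of_length V E (l + i)"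
proof -
  let ?A = "K - {x}"
  define H where "H = insert w1 ?A"
  have fin: "finite K" using K(1) by (rule finite_sub)
  have cA: "card ?A = card K - 1" using K fin by simp
  then have A0: "?A \<noteq> {}" using K(4) by force
  have xV: "x \<in> V" using K by blast
  have w1a: "E w1 a" "E a w1" if "a \<in> ?A" for a
  proof -
    have "a \<in> nbrs E w1" using that w1(2) by blast
    then show "E w1 a" "E a w1" using sgD(4) by auto
  qed
  have Ka: "E x a" "E a x" if "a \<in> ?A" for a using that K by (auto simp: clique_def)
  have clH: "clique E H" using w1a clique_subset[OF K(2), of ?A] unfolding H_def by (auto simp: clique_def)
  have cH: "card H = card K" using cA w1(1) fin K(4) by (simp add: H_def)
  have finH: "finite H" using fin by (simp add: H_def)
  have H: "H \<subseteq> V - {x}" "?A \<subseteq> H" using K w1 by (auto simp: H_def)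
  have xw1: "\<not> E x w1"
  proof
    assume "E x w1"
    then have "clique E (insert w1 K)" using w1a K(2) sgD(4) by (auto simp: clique_def)
    then have "card (insert w1 K) \<le> card K" using K w1 by (intro maximal) auto
    then show False using w1(1) fin by simp
  qed
  have ex_p: "\<exists>p\<in>?A. p \<noteq> b" for b
  proof -
    have "\<not> ?A \<subseteq> {b}" using cA K(4) card_le_1_of_subset_singleton[of ?A b] by linarith
    then show ?thesis by blast
  qed
  note reg = region[OF H(1) xV]
  let ?R = "reach E (V - H) x"
  have nxH: "\<not> nbrs E x \<subseteq> H"
  proof
    assume "nbrs E x \<subseteq> H"
    then have "nbrs E x \<subseteq> ?A" using xw1 by (auto simp: H_def)
    then have "card (nbrs E x) \<le> card ?A" using fin by (intro card_mono) auto
    then show False using deg[OF xV] cA K(4,5) by (simp add: degree_eq_card_nbrs)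
  qed
  have RV: "?R \<subseteq> V" using reg(2) by blast
  show ?thesis
  proof (cases "linked E ?A ?R x")
    case True
    show ?thesis
    proof (rule core_cycles[OF sg _ RV H(2) A0 _ True, where m = "k - card K + 1" and r = "card K"
          and l = 1 and F = "insert w1 K"])
      show "?R - {x} \<noteq> {}" by (rule reg(6)[OF nxH])
      show "nbrs E w \<subseteq> ?R \<union> H" if "w \<in> ?R - {x}" for w using reg(5) that by blast
      show "k - card K + 1 = 1 \<or> card (nbrs E w \<inter> H) + (k - card K + 1 + 1)
          \<le> degree E w + (if nbrs E w \<inter> ?A = {} then 0 else 1)" if w: "w \<in> ?R - {x}" for w
      proof -
        have wV: "w \<in> V" "w \<notin> H" using w reg(2) by blast+
        have "card (nbrs E w \<inter> H) + 2 \<le> card K + (if nbrs E w \<inter> ?A = {} then 0 else 1)"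
        proof (cases "nbrs E w \<inter> ?A = {}")
          case True
          then have "nbrs E w \<inter> H \<subseteq> {w1}" by (auto simp: H_def)
          then have "card (nbrs E w \<inter> H) \<le> 1" by (rule card_le_1_of_subset_singleton)
          then show ?thesis using True K(4) by simp
        next
          case False
          \<comment> \<open>\<open>H\<close> is again a maximum clique, so no further vertex sees
            all of it.\<close>
          have "\<not> H \<subseteq> nbrs E w"
          proof
            assume sub: "H \<subseteq> nbrs E w"
            have "E w u" "E u w" if "u \<in> H" for u
            proof -
              have "u \<in> nbrs E w" using that sub by blast
              then show "E w u" "E u w" using sgD(4) by auto
            qed
            then have "clique E (insert w H)" using clH by (auto simp: clique_def)
            then have "card (insert w H) \<le> card K" using wV H by (intro maximal) auto
            then show False using wV finH cH by simp
          qed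
          then have "nbrs E w \<inter> H \<subset> H" by blast
          then have "card (nbrs E w \<inter> H) < card H" by (rule psubset_card_mono[OF finH])
          then show ?thesis using False cH by simp
        qed
        then show ?thesis using deg[OF wV(1)] K(5) by linarith
      qed
      show "has_path E (insert w1 K) x b (1 + j)" if b: "b \<in> ?A" "j < card K" for b j
      proof (cases "j < card K - 1")
        case True
        have "has_path E K x b (1 + j)" by (rule clique_path) (use fin K b True in auto)
        then show ?thesis by (rule has_path_mono) blast
      next
        case False
        \<comment> \<open>The extra length \<open>card K\<close> goes from \<open>x\<close> to
          \<open>p\<close> and then through all of the clique \<open>H\<close>.\<close>
        obtain p where p: "p \<in> ?A" "p \<noteq> b" using ex_p by blast
        have "has_path E H p b (card K - 1)"
          by (rule clique_path) (use finH clH p b H(2) cH K(4) in auto)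
        then have "has_path E (insert x H) x b (Suc (card K - 1))"
          by (rule has_path_Cons[where E = E, rotated]) (use Ka p H(1) in auto)
        moreover have "insert x H \<subseteq> insert w1 K" using K(3) by (auto simp: H_def)
        moreover have "Suc (card K - 1) = 1 + j" using False b(2) by simp
        ultimately show ?thesis using has_path_mono by metis
      qed
      show "insert w1 K \<inter> ?R \<subseteq> {x}" using reg(2) unfolding H_def by blast
      show "H \<inter> ?R = {}" using reg(2) by blast
    qed (use H K w1 in auto)
  next
    case False
    have "\<exists>Z c. Z \<noteq> {} \<and> Z \<subseteq> ?R - {x} \<and> c \<in> ?R - Z \<and> boundary E Z \<subseteq> insert c (H - ?A)"
    proof (rule not_linked_gap[OF reg(1) _ False reg(4)])
      show "?A \<inter> ?R = {}" using reg(2) H(2) by blast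
      show "nbrs E w \<subseteq> ?R \<union> H" if "w \<in> ?R - {x}" for w using reg(5) that by blast
    qed
    moreover have "H - ?A = {w1}" using w1(1) by (auto simp: H_def)
    ultimately obtain Z c where Z: "Z \<noteq> {}" "Z \<subseteq> ?R - {x}" "c \<in> ?R" "c \<notin> Z"
        "boundary E Z \<subseteq> {c, w1}" by auto
    have w1R: "w1 \<notin> ?R" using reg(2) by (auto simp: H_def)
    have ZV: "Z \<subseteq> V" using Z(2) RV by blast
    have bZ: "boundary E Z \<inter> ?R \<subseteq> {c}" using Z(5) w1R by blast
    have anchZ: "anchored E (?R - Z) x" by (rule anchored_diff[OF reg(1) Z(2,4) bZ sgD(4)])
    have "c \<in> ?R - Z" using Z(3,4) by simp
    then obtain n where n: "has_path E (?R - Z) c x n" using anchored_path[OF anchZ] by blast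
    obtain a where a: "a \<in> ?A" using A0 by blast
    have aR: "a \<notin> ?R" "a \<noteq> w1"
    proof -
      show "a \<notin> ?R" using a reg(2) H(2) by blast
      show "a \<noteq> w1" using a w1(1) by blast
    qed
    have nbZ: "nbrs E w \<subseteq> Z \<union> {c, w1}" if "w \<in> Z" for w
      using nbrs_Un_boundary[OF that, of E] Z(5) by blast
    have l: "linked E {w1} (insert c Z) c"
    proof (rule linked_single)
      show "w1 \<notin> insert c Z" using w1R Z by blast
      fix W assume W: "W \<noteq> {}" "W \<subseteq> insert c Z - {c}"
      have b: "boundary E W \<subseteq> Z \<union> {c, w1}" using boundary_subset_Un[of W Z E] W(2) Z(5) by blast
      then have "boundary E W \<inter> insert w1 (insert c Z) = boundary E W" by blast
      moreover have "2 \<le> card (boundary E W)"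
      proof (rule separator[OF W(1)])
        show "W \<subseteq> V" using W(2) ZV by blast
        have "a \<notin> W" using aR W(2) Z(2) by blast
        moreover have "a \<notin> boundary E W" using b aR Z(2,3) by blast
        moreover have "a \<in> V" using a K by blast
        ultimately show "W \<union> boundary E W \<noteq> V" by blast
      qed
      ultimately show "2 \<le> card (boundary E W \<inter> insert w1 (insert c Z))" by simp
    qed simp
    have k3: "3 \<le> k" using K by simp
    show ?thesis
    \<comment> \<open>The gap is attached to \<open>c\<close> and \<open>w1\<close> only.
      Contracting the single vertex \<open>w1\<close> costs nothing, so degree \<open>k\<close>
      allows \<open>m = k - 1\<close>; the closing paths from \<open>c\<close> pass through
      \<open>x\<close> into \<open>H\<close> and have at least two lengths.\<close>
    proof (rule core_cycles[OF sg _ _ subset_refl _ _ l, where m = "k - 1" and r = "card K - 1"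
          and l = "n + 2" and F = "(?R - Z) \<union> insert w1 K"])
      show "nbrs E w \<subseteq> insert c Z \<union> {w1}" if "w \<in> insert c Z - {c}" for w using nbZ[of w] that by blast
      show "k - 1 = 1 \<or> card (nbrs E w \<inter> {w1}) + (k - 1 + 1)
          \<le> degree E w + (if nbrs E w \<inter> {w1} = {} then 0 else 1)" if "w \<in> insert c Z - {c}" for w
      proof -
        have "k \<le> degree E w" using that ZV by (intro deg) blast
        moreover have "card (nbrs E w \<inter> {w1}) \<le> 1" by (rule card_le_1_of_subset_singleton) blast
        ultimately show ?thesis using k3 by (cases "nbrs E w \<inter> {w1} = {}") auto
      qed
      show "has_path E ((?R - Z) \<union> insert w1 K) c u (n + 2 + j)" if u: "u \<in> {w1}" "j < card K - 1" for u j
      proof -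
        have "has_path E H a w1 (1 + j)"
          by (rule clique_path) (use finH clH a aR H(2) cH u in \<open>auto simp: H_def\<close>)
        then have p: "has_path E (insert x H) x w1 (Suc (1 + j))"
          by (rule has_path_Cons[where E = E, rotated]) (use Ka a H(1) in auto)
        have "has_path E ((?R - Z) \<union> insert w1 K) c w1 (n + Suc (1 + j))"
          by (rule has_path_join[OF n p]) (use reg(2) K(3) in \<open>auto simp: H_def\<close>)
        then show ?thesis using u by simp
      qed
      show "((?R - Z) \<union> insert w1 K) \<inter> insert c Z \<subseteq> {c}"
        using Z(2,3) reg(2) w1R unfolding H_def by blast
      show "{w1} \<inter> insert c Z = {}" using w1R Z(2,3) by blast
      show "insert c Z \<subseteq> V" using Z(3) ZV RV by blast
    qed (use Z K w1 k3 RV in auto)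
  qed
qed

end

theorem theorem4p1:
  fixes V :: "'a set" and E :: "'a \<Rightarrow> 'a \<Rightarrow> bool" and k :: nat
  assumes "k \<ge> 2"
    and "simple_graph V E"
    and "two_connected V E"
    and "min_degree_ge V E k"
    and "has_cycle_of_length V E 3"
  shows "graph_iso V E (complete_verts (k + 1)) complete_edges
         \<or> (\<exists>l. \<forall>i < k. has_cycle_of_length V E (l + i))"
proof -
  interpret cycles V E k
    using assms by unfold_locales (auto simp: min_degree_ge_def)
  obtain cs where cs: "is_cycle V E cs" "length cs = 3"
    using assms(5) unfolding has_cycle_of_length_def by blast
  then obtain x a b where "cs = [x, a, b]" by (auto simp: numeral_3_eq_3 length_Suc_conv)
  then have tri: "E x a" "E a b" "E b x"
    using cs(1) unfolding is_cycle_def by (auto simp: numeral_2_eq_2 less_Suc_eq)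
  define P where "P K \<longleftrightarrow> K \<subseteq> V \<and> clique E K" for K
  have ab: "x \<in> V" "a \<in> V" "b \<in> V" "x \<noteq> a" "a \<noteq> b" "b \<noteq> x" using tri sgD by blast+
  have P3: "P {x, a, b}" using tri ab sgD(4) by (auto simp: P_def clique_def)
  then have "\<exists>K. P K \<and> (\<forall>K'. P K' \<longrightarrow> card K' \<le> card K)"
    by (rule ex_max_card[OF sgD(1)]) (auto simp: P_def)
  then obtain K where PK: "P K" and Kmax: "\<And>K'. P K' \<Longrightarrow> card K' \<le> card K" by blast
  have K: "K \<subseteq> V" "clique E K" using PK by (auto simp: P_def)
  have fin: "finite K" using K(1) by (rule finite_sub)
  have K3: "3 \<le> card K" using Kmax[OF P3] ab by simp
  show ?thesis
  proof (cases "card K \<le> k")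
    case True
    show ?thesis
    proof (cases "\<exists>x\<in>K. \<exists>w\<in>V - K. K - {x} \<subseteq> nbrs E w")
      case near: True
      then obtain x w where xw: "x \<in> K" "w \<in> V - K" "K - {x} \<subseteq> nbrs E w" by blast
      have "card K' \<le> card K" if "K' \<subseteq> V" "clique E K'" for K'
        by (rule Kmax) (use that in \<open>simp add: P_def\<close>)
      then show ?thesis using near_clique_cycles[OF K xw(1) K3 True _ xw(2,3)] by blast
    next
      case far: False
      have "K \<noteq> {}" using K3 by auto
      then obtain x where x: "x \<in> K" by blast
      have cA: "card (K - {x}) = card K - 1" using x fin by simp
      have "\<not> nbrs E x \<subseteq> K - {x}"
      proof
        assume "nbrs E x \<subseteq> K - {x}"
        then have "card (nbrs E x) \<le> card (K - {x})" using fin by (intro card_mono) auto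
        then show False using deg[of x] x K(1) cA True K3 by (auto simp: degree_eq_card_nbrs)
      qed
      then obtain v where "v \<in> nbrs E x" "v \<notin> K - {x}" by blast
      then have v: "E x v" "v \<notin> K" using sgD(5) by auto
      have "\<exists>l. \<forall>i<k. has_cycle_of_length V E (l + i)"
      \<comment> \<open>Every outside vertex has at most \<open>card K - 2\<close> neighbours in
        \<open>K - {x}\<close>, so a vertex seeing that set keeps degree at least
        \<open>k - card K + 3 = m + 1\<close> after contraction.\<close>
      proof (rule clique_cycles[OF K x _ v, where m = "k - card K + 2"])
        fix w assume w: "w \<in> V - K"
        have "card (nbrs E w \<inter> (K - {x})) + 3 \<le> card K + (if nbrs E w \<inter> (K - {x}) = {} then 0 else 1)"
        proof (cases "nbrs E w \<inter> (K - {x}) = {}")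
          case True
          then show ?thesis using K3 by simp
        next
          case False
          have "nbrs E w \<inter> (K - {x}) \<subset> K - {x}" using far w x by blast
          then have "card (nbrs E w \<inter> (K - {x})) < card (K - {x})"
            using fin by (intro psubset_card_mono) auto
          then show ?thesis using False cA by simp
        qed
        moreover have "k \<le> degree E w" using w by (intro deg) blast
        ultimately show "k - card K + 2 = 1 \<or> card (nbrs E w \<inter> (K - {x})) + (k - card K + 2 + 1)
            \<le> degree E w + (if nbrs E w \<inter> (K - {x}) = {} then 0 else 1)"
          using True by linarith
      qed (use K3 True in auto)
      then show ?thesis by blast
    qed
  next
    case False
    then have "k + 1 \<le> card K" by simp
    \<comment> \<open>A clique on \<open>k + 1\<close> vertices already offers \<open>k\<close>
      lengths. Unless it is the whole graph, one return path outside it closes all the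
      cycles.\<close>
    then obtain K1 where K1: "K1 \<subseteq> K" "card K1 = k + 1" by (meson obtain_subset_with_card_n)
    have K1V: "K1 \<subseteq> V" "clique E K1" using K1(1) K clique_subset by blast+
    show ?thesis
    proof (cases "K1 = V")
      case True
      have "finite K1" using K1V(1) by (rule finite_sub)
      then obtain f where f: "bij_betw f V {..<k + 1}"
        using K1(2) True by (metis ex_bij_betw_finite_nat atLeast0LessThan)
      have "E u v \<longleftrightarrow> f u \<noteq> f v" if "u \<in> V" "v \<in> V" for u v
      proof -
        have "f u = f v \<longleftrightarrow> u = v" using f that unfolding bij_betw_def inj_on_def by blast
        moreover have "u \<noteq> v \<Longrightarrow> E u v" using K1V(2) True that by (simp add: clique_def)
        ultimately show ?thesis using sgD(5) by blast
      qed
      then have "graph_iso V E (complete_verts (k + 1)) complete_edges"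
        unfolding graph_iso_def complete_verts_def complete_edges_def using f by blast
      then show ?thesis ..
    next
      case False
      have "boundary E K1 \<noteq> {}"
      proof
        assume "boundary E K1 = {}"
        moreover have "K1 \<noteq> {}" using K1(2) by auto
        ultimately have "2 \<le> card (boundary E K1)" using separator[of K1] K1V False by simp
        then show False using \<open>boundary E K1 = {}\<close> by simp
      qed
      then obtain x v where xv: "x \<in> K1" "E x v" "v \<notin> K1" unfolding boundary_def by blast
      have "\<exists>l. \<forall>i<k. has_cycle_of_length V E (l + i)"
        by (rule clique_cycles[OF K1V xv(1) _ xv(2,3), where m = 1]) (use K1(2) assms(1) in auto)
      then show ?thesis ..
    qed
  qed
qed

end
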